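(* Assume that $N_R<N$. If $\beta>c^{-1}(\rho_{\min}/2)$, then $\beta>2\frac{\omega_{\max}}{b_{\min}}$, $c(\beta)<\rho_{\min}/2\le\omega_{\max}/2$, and the following hold. (a) (Modal dichotomy I.) $\sigma(A(\beta))=\sigma_0(A(\beta))\cup\sigma_1(A(\beta))$ with $\sigma_0(A(\beta))\cap\sigma_1(A(\beta))=\emptyset$, and there exist unique invariant subspaces $H_{\ell\ell}(\beta)$, $H_{h\ell}(\beta)$ of $A(\beta)$ with $H=H_{h\ell}(\beta)\oplus H_{\ell\ell}(\beta)$, $\sigma(A(\beta)|_{H_{\ell\ell}(\beta)})=\sigma_0(A(\beta))$, $\sigma(A(\beta)|_{H_{h\ell}(\beta)})=\sigma_1(A(\beta))$; moreover $\dim H_{h\ell}(\beta)=N_R$ and $\dim H_{\ell\ell}(\beta)=2N-N_R$. (b) (Low-loss subspace eigenvalue bounds.) One has $$\sigma(A(\beta)|_{H_{\ell\ell}(\beta)})=\{\zeta\in\sigma(A(\beta)):0\le-\operatorname{Im}\zeta\le\omega_{\max}\},$$ $$\sigma(A(\beta)|_{H_{h\ell}(\beta)})=\{\zeta\in\sigma(A(\beta)):-\operatorname{Im}\zeta\ge\beta b_{\min}-\omega_{\max}>\omega_{\max}\},$$ $$\max_{\zeta\in\sigma(A(\beta)|_{H_{h\ell}(\beta)})}Q_\zeta\le\frac12\,\frac{\omega_{\max}}{\beta b_{\min}-\omega_{\max}}<\frac12,$$ and $$\max_{\zeta\in\sigma(A(\beta)|_{H_{\ell\ell}(\beta)})}\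 \min_{\rho\in\sigma(P_B^\perp\Omega P_B^\perp)}|\zeta-\rho|\le c(\beta);$$ in particular, for every $\zeta\in\sigma(A(\beta)|_{H_{\ell\ell}(\beta)})$, both $\min_{\rho\in\sigma(P_B^\perp\Omega P_B^\perp)}|\operatorname{Re}\zeta-\rho|$ and $-\operatorname{Im}\zeta$ lie in $[0,c(\beta)]$. (c) There exist unique invariant subspaces $H_{\ell\ell,0}(\beta)$, $H_{\ell\ell,1}(\beta)$ of $A(\beta)$ such that $$H_{\ell\ell}(\beta)=H_{\ell\ell,0}(\beta)\oplus H_{\ell\ell,1}(\beta),$$ $$\sigma\big(A(\beta)|_{H_{\ell\ell,0}(\beta)}\big)=\sigma(A(\beta))\cap D(0;c(\beta)),\qquad \sigma\big(A(\beta)|_{H_{\ell\ell,1}(\beta)}\big)=\sigma(A(\beta))\cap\bigcup_{0\ne\rho\in\sigma(P_B^\perp\Omega P_B^\perp)}D(\rho;c(\beta)).$$ (d) Furthermore, $$\sigma\big(A(\beta)|_{H_{\ell\ell,1}(\beta)}\big)=\sigma(A(\beta))\cap\{\zeta\in\mathbb C:\rho_{\min}/2<|\zeta|\le\omega_{\max}\},\qquad \sigma\big(A(\beta)|_{H_{\ell\ell,0}(\beta)}\big)=\sigma(A(\beta))\cap\{\zeta\in\mathbb C:|\zeta|<\rho_{\min}/2\}.$$ (e) Moreover, $$\dim H_{\ell\ell,1}(\beta)=\dim\operatorname{Ran}\big(P_B^\perp\Omega P_B^\perp\big),\qquad \dim H_{\ell\ell,0}(\beta)=2N-N_R-\dim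 H_{\ell\ell,1}(\beta).$$ In particular, if $\operatorname{Ker}R\cap\operatorname{Ker}\eta=\{0\}$ then $\dim H_{\ell\ell,1}(\beta)=2(N-N_R)$.
   Context: Setting. $N\ge 1$; $\alpha,\eta,\theta,R$ are real $N\times N$ matrices with $\alpha^{\mathrm T}=\alpha>0$, $\eta^{\mathrm T}=\eta\ge0$, $\theta^{\mathrm T}=-\theta$, $R^{\mathrm T}=R\ge0$, and $N_R=\operatorname{rank}R>0$; $\beta\ge0$. $\sqrt{\cdot}$ denotes the positive semidefinite square root. On $H=\mathbb C^{2N}=\mathbb C^N\oplus\mathbb C^N$ set $$\Omega=\begin{bmatrix}-2\mathrm i\sqrt\alpha^{-1}\theta\sqrt\alpha^{-1} & -\mathrm i\Phi^{\mathrm T}\\ \mathrm i\Phi&0\end{bmatrix},\quad \Phi=\sqrt\eta\sqrt\alpha^{-1},\quad B=\begin{bmatrix}\sqrt\alpha^{-1}R\sqrt\alpha^{-1}&0\\0&0\end{bmatrix},\quad A(\beta)=\Omega-\mathrm i\beta B .$$ $\Omega$ is Hermitian, $B\ge0$, $\operatorname{rank}B=N_R$. $P_B^\perp$ is the orthogonal projection onto $\operatorname{Ker}B$. $\rho_{\min}$ denotes the smallest positive eigenvalue of the Hermitian matrix $P_B^\perp\Omega P_B^\perp$; it is defined whenever $P_B^\perp\Omega P_B^\perp\ne0$, which the source asserts to be equivalent to $N_R<N$. $\omega_{\max}=\|\Omega\|$ is the largest eigenvalue of $\Omega$; $b_{\min}$ is the smallest nonzero eigenvalue of $B$ (equivalently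 of $\alpha^{-1}R$); $0=b_0<b_1\le\dots\le b_{N_R}$ are the eigenvalue $0$ and the nonzero eigenvalues of $B$ (with multiplicity). $D(\rho;r)=\{\lambda\in\mathbb C:|\lambda-\rho|\le r\}$, $D_j(\beta)=D(-\mathrm i\beta b_j;\omega_{\max})$, $\sigma_0(A(\beta))=\sigma(A(\beta))\cap D_0(\beta)$, $\sigma_1(A(\beta))=\sigma(A(\beta))\cap\bigcup_{j=1}^{N_R}D_j(\beta)$. The quality factor is $Q_\zeta=\frac12\frac{|\operatorname{Re}\zeta|}{-\operatorname{Im}\zeta}$, with $Q_\zeta=+\infty$ if $\operatorname{Im}\zeta=0\ne\operatorname{Re}\zeta$ and $Q_0=0$. The function $c$ and its inverse are $$c(\beta)=\frac{2\omega_{\max}^2}{b_{\min}}\Big[\beta-\frac{2\omega_{\max}}{b_{\min}}\Big]^{-1}\ \Big(\beta>\frac{2\omega_{\max}}{b_{\min}}\Big),\qquad c^{-1}(y)=\frac{2\omega_{\max}^2}{b_{\min}}y^{-1}+\frac{2\omega_{\max}}{b_{\min}}\ (y>0).$$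
   Formalization: The theorem additionally assumes P_B^⊥ΩP_B^⊥ ≠ 0, so that ρ_min exists; N_R < N alone does not guarantee this (for example η = θ = 0 gives Ω = 0, and then ρ_min is undefined). *)

theory Defs
  imports "HOL-Analysis.Analysis" "HOL-Library.Multiset"
begin

section \<open>Real symmetric matrices\<close>

definition psd :: "real^'n^'n \<Rightarrow> bool" where
  "psd M \<longleftrightarrow> transpose M = M \<and> (\<forall>x. 0 \<le> x \<bullet> (M *v x))"

definition pos_def :: "real^'n^'n \<Rightarrow> bool" where
  "pos_def M \<longleftrightarrow> transpose M = M \<and> (\<forall>x. x \<noteq> 0 \<longrightarrow> 0 < x \<bullet> (M *v x))"

definition psd_sqrt :: "real^'n^'n \<Rightarrow> real^'n^'n" where
  "psd_sqrt M = (THE S. psd S \<and> S ** S = M)"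

section \<open>Complex matrices and their invariant subspaces\<close>

definition cscale :: "complex \<Rightarrow> complex^'n^'m \<Rightarrow> complex^'n^'m" where
  "cscale c M = map_matrix (\<lambda>z. c * z) M"

definition hermitian_adjoint :: "complex^'n^'m \<Rightarrow> complex^'m^'n" where
  "hermitian_adjoint M = transpose (map_matrix cnj M)"

text \<open>The direct sum of two coordinate spaces is indexed by the sum of the index types;
  \<open>Inl\<close> indexes the first summand.\<close>

definition block_matrix ::
  "'a^'n^'k \<Rightarrow> 'a^'m^'k \<Rightarrow> 'a^'n^'l \<Rightarrow> 'a^'m^'l \<Rightarrow> 'a^('n::finite + 'm::finite)^('k::finite + 'l::finite)"
where
  "block_matrix P Q S T = (\<chi> i j.
     (case i of
        Inl k \<Rightarrow> (case j of Inl n \<Rightarrow> P $ k $ n | Inr m \<Rightarrow> Q $ k $ m)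
      | Inr l \<Rightarrow> (case j of Inl n \<Rightarrow> S $ l $ n | Inr m \<Rightarrow> T $ l $ m)))"

definition invariant_subspace :: "complex^'n^'n \<Rightarrow> (complex^'n) set \<Rightarrow> bool" where
  "invariant_subspace A W \<longleftrightarrow> vec.subspace W \<and> (\<forall>v\<in>W. A *v v \<in> W)"

text \<open>Spectrum of the restriction of \<open>A\<close> to \<open>W\<close>, as the set of its eigenvalues.\<close>

definition spectrum_on :: "complex^'n^'n \<Rightarrow> (complex^'n) set \<Rightarrow> complex set" where
  "spectrum_on A W = {\<zeta>. \<exists>v\<in>W. v \<noteq> 0 \<and> A *v v = \<zeta> *s v}"

abbreviation spectrum :: "complex^'n^'n \<Rightarrow> complex set" where
  "spectrum A \<equiv> spectrum_on A UNIV"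

lemma spectrum_on_iff_not_bij:
  assumes "invariant_subspace A W"
  shows "\<zeta> \<in> spectrum_on A W \<longleftrightarrow> \<not> bij_betw (\<lambda>v. A *v v - \<zeta> *s v) W W"
proof -
  let ?f = "\<lambda>v. A *v v - \<zeta> *s v"
  have W: "vec.subspace W" and inv: "\<And>v. v \<in> W \<Longrightarrow> A *v v \<in> W"
    using assms by (auto simp: invariant_subspace_def)
  have lin: "Vector_Spaces.linear (*s) (*s) ?f"
    by unfold_locales (simp_all add: algebra_simps vector_smult_assoc matrix_vector_right_distrib
        vector_scalar_commute vec.scale_right_distrib vec.scale_right_diff_distrib mult.commute)
  have sub: "?f ` W \<subseteq> W"
    using W inv by (auto intro!: vec.subspace_diff vec.subspace_scale)
  have "\<zeta> \<notin> spectrum_on A W \<longleftrightarrow> inj_on ?f W"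
    unfolding vec.linear_inj_on_iff_eq_0[OF lin W] by (auto simp: spectrum_on_def)
  moreover have "?f ` W = W" if "inj_on ?f W"
  proof -
    have "vec.dim (?f ` W) = vec.dim W"
      using vec.dim_image_eq[OF lin, of W] that W by (simp add: vec.span_eq_iff[THEN iffD2])
    then show ?thesis
      using vec.subspace_dim_equal[OF vec.linear_subspace_image[OF lin W] W sub] by simp
  qed
  ultimately show ?thesis
    by (auto simp: bij_betw_def)
qed

definition direct_sum :: "(complex^'n) set \<Rightarrow> (complex^'n) set \<Rightarrow> (complex^'n) set \<Rightarrow> bool" where
  "direct_sum V U W \<longleftrightarrow> V = {u + w | u w. u \<in> U \<and> w \<in> W} \<and> U \<inter> W = {0}"

text \<open>\<open>U\<close> and \<open>W\<close> are invariant subspaces of \<open>A\<close>, \<open>V\<close> is their direct sum, and the restrictions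
  of \<open>A\<close> to them have the spectra \<open>S\<close> and \<open>T\<close>.\<close>

definition spectral_splitting ::
  "complex^'n^'n \<Rightarrow> (complex^'n) set \<Rightarrow> complex set \<Rightarrow> complex set \<Rightarrow>
    (complex^'n) set \<Rightarrow> (complex^'n) set \<Rightarrow> bool" where
  "spectral_splitting A V S T U W \<longleftrightarrow>
     invariant_subspace A U \<and> invariant_subspace A W \<and> direct_sum V U W \<and>
     spectrum_on A U = S \<and> spectrum_on A W = T"

definition orthogonal_projection :: "(complex^'n) set \<Rightarrow> complex^'n^'n" where
  "orthogonal_projection W =
     (THE P. P ** P = P \<and> hermitian_adjoint P = P \<and> range ((*v) P) = W)"

section \<open>Eigenvalues of Hermitian matrices\<close>

definition min_nonzero_eigenvalue :: "complex^'n^'n \<Rightarrow> real" where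
  "min_nonzero_eigenvalue M = Min {x. x \<noteq> 0 \<and> complex_of_real x \<in> spectrum M}"

text \<open>Meaningful only if \<open>M\<close> has a positive eigenvalue.\<close>

definition min_pos_eigenvalue :: "complex^'n^'n \<Rightarrow> real" where
  "min_pos_eigenvalue M = Min {x. 0 < x \<and> complex_of_real x \<in> spectrum M}"

text \<open>The eigenvalue \<open>0\<close> (once, at position \<open>0\<close>), followed by the nonzero eigenvalues in
  increasing order, each repeated according to its multiplicity. For Hermitian matrices the
  multiplicity is the dimension of the eigenspace.\<close>

definition zero_and_nonzero_eigenvalues :: "complex^'n^'n \<Rightarrow> real list" where
  "zero_and_nonzero_eigenvalues M =
     0 # sorted_list_of_multiset
           (\<Sum>x \<in> {x. x \<noteq> 0 \<and> complex_of_real x \<in> spectrum M}.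
              replicate_mset (vec.dim {v. M *v v = complex_of_real x *s v}) x)"

section \<open>The system operator\<close>

definition \<Phi>_matrix :: "real^'n^'n \<Rightarrow> real^'n^'n \<Rightarrow> real^'n^'n" where
  "\<Phi>_matrix \<alpha> \<eta> = psd_sqrt \<eta> ** matrix_inv (psd_sqrt \<alpha>)"

definition \<Omega>_matrix ::
  "real^'n^'n \<Rightarrow> real^'n^'n \<Rightarrow> real^'n^'n \<Rightarrow> complex^('n::finite + 'n)^('n + 'n)" where
  "\<Omega>_matrix \<alpha> \<eta> \<theta> = block_matrix
     (cscale (- 2 * \<i>) (map_matrix of_real (matrix_inv (psd_sqrt \<alpha>) ** \<theta> ** matrix_inv (psd_sqrt \<alpha>))))
     (cscale (- \<i>) (map_matrix of_real (transpose (\<Phi>_matrix \<alpha> \<eta>))))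
     (cscale \<i> (map_matrix of_real (\<Phi>_matrix \<alpha> \<eta>)))
     0"

definition B_matrix ::
  "real^'n^'n \<Rightarrow> real^'n^'n \<Rightarrow> complex^('n::finite + 'n)^('n + 'n)" where
  "B_matrix \<alpha> R = block_matrix
     (map_matrix of_real (matrix_inv (psd_sqrt \<alpha>) ** R ** matrix_inv (psd_sqrt \<alpha>))) 0 0 0"

definition quality_factor :: "complex \<Rightarrow> ereal" where
  "quality_factor \<zeta> =
     (if Im \<zeta> = 0 then (if Re \<zeta> = 0 then 0 else \<infinity>)
      else ereal (1 / 2 * (\<bar>Re \<zeta>\<bar> / (- Im \<zeta>))))"

text \<open>The bound \<open>c\<close>, relevant for \<open>\<beta> > 2 * \<omega> / b\<close>, and its inverse function, relevant for \<open>y > 0\<close>;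
  here \<open>\<omega>\<close> and \<open>b\<close> stand for the norm of the first and the smallest nonzero eigenvalue of the
  second of the matrices above.\<close>

definition c_bound :: "real \<Rightarrow> real \<Rightarrow> real \<Rightarrow> real" where
  "c_bound \<omega> b \<beta> = 2 * \<omega>\<^sup>2 / b * inverse (\<beta> - 2 * \<omega> / b)"

definition c_bound_inv :: "real \<Rightarrow> real \<Rightarrow> real \<Rightarrow> real" where
  "c_bound_inv \<omega> b y = 2 * \<omega>\<^sup>2 / b * inverse y + 2 * \<omega> / b"

end

(* The form J = k^2 P - (1 - P), with P the projection onto Ker B and k = c / omega_max, satisfies a
   strict Lyapunov inequality for A shifted by i beta b_min / 2.  Hence J is positive on the low-loss
   subspace and negative on the high-loss one, which fixes both dimensions and shows that the low-loss
   subspace is the graph over Ker B of an operator of norm less than k.  On this graph A is a perturbation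
   of P Omega P by an operator of norm less than rho_min / 2.  If Q is the projection onto
   Ran (P Omega P), the form 2 Q - P then satisfies a strict Stein inequality for the circle of radius
   rho_min / 2, which counts the eigenvalues outside and inside that circle.  The eigenvalue bounds follow
   from the Schur complement with respect to Ker B.  Both inequalities give definiteness on invariant
   subspaces by one induction on the dimension, without deforming A. *)

theory Submission
  imports Defs "HOL-Computational_Algebra.Fundamental_Theorem_Algebra"
begin

subsection \<open>Complex vectors with their real inner product\<close>

text \<open>On complex vectors \<open>\<bullet>\<close> is the real part of the Hermitian inner
  product. For selfadjoint \<open>J\<close> the form \<open>(J *v v) \<bullet> v\<close> is
  therefore the Hermitian form, and imaginary parts are read off after multiplication by the
  imaginary unit. The obstacle is that \<open>A\<close> need not be normal: discs and residuals
  locate eigenvalues but do not count them with algebraic multiplicity, and eigenvectors need not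
  span the subspaces in question. A form that is definite on a whole invariant subspace does count:
  each of two dimensions is bounded from above by a trivial intersection with a known subspace, and
  since the two bounds add up to the dimension of the space being split, both are attained. The
  thresholds are midpoints. The values of - Im leave the gap from \<omega> to \<beta> b - \<omega>,
  whose centre is the shift \<beta> b / 2; the nonzero eigenvalues of P \<Omega> P have modulus at
  least \<rho>, so \<rho> / 2 separates them from 0. The lower bound on \<beta> gives c < \<rho> /
  2, and the slope k is such that \<omega> k = c bounds the perturbation on the graph.\<close>

lemma subspace_if_vec_subspace:
  fixes W :: "(complex^'n) set"
  assumes "vec.subspace W"
  shows "subspace W"
proof -
  have "c *\<^sub>R x = complex_of_real c *s x" for c and x :: "complex^'n"
    unfolding vec_eq_iff vector_scaleR_component vector_smult_component
    by (simp add: scaleR_conv_of_real)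
  then show ?thesis
    using assms by (simp add: subspace_def vec.subspace_def)
qed

lemma cscale_mult_vec: "cscale c M *v v = c *s (M *v v)"
  by (simp add: cscale_def matrix_vector_mult_def vec_eq_iff sum_distrib_left mult.assoc)

lemma inner_smult_left:
  fixes u v :: "complex^'n"
  shows "(c *s u) \<bullet> v = u \<bullet> (cnj c *s v)"
  unfolding inner_vec_def
  by (intro sum.cong) (simp_all add: inner_complex_def algebra_simps)

lemma inner_smult_right:
  fixes u v :: "complex^'n"
  shows "u \<bullet> (c *s v) = (cnj c *s u) \<bullet> v"
  by (simp add: inner_smult_left)

lemma norm_smult: "norm (c *s (v::complex^'n)) = cmod c * norm v"
  by (simp add: norm_vec_def norm_mult L2_set_right_distrib)

lemma inner_smult_self:
  fixes u :: "complex^'n"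
  shows "u \<bullet> (c *s u) = Re c * (u \<bullet> u)"
  unfolding inner_vec_def sum_distrib_left
  by (intro sum.cong) (simp_all add: inner_complex_def algebra_simps)

lemma inner_hermitian_adjoint:
  fixes M :: "complex^'n^'m"
  shows "(M *v u) \<bullet> v = u \<bullet> (hermitian_adjoint M *v v)"
proof -
  have "(M *v u) \<bullet> v = (\<Sum>i\<in>UNIV. \<Sum>j\<in>UNIV. (M$i$j * u$j) \<bullet> v$i)"
    by (simp add: inner_vec_def matrix_vector_mult_def inner_sum_left)
  also have "\<dots> = (\<Sum>i\<in>UNIV. \<Sum>j\<in>UNIV. u$j \<bullet> (cnj (M$i$j) * v$i))"
    by (intro sum.cong refl) (simp add: inner_complex_def algebra_simps)
  also have "\<dots> = u \<bullet> (hermitian_adjoint M *v v)"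
    by (subst sum.swap)
      (simp add: inner_vec_def matrix_vector_mult_def inner_sum_right hermitian_adjoint_def transpose_def)
  finally show ?thesis .
qed

text \<open>Only the real inner product occurs here. Since \<open>M\<close> is complex linear, this
  is still full Hermitian symmetry, as \<open>selfadjoint_iff\<close> confirms.\<close>

definition selfadjoint :: "complex^'n^'n \<Rightarrow> bool" where
  "selfadjoint M \<longleftrightarrow> (\<forall>u v. (M *v u) \<bullet> v = u \<bullet> (M *v v))"

lemma selfadjointD: "selfadjoint M \<Longrightarrow> (M *v u) \<bullet> v = u \<bullet> (M *v v)"
  by (simp add: selfadjoint_def)

lemma selfadjoint_iff: "selfadjoint M \<longleftrightarrow> hermitian_adjoint M = M"
proof
  assume M: "selfadjoint M"
  have "hermitian_adjoint M *v v = M *v v" for v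
  proof -
    have "u \<bullet> (hermitian_adjoint M *v v) = u \<bullet> (M *v v)" for u
      using M by (metis inner_hermitian_adjoint selfadjointD)
    then show ?thesis
      by (metis vector_eq_rdot inner_commute)
  qed
  then show "hermitian_adjoint M = M"
    by (simp add: matrix_eq)
qed (metis inner_hermitian_adjoint selfadjoint_def)

lemma selfadjoint_diff: "selfadjoint M \<Longrightarrow> selfadjoint N \<Longrightarrow> selfadjoint (M - N)"
  by (simp add: selfadjoint_def algebra_simps inner_diff)

lemma selfadjoint_cscale: "selfadjoint M \<Longrightarrow> selfadjoint (cscale (of_real r) M)"
  by (simp add: selfadjoint_def cscale_mult_vec inner_smult_left vector_scalar_commute)

lemma selfadjoint_id: "selfadjoint (mat 1)"
  by (simp add: selfadjoint_def)

text \<open>The Hermitian product of \<open>M *v u\<close> and \<open>u\<close> is real: its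
  imaginary part is, up to sign, the real inner product with \<open>\<i> *s u\<close>, which
  selfadjointness turns into its own negative.\<close>

lemma selfadjoint_smult:
  assumes "selfadjoint M"
  shows "(M *v u) \<bullet> (c *s u) = Re c * ((M *v u) \<bullet> u)"
proof -
  have split: "c *s w = complex_of_real (Re c) *s w + complex_of_real (Im c) *s (\<i> *s w)" for w :: "complex^'n"
    by (simp add: vec_eq_iff complex_eq_iff)
  have real: "a \<bullet> (complex_of_real r *s w) = r * (a \<bullet> w)" for r and a w :: "complex^'n"
    by (simp add: inner_vec_def sum_distrib_left inner_complex_def algebra_simps)
  have "(M *v u) \<bullet> (\<i> *s u) = u \<bullet> (\<i> *s (M *v u))"
    using assms by (simp add: selfadjointD vector_scalar_commute)
  also have "\<dots> = - ((\<i> *s u) \<bullet> (M *v u))"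
    by (simp add: inner_smult_left)
  finally have "(M *v u) \<bullet> (\<i> *s u) = 0"
    using inner_commute[of "M *v u" "\<i> *s u"] by linarith
  then show ?thesis
    using arg_cong[OF split[of u], of "\<lambda>w. (M *v u) \<bullet> w"]
    unfolding inner_add_right real by simp
qed

subsection \<open>Orthogonal complements and orthogonal projections\<close>

lemma orthogonal_comp_altdef: "W\<^sup>\<bottom> = {v. \<forall>w\<in>W. w \<bullet> v = 0}"
  by (auto simp: orthogonal_comp_def orthogonal_def inner_commute)

lemma vec_subspace_orthogonal_comp:
  fixes W :: "(complex^'n) set"
  assumes "vec.subspace W"
  shows "vec.subspace (W\<^sup>\<bottom>)"
  using assms
  by (auto simp: orthogonal_comp_altdef vec.subspace_def inner_add_right inner_smult_right)

lemma orthogonal_comp_decomp: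
  fixes W :: "(complex^'n) set"
  assumes "vec.subspace W"
  obtains w z where "v = w + z" "w \<in> W" "z \<in> W\<^sup>\<bottom>"
  using subspace_sum_orthogonal_comp[OF subspace_if_vec_subspace[OF assms]]
  by (metis UNIV_I set_plus_elim)

lemma orthogonal_comp_Int: "W \<inter> W\<^sup>\<bottom> \<subseteq> {0}"
  by (auto simp: orthogonal_comp_altdef)

lemma direct_sum_dim:
  assumes "direct_sum V U W" "vec.subspace U" "vec.subspace W"
  shows "vec.dim V = vec.dim U + vec.dim W"
  using vec.dim_sums_Int[OF assms(2,3)] assms(1) by (simp add: direct_sum_def)

lemma dim_orthogonal_comp:
  fixes W :: "(complex^'n) set"
  assumes W: "vec.subspace W"
  shows "vec.dim W + vec.dim (W\<^sup>\<bottom>) = CARD('n)"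
proof -
  have "direct_sum UNIV W (W\<^sup>\<bottom>)"
    unfolding direct_sum_def
  proof
    have "\<exists>w z. v = w + z \<and> w \<in> W \<and> z \<in> W\<^sup>\<bottom>" for v
      using orthogonal_comp_decomp[OF W, of v] by metis
    then show "UNIV = {w + z |w z. w \<in> W \<and> z \<in> W\<^sup>\<bottom>}" by blast
    show "W \<inter> W\<^sup>\<bottom> = {0}"
      using orthogonal_comp_Int[of W] vec.subspace_0[OF W]
        vec.subspace_0[OF vec_subspace_orthogonal_comp[OF W]] by blast
  qed
  from direct_sum_dim[OF this W vec_subspace_orthogonal_comp[OF W]] show ?thesis
    using vec_dim_card[where ?'a=complex and ?'n='n] by linarith
qed

lemma dim_add_le:
  fixes U W :: "(complex^'n) set"
  assumes "vec.subspace U" "vec.subspace W" "U \<inter> W \<subseteq> {0}"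
  shows "vec.dim U + vec.dim W \<le> CARD('n)"
proof -
  have "U \<inter> W = {0}"
    using assms by (auto simp: vec.subspace_0)
  then have "vec.dim {x + y |x y. x \<in> U \<and> y \<in> W} = vec.dim U + vec.dim W"
    using vec.dim_sums_Int[OF assms(1,2)] by simp
  then show ?thesis
    using dim_subset_UNIV_cart_gen[of "{x + y |x y. x \<in> U \<and> y \<in> W}"] by simp
qed

text \<open>The remainder of the orthogonal decomposition of a vector of \<open>W\<close> along
  \<open>U\<close> stays in \<open>W\<close>. This gives equality of subspaces without counting
  dimensions, for instance in the spectral theorem.\<close>

lemma subspace_eqI_orthogonal:
  fixes U W :: "(complex^'n) set"
  assumes U: "vec.subspace U" and W: "vec.subspace W" and sub: "U \<subseteq> W"
    and orth: "\<And>w. w \<in> W \<Longrightarrow> w \<in> U\<^sup>\<bottom> \<Longrightarrow> w = 0"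
  shows "U = W"
proof
  show "W \<subseteq> U"
  proof
    fix w assume w: "w \<in> W"
    obtain u z where uz: "w = u + z" "u \<in> U" "z \<in> U\<^sup>\<bottom>"
      using orthogonal_comp_decomp[OF U] by blast
    then have "z \<in> W"
      using w sub vec.subspace_diff[OF W w] by (metis add_diff_cancel_left' subsetD)
    then have "z = 0"
      using orth uz(3) by blast
    with uz show "w \<in> U" by simp
  qed
qed (rule sub)

lemma orthogonal_projection_unique:
  fixes P P' :: "complex^'n^'n"
  assumes P: "P ** P = P" "hermitian_adjoint P = P" "range ((*v) P) = W"
    and P': "P' ** P' = P'" "hermitian_adjoint P' = P'" "range ((*v) P') = W"
  shows "P = P'"
proof -
  have 1: "P *v (P' *v v) = P' *v v" "P' *v (P *v v) = P *v v" for v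
  proof -
    have "P' *v v \<in> range ((*v) P)" "P *v v \<in> range ((*v) P')"
      using P(3) P'(3) by auto
    then show "P *v (P' *v v) = P' *v v" "P' *v (P *v v) = P *v v"
      using P(1) P'(1) by (metis imageE matrix_vector_mul_assoc)+
  qed
  have "u \<bullet> (P *v v) = u \<bullet> (P' *v v)" for u v
    using 1 P(2) P'(2) by (metis selfadjointD selfadjoint_iff)
  then show ?thesis
    by (metis matrix_eq vector_eq_rdot inner_commute)
qed

lemma orthogonal_projection_exists:
  fixes W :: "(complex^'n) set"
  assumes W: "vec.subspace W"
  obtains P :: "complex^'n^'n" where "P ** P = P" "hermitian_adjoint P = P" "range ((*v) P) = W"
proof -
  note W' = vec_subspace_orthogonal_comp[OF W]
  have "\<exists>w. w \<in> W \<and> v - w \<in> W\<^sup>\<bottom>" for v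
    using orthogonal_comp_decomp[OF W, of v] by (metis add_diff_cancel_left')
  then obtain f where f: "\<And>v. f v \<in> W" "\<And>v. v - f v \<in> W\<^sup>\<bottom>"
    by metis
  have uniq: "f v = w" if "w \<in> W" "v - w \<in> W\<^sup>\<bottom>" for v w
  proof -
    have "(v - w) - (v - f v) \<in> W\<^sup>\<bottom>" "f v - w \<in> W"
      using vec.subspace_diff[OF W' that(2) f(2)[of v]] vec.subspace_diff[OF W f(1)[of v] that(1)]
      by blast+
    then show ?thesis
      using orthogonal_comp_Int[of W] by auto
  qed
  have add: "f (u + v) = f u + f v" for u v
    using vec.subspace_add[OF W f(1)[of u] f(1)[of v]] vec.subspace_add[OF W' f(2)[of u] f(2)[of v]]
    by (intro uniq) (simp_all add: algebra_simps)
  have scale: "f (c *s v) = c *s f v" for c v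
    using vec.subspace_scale[OF W f(1)[of v]] vec.subspace_scale[OF W' f(2)[of v]]
    by (intro uniq) (simp_all add: vec.scale_right_diff_distrib)
  have lin: "Vector_Spaces.linear (*s) (*s) f"
    by unfold_locales (simp_all add: algebra_simps vec.scale_right_distrib add scale)
  define P where "P = matrix f"
  have Pf: "P *v v = f v" for v
    by (simp add: P_def matrix_works[OF lin])
  have fix_W: "f w = w" if "w \<in> W" for w
    using that vec.subspace_0[OF W'] by (intro uniq) auto
  have orth: "f u \<bullet> (v - f v) = 0" for u v
    using f by (auto simp: orthogonal_comp_altdef)
  show ?thesis
  proof (rule that[of P])
    show "P ** P = P"
      by (simp add: matrix_eq flip: matrix_vector_mul_assoc) (simp add: Pf fix_W f)
    have "f u \<bullet> v = u \<bullet> f v" for u v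
      using orth[of u v] orth[of v u] by (simp add: inner_diff inner_commute)
    then show "hermitian_adjoint P = P"
      by (simp add: selfadjoint_def Pf flip: selfadjoint_iff)
    show "range ((*v) P) = W"
      using f fix_W by (auto simp: Pf image_iff) metis
  qed
qed

lemma orthogonal_projection:
  fixes W :: "(complex^'n) set"
  assumes W: "vec.subspace W"
  defines "P \<equiv> orthogonal_projection W"
  shows "P *v (P *v v) = P *v v" "selfadjoint P" "P *v v \<in> W" "w \<in> W \<Longrightarrow> P *v w = w"
    "w \<in> W\<^sup>\<bottom> \<Longrightarrow> P *v w = 0"
proof -
  have "\<exists>!P. P ** P = P \<and> hermitian_adjoint P = P \<and> range ((*v) P) = W"
    by (metis orthogonal_projection_exists[OF W] orthogonal_projection_unique)
  from theI'[OF this] have P: "P ** P = P" "hermitian_adjoint P = P" "range ((*v) P) = W"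
    unfolding P_def orthogonal_projection_def by blast+
  then show 1: "P *v (P *v v) = P *v v" "selfadjoint P" "P *v v \<in> W" for v
    by (auto simp: matrix_vector_mul_assoc selfadjoint_iff)
  show "w \<in> W \<Longrightarrow> P *v w = w"
    using P by (metis imageE matrix_vector_mul_assoc)
  assume "w \<in> W\<^sup>\<bottom>"
  then have "(P *v w) \<bullet> (P *v w) = 0"
    using 1 by (auto simp: orthogonal_comp_altdef selfadjointD inner_commute)
  then show "P *v w = 0" by simp
qed

lemma projection_norm:
  assumes "selfadjoint P" "\<And>v. P *v (P *v v) = P *v v"
  shows "(norm v)\<^sup>2 = (norm (P *v v))\<^sup>2 + (norm (v - P *v v))\<^sup>2"
proof -
  have "(P *v v) \<bullet> v = (P *v v) \<bullet> (P *v v)"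
    using assms by (metis selfadjointD)
  then show ?thesis
    unfolding power2_norm_eq_inner by (simp add: inner_diff inner_commute)
qed

lemma selfadjoint_kernel:
  assumes "selfadjoint M"
  shows "{v. M *v v = 0} = (range ((*v) M))\<^sup>\<bottom>"
proof (rule set_eqI)
  fix v
  have "M *v v = 0 \<longleftrightarrow> (\<forall>u. u \<bullet> (M *v v) = 0)"
    by (metis inner_eq_zero_iff inner_zero_right)
  then show "v \<in> {v. M *v v = 0} \<longleftrightarrow> v \<in> (range ((*v) M))\<^sup>\<bottom>"
    using assms by (simp add: orthogonal_comp_altdef selfadjoint_def)
qed

lemma subspace_range: "vec.subspace (range ((*v) (M::complex^'n^'m)))"
  by (rule vec.linear_subspace_image[OF matrix_vector_mul_linear_gen vec.subspace_UNIV])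

lemma subspace_kernel: "vec.subspace {v. M *v v = (0::complex^'m)}"
  by (auto simp: vec.subspace_def algebra_simps vector_scalar_commute)

subsection \<open>Polynomials in a matrix\<close>

text \<open>Horner's scheme over an arbitrary field, so that it serves both the real square root and
  the complex invariant subspaces.\<close>

definition mat_poly :: "'a::field poly \<Rightarrow> 'a^'n^'n \<Rightarrow> 'a^'n^'n" where
  "mat_poly p A = fold_coeffs (\<lambda>a S. mat a + A ** S) p 0"

lemma mat_mult_vec: "mat a *v v = a *s (v :: 'a::semiring_1^'n)"
  by (simp add: vec_eq_iff matrix_vector_mult_def mat_def if_distrib if_distribR cong: if_cong)

lemma mat_poly_0 [simp]: "mat_poly 0 A = 0"
  by (simp add: mat_poly_def)

lemma mat_poly_pCons: "mat_poly (pCons a p) A = mat a + A ** mat_poly p A"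
proof (cases "a = 0 \<and> p = 0")
  case True
  have "mat 0 = (0 :: 'a^'n^'n)" by (simp add: mat_def vec_eq_iff)
  with True show ?thesis by (simp add: mat_poly_def)
qed (auto simp: mat_poly_def)

lemma mat_poly_pCons_vec:
  "mat_poly (pCons a p) A *v v = a *s v + A *v (mat_poly p A *v v)"
  by (simp add: mat_poly_pCons mat_mult_vec matrix_vector_mult_add_rdistrib matrix_vector_mul_assoc)

lemma mat_poly_add: "mat_poly (p + q) A *v v = mat_poly p A *v v + mat_poly q A *v v"
  by (induction p q rule: poly_induct2)
    (simp_all add: mat_poly_pCons_vec vec.scale_left_distrib matrix_vector_right_distrib)

lemma mat_poly_smult: "mat_poly (smult c p) A *v v = c *s (mat_poly p A *v v)"
  by (induction p)
    (simp_all add: mat_poly_pCons_vec vec.scale_right_distrib vector_scalar_commute)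

lemma mat_poly_minus: "mat_poly (- p) A *v v = - (mat_poly p A *v v)"
  using mat_poly_smult[of "- 1" p A v] by simp

lemma mat_poly_mult: "mat_poly (p * q) A *v v = mat_poly p A *v (mat_poly q A *v v)"
  by (induction p) (simp_all add: mat_poly_pCons_vec mat_poly_add mat_poly_smult)

lemma mat_poly_commute: "mat_poly p A *v (A *v v) = A *v (mat_poly p A *v v)"
  by (induction p) (simp_all add: mat_poly_pCons_vec matrix_vector_right_distrib vector_scalar_commute)

lemma mat_poly_sum: "mat_poly (\<Sum>i\<in>I. p i) A *v v = (\<Sum>i\<in>I. mat_poly (p i) A *v v)"
  by (induction I rule: infinite_finite_induct) (simp_all add: mat_poly_add)

lemma mat_poly_eigenvector:
  assumes "A *v v = x *s v"
  shows "mat_poly p A *v v = poly p x *s v"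
  by (induction p)
    (simp_all add: mat_poly_pCons_vec assms vector_scalar_commute vec.scale_left_distrib
      vector_smult_assoc mult.commute)

lemma mat_poly_invariant:
  assumes "invariant_subspace A W" "v \<in> W"
  shows "mat_poly p A *v v \<in> W"
  using assms
  by (induction p)
    (auto simp: mat_poly_pCons_vec invariant_subspace_def vec.subspace_0 vec.subspace_add vec.subspace_scale)

text \<open>The n + 1 iterates of \<open>v\<close> under \<open>A\<close>, with exponents 0 to n,
  are linearly dependent in dimension n, and a dependence relation is a polynomial.\<close>

lemma mat_poly_annihilates_vec:
  fixes A :: "'a::field^'n^'n"
  obtains p where "p \<noteq> 0" "mat_poly p A *v v = 0"
proof -
  define x where "x i = mat_poly (monom 1 i) A *v v" for i
  show ?thesis
  proof (cases "inj_on x {..CARD('n)}")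
    \<comment> \<open>Dependence is a property of sets of vectors, so a repetition among the
      iterates is treated apart; there the difference of two monomials works.\<close>
    case False
    then obtain i j where ij: "i \<noteq> j" "x i = x j"
      by (auto simp: inj_on_def)
    define p where "p = monom 1 i + - monom (1::'a) j"
    have "coeff p i \<noteq> 0"
      using ij by (simp add: p_def)
    then have "p \<noteq> 0"
      by (metis coeff_0)
    moreover have "mat_poly p A *v v = 0"
      unfolding p_def mat_poly_add mat_poly_minus using ij by (simp add: x_def)
    ultimately show ?thesis by (rule that)
  next
    case True
    then have "card (x ` {..CARD('n)}) > CARD('n)"
      by (simp add: card_image)
    then have "vec.dependent (x ` {..CARD('n)})"
      using vec.dim_subset_UNIV[of "x ` {..CARD('n)}"] vec.dim_eq_card_independent
      by (fastforce simp: vec.dimension_def card_cart_basis)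
    then obtain u i where u: "(\<Sum>w\<in>x ` {..CARD('n)}. u w *s w) = 0" "i \<le> CARD('n)" "u (x i) \<noteq> 0"
      by (auto simp: vec.dependent_finite)
    define p where "p = (\<Sum>i\<le>CARD('n). smult (u (x i)) (monom 1 i))"
    have "coeff p i = u (x i)"
      using u(2) by (simp add: p_def coeff_sum if_distrib cong: if_cong)
    then have "p \<noteq> 0"
      using u(3) by auto
    moreover have "mat_poly p A *v v = 0"
      using u(1) by (simp add: p_def mat_poly_sum mat_poly_smult sum.reindex[OF True] o_def flip: x_def)
    ultimately show ?thesis by (rule that)
  qed
qed

text \<open>The product of annihilating polynomials of the basis vectors annihilates each of them,
  since the factor belonging to a given basis vector can be applied first.\<close>

lemma mat_poly_annihilates:
  fixes A :: "'a::field^'n^'n"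
  obtains p where "p \<noteq> 0" "\<And>v. mat_poly p A *v v = 0"
proof -
  have "\<exists>p. p \<noteq> 0 \<and> mat_poly p A *v axis i 1 = 0" for i :: 'n
    using mat_poly_annihilates_vec by metis
  then obtain p where p: "\<And>i. p i \<noteq> 0" "\<And>i. mat_poly (p i) A *v axis i 1 = 0"
    by metis
  define q where "q = (\<Prod>i\<in>UNIV. p i)"
  have "mat_poly q A *v axis i 1 = 0" for i
  proof -
    have "q = (\<Prod>j\<in>UNIV - {i}. p j) * p i"
      by (simp add: q_def prod.remove[of UNIV i] mult.commute)
    then show ?thesis
      by (simp add: mat_poly_mult p)
  qed
  then have "mat_poly q A *v v = 0" for v
    by (subst basis_expansion[symmetric, of v])
      (simp add: vec.linear_sum[OF matrix_vector_mul_linear_gen] vector_scalar_commute)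
  moreover have "q \<noteq> 0"
    by (simp add: q_def p)
  ultimately show ?thesis using that by blast
qed

subsection \<open>Spectra of restrictions\<close>

lemma spectrum_on_mono: "W \<subseteq> W' \<Longrightarrow> spectrum_on A W \<subseteq> spectrum_on A W'"
  by (auto simp: spectrum_on_def)

lemma finite_spectrum_on [simp]: "finite (spectrum_on A W)"
proof -
  obtain p where p: "p \<noteq> 0" "\<And>v. mat_poly p A *v v = 0"
    using mat_poly_annihilates[of A] by metis
  have "spectrum_on A W \<subseteq> {x. poly p x = 0}"
  proof
    fix x assume "x \<in> spectrum_on A W"
    then obtain v where "v \<noteq> 0" "A *v v = x *s v"
      by (auto simp: spectrum_on_def)
    then show "x \<in> {x. poly p x = 0}"
      using p(2)[of v] mat_poly_eigenvector[of A v x p] by (auto simp: vec.scale_eq_0_iff)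
  qed
  then show ?thesis
    using poly_roots_finite[OF p(1)] by (rule finite_subset)
qed

text \<open>Take an annihilating polynomial \<open>p\<close> of \<open>v\<close> of least degree and
  split off a root: \<open>p = [:- z, 1:] * q\<close>. By minimality \<open>q(A) v\<close> is
  nonzero, and it is an eigenvector for \<open>z\<close> that lies in \<open>W\<close> by
  invariance.\<close>

lemma spectrum_on_nonempty:
  assumes W: "invariant_subspace A W" and v: "v \<in> W" "v \<noteq> 0"
  shows "spectrum_on A W \<noteq> {}"
proof -
  define P where "P p \<longleftrightarrow> p \<noteq> 0 \<and> mat_poly p A *v v = 0" for p
  obtain p0 where "p0 \<noteq> 0" "mat_poly p0 A *v v = 0"
    by (rule mat_poly_annihilates_vec)
  then have "P p0" by (simp add: P_def)
  then obtain p where p: "P p" and min: "\<And>q. P q \<Longrightarrow> degree p \<le> degree q"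
    using arg_min_nat_lemma[of P p0 degree] by blast
  have "degree p \<noteq> 0"
  proof
    assume "degree p = 0"
    then obtain a where "p = [:a:]" by (metis degree_eq_zeroE)
    with p v show False
      by (simp add: P_def mat_poly_pCons_vec vec.scale_eq_0_iff)
  qed
  then obtain z where "poly p z = 0"
    using fundamental_theorem_of_algebra[of p] by (auto simp: constant_degree)
  then obtain q where q: "p = [:- z, 1:] * q"
    by (metis poly_eq_0_iff_dvd dvdE)
  with p have "q \<noteq> 0" by (auto simp: P_def)
  then have "degree q < degree p"
    unfolding q by (subst degree_mult_eq) auto
  then have "mat_poly q A *v v \<noteq> 0"
    using min[of q] \<open>q \<noteq> 0\<close> by (auto simp: P_def)
  moreover have "A *v (mat_poly q A *v v) = z *s (mat_poly q A *v v)"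
    using p by (simp add: P_def q mat_poly_mult mat_poly_pCons_vec del: mult_pCons_left)
  ultimately show ?thesis
    using mat_poly_invariant[OF W v(1), of q] by (auto simp: spectrum_on_def)
qed

lemma subspace_0_if_spectrum_on_empty:
  assumes W: "invariant_subspace A W" and "spectrum_on A W = {}"
  shows "W = {0}"
  using spectrum_on_nonempty[OF W] assms by (auto simp: invariant_subspace_def vec.subspace_0)

lemma invariant_subspace_image:
  assumes W: "invariant_subspace A W"
  shows "invariant_subspace A ((*v) (mat_poly p A) ` W)"
  using W vec.linear_subspace_image[OF matrix_vector_mul_linear_gen, of W "mat_poly p A"]
  by (auto simp: invariant_subspace_def simp flip: mat_poly_commute)

lemma invariant_subspace_kernel:
  assumes W: "invariant_subspace A W"
  shows "invariant_subspace A {v \<in> W. mat_poly p A *v v = 0}"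
  using W by (auto simp: invariant_subspace_def mat_poly_commute vec.subspace_def algebra_simps vector_scalar_commute)

lemma invariant_subspace_UNIV [simp]: "invariant_subspace A UNIV"
  by (simp add: invariant_subspace_def)

lemma spectral_splittingD:
  assumes "spectral_splitting A V S T U W"
  shows "invariant_subspace A U" "invariant_subspace A W" "direct_sum V U W"
    "spectrum_on A U = S" "spectrum_on A W = T" "vec.subspace U" "vec.subspace W"
    "U \<subseteq> V" "W \<subseteq> V" "vec.dim V = vec.dim U + vec.dim W"
proof -
  show *: "invariant_subspace A U" "invariant_subspace A W" "direct_sum V U W"
    "spectrum_on A U = S" "spectrum_on A W = T" "vec.subspace U" "vec.subspace W"
    using assms by (auto simp: spectral_splitting_def invariant_subspace_def)
  then show "vec.dim V = vec.dim U + vec.dim W"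
    by (intro direct_sum_dim)
  have "u + 0 \<in> V" "0 + w \<in> V" if "u \<in> U" "w \<in> W" for u w
    using that *(3) vec.subspace_0[OF *(6)] vec.subspace_0[OF *(7)] unfolding direct_sum_def by blast+
  then show "U \<subseteq> V" "W \<subseteq> V"
    using vec.subspace_0[OF *(6)] vec.subspace_0[OF *(7)] by auto
qed

lemma poly_with_roots:
  fixes S :: "'a::idom set"
  assumes "finite S"
  obtains p where "\<And>x. poly p x = 0 \<longleftrightarrow> x \<in> S"
proof
  show "poly (\<Prod>a\<in>S. [:- a, 1:]) x = 0 \<longleftrightarrow> x \<in> S" for x
    using assms by (auto simp: poly_prod)
qed

text \<open>A polynomial \<open>p(A)\<close> that vanishes exactly on the eigenvalues in \<open>S\<close> and whose kernel in \<open>V\<close> has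
  maximal dimension splits \<open>V\<close> into its kernel and its image, as in Fitting's lemma.\<close>

lemma fitting_polynomial:
  fixes A :: "complex^'n^'n"
  assumes V: "invariant_subspace A V" and "finite S"
  obtains p where "\<And>x. poly p x = 0 \<longleftrightarrow> x \<in> S"
    "direct_sum V {v\<in>V. mat_poly p A *v v = 0} ((*v) (mat_poly p A) ` V)"
proof -
  define K where "K p = {v\<in>V. mat_poly p A *v v = 0}" for p
  define R where "R p \<longleftrightarrow> (\<forall>x. poly p x = 0 \<longleftrightarrow> x \<in> S)" for p :: "complex poly"
  have "\<exists>p. R p"
    using poly_with_roots[OF \<open>finite S\<close>] unfolding R_def by metis
  moreover have "vec.dim (K p) < Suc CARD('n)" for p
    using dim_subset_UNIV_cart_gen[of "K p"] by simp
  ultimately obtain p where p: "R p" and max: "\<And>q. R q \<Longrightarrow> vec.dim (K q) \<le> vec.dim (K p)"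
    using ex_has_greatest_nat[of R _ "\<lambda>p. vec.dim (K p)" "Suc CARD('n)"] by blast
  define f where "f = (*v) (mat_poly p A)"
  have lin: "Vector_Spaces.linear (*s) (*s) f"
    by (simp add: f_def)
  have subV: "vec.subspace V" using V by (simp add: invariant_subspace_def)
  have fV: "f ` V \<subseteq> V"
    using mat_poly_invariant[OF V] by (auto simp: f_def)
  have subfV: "vec.subspace (f ` V)"
    by (rule vec.linear_subspace_image[OF lin subV])
  \<comment> \<open>Squaring keeps the roots, so maximality forces \<open>p(A)\<close> and its
    square to have the same kernel in \<open>V\<close>: the stabilisation that Fitting's lemma
    obtains from high powers.\<close>
  have "R (p * p)"
    using p by (simp add: R_def)
  then have dim: "vec.dim (K (p * p)) \<le> vec.dim (K p)"
    by (rule max)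
  have sub: "vec.subspace (K q)" for q
    using invariant_subspace_kernel[OF V] by (auto simp: K_def invariant_subspace_def)
  have "K p \<subseteq> K (p * p)"
    by (auto simp: K_def mat_poly_mult)
  then have K_eq: "K p = K (p * p)"
    using dim by (intro vec.subspace_dim_equal sub)
  have inj: "w = 0" if w: "w \<in> f ` V" "f w = 0" for w
  proof -
    obtain v where v: "v \<in> V" "w = f v" using w by blast
    then have "v \<in> K (p * p)"
      using w(2) by (simp add: K_def f_def mat_poly_mult)
    then have "v \<in> K p" using K_eq by simp
    then show ?thesis using v by (simp add: K_def f_def)
  qed
  then have "inj_on f (f ` V)"
    using vec.linear_inj_on_iff_eq_0[OF lin subfV] by blast
  then have "vec.dim (f ` f ` V) = vec.dim (f ` V)"
    by (intro vec.dim_image_eq[OF lin]) (use subfV in \<open>simp add: vec.span_eq_iff[THEN iffD2]\<close>)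
  then have ffV: "f ` f ` V = f ` V"
    by (intro vec.subspace_dim_equal vec.linear_subspace_image[OF lin] subfV image_mono fV) simp
  have "direct_sum V {v\<in>V. f v = 0} (f ` V)"
    unfolding direct_sum_def
  proof
    show "{v \<in> V. f v = 0} \<inter> f ` V = {0}"
      using inj vec.subspace_0[OF subfV] vec.subspace_0[OF subV] vec.linear_0[OF lin] by auto
    have "\<exists>u w. v = u + w \<and> u \<in> {v\<in>V. f v = 0} \<and> w \<in> f ` V" if v: "v \<in> V" for v
    proof -
      obtain w where w: "w \<in> f ` V" "f v = f w"
        using ffV v by (metis imageE imageI)
      then have "v - w \<in> V" "f (v - w) = 0"
        using v fV subV by (auto simp: vec.subspace_diff vec.linear_diff[OF lin])
      with w show ?thesis
        by (intro exI[of _ "v - w"] exI[of _ w]) auto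
    qed
    moreover have "u + w \<in> V" if "u \<in> {v \<in> V. f v = 0}" "w \<in> f ` V" for u w
      using that fV by (intro vec.subspace_add[OF subV]) auto
    ultimately show "V = {u + w |u w. u \<in> {v \<in> V. f v = 0} \<and> w \<in> f ` V}"
      by blast
  qed
  then show ?thesis
    using p by (intro that[of p]) (auto simp: R_def f_def)
qed

text \<open>With \<open>p\<close> from \<open>fitting_polynomial\<close>, the kernel carries
  \<open>S\<close> and the image the rest, because an eigenvector in the image with eigenvalue in
  \<open>S\<close> would also lie in the kernel. For uniqueness, \<open>p(A)\<close> maps a
  competing \<open>U'\<close> into both \<open>U'\<close> and \<open>W\<close>; an invariant
  subspace with spectrum in \<open>S\<close> and in \<open>T\<close> is zero, so \<open>U'\<close>
  is contained in \<open>U\<close>. The kernel of \<open>p(A)\<close> in \<open>W'\<close> vanishes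
  for the same reason, which makes \<open>W'\<close> part of the image.\<close>

lemma spectral_splitting_unique_exists:
  fixes A :: "complex^'n^'n"
  assumes V: "invariant_subspace A V" and ST: "spectrum_on A V = S \<union> T" "S \<inter> T = {}"
  shows "\<exists>!H. spectral_splitting A V S T (fst H) (snd H)"
proof -
  have "finite S"
    using finite_spectrum_on[of A V] ST by (metis finite_Un)
  obtain p where p: "\<And>x. poly p x = 0 \<longleftrightarrow> x \<in> S"
    "direct_sum V {v\<in>V. mat_poly p A *v v = 0} ((*v) (mat_poly p A) ` V)"
    by (rule fitting_polynomial[OF V \<open>finite S\<close>]) blast
  define U where "U = {v\<in>V. mat_poly p A *v v = 0}"
  define W where "W = (*v) (mat_poly p A) ` V"
  note ds = p(2)[folded U_def W_def]
  have inv: "invariant_subspace A U" "invariant_subspace A W"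
    unfolding U_def W_def by (intro invariant_subspace_kernel invariant_subspace_image V)+
  then have sub: "vec.subspace U" "vec.subspace W"
    by (auto simp: invariant_subspace_def)
  have V_iff: "v \<in> V \<longleftrightarrow> (\<exists>u\<in>U. \<exists>w\<in>W. v = u + w)" and Int: "U \<inter> W = {0}" for v
    using ds unfolding direct_sum_def by blast+
  have UV: "U \<subseteq> V" "W \<subseteq> V"
    using mat_poly_invariant[OF V] by (auto simp: U_def W_def)
  have specU: "spectrum_on A U \<subseteq> S"
    using mat_poly_eigenvector[of A _ _ p] by (fastforce simp: spectrum_on_def U_def vec.scale_eq_0_iff p(1))
  have specW: "spectrum_on A W \<inter> S = {}"
  proof (rule ccontr)
    assume "spectrum_on A W \<inter> S \<noteq> {}"
    then obtain x v where v: "x \<in> S" "v \<in> W" "v \<noteq> 0" "A *v v = x *s v"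
      by (auto simp: spectrum_on_def)
    then have "v \<in> U"
      using mat_poly_eigenvector[OF v(4), of p] UV p(1)[of x] by (auto simp: U_def)
    then show False using v Int by blast
  qed
  have "spectrum_on A V \<subseteq> spectrum_on A U \<union> spectrum_on A W"
  proof
    fix x assume "x \<in> spectrum_on A V"
    then obtain v where v: "v \<in> V" "v \<noteq> 0" "A *v v = x *s v"
      by (auto simp: spectrum_on_def)
    then obtain u w where uw: "u \<in> U" "w \<in> W" "v = u + w"
      using V_iff by blast
    have "A *v u - x *s u = - (A *v w - x *s w)"
      using v(3) by (simp add: uw(3) algebra_simps vec.scale_right_distrib)
    moreover have "A *v u - x *s u \<in> U" "- (A *v w - x *s w) \<in> W"
      using uw inv sub
      by (auto simp: invariant_subspace_def intro!: vec.subspace_diff vec.subspace_scale vec.subspace_neg)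
    ultimately have "A *v u - x *s u = 0" "A *v w - x *s w = 0"
      using Int by (metis IntI singletonD neg_equal_0_iff_equal)+
    then show "x \<in> spectrum_on A U \<union> spectrum_on A W"
      using uw v(2) by (cases "w = 0") (auto simp: spectrum_on_def)
  qed
  then have spec: "spectrum_on A U = S" "spectrum_on A W = T"
    using specU specW ST spectrum_on_mono[OF UV(1), of A] spectrum_on_mono[OF UV(2), of A] by blast+
  show ?thesis
  proof (rule ex1I[of _ "(U, W)"])
    show "spectral_splitting A V S T (fst (U, W)) (snd (U, W))"
      using ds inv spec by (simp add: spectral_splitting_def)
    fix H assume "spectral_splitting A V S T (fst H) (snd H)"
    then obtain U' W' where H: "H = (U', W')" and *: "spectral_splitting A V S T U' W'"
      by (cases H) auto
    note D = spectral_splittingD[OF *]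
    have "(*v) (mat_poly p A) ` U' = {0}"
    proof (rule subspace_0_if_spectrum_on_empty)
      show "invariant_subspace A ((*v) (mat_poly p A) ` U')"
        by (intro invariant_subspace_image D)
      have "(*v) (mat_poly p A) ` U' \<subseteq> U'" "(*v) (mat_poly p A) ` U' \<subseteq> W"
        using mat_poly_invariant[OF D(1)] D(8) by (auto simp: W_def)
      then show "spectrum_on A ((*v) (mat_poly p A) ` U') = {}"
        using D(4) spec(2) ST(2) spectrum_on_mono by blast
    qed
    then have U': "U' \<subseteq> U"
      using D(8) by (auto simp: U_def)
    have "{v \<in> W'. mat_poly p A *v v = 0} = {0}"
    proof (rule subspace_0_if_spectrum_on_empty)
      show "invariant_subspace A {v \<in> W'. mat_poly p A *v v = 0}"
        by (intro invariant_subspace_kernel D)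
      have "{v \<in> W'. mat_poly p A *v v = 0} \<subseteq> U" "{v \<in> W'. mat_poly p A *v v = 0} \<subseteq> W'"
        using D(9) by (auto simp: U_def)
      then show "spectrum_on A {v \<in> W'. mat_poly p A *v v = 0} = {}"
        using D(5) spec(1) ST(2) spectrum_on_mono by blast
    qed
    then have "inj_on ((*v) (mat_poly p A)) W'"
      using vec.linear_inj_on_iff_eq_0[OF matrix_vector_mul_linear_gen D(7)] by blast
    then have "vec.dim ((*v) (mat_poly p A) ` W') = vec.dim W'"
      by (intro vec.dim_image_eq) (use D(7) in \<open>simp_all add: vec.span_eq_iff[THEN iffD2]\<close>)
    moreover have "(*v) (mat_poly p A) ` W' \<subseteq> W'"
      using mat_poly_invariant[OF D(2)] by auto
    ultimately have "(*v) (mat_poly p A) ` W' = W'"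
      using vec.subspace_dim_equal[OF vec.linear_subspace_image[OF matrix_vector_mul_linear_gen D(7)] D(7)]
      by simp
    then have W': "W' \<subseteq> W"
      using D(9) by (auto simp: W_def)
    have V_iff': "\<exists>u\<in>U'. \<exists>w\<in>W'. v = u + w" if "v \<in> V" for v
      using D(3) that unfolding direct_sum_def by blast
    have "v \<in> U'" if "v \<in> U" "u \<in> U'" "w \<in> W'" "v = u + w" for u v w
    proof -
      have "w \<in> U"
        using that U' vec.subspace_diff[OF sub(1), of v u] by auto
      then have "w = 0" using that W' Int by blast
      then show ?thesis using that by simp
    qed
    then have "U \<subseteq> U'"
      using V_iff' UV by blast
    moreover have "v \<in> W'" if "v \<in> W" "u \<in> U'" "w \<in> W'" "v = u + w" for u v w
    proof -
      have "u \<in> W"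
        using that W' vec.subspace_diff[OF sub(2), of v w] by auto
      then have "u = 0" using that U' Int by blast
      then show ?thesis using that by simp
    qed
    then have "W \<subseteq> W'"
      using V_iff' UV by blast
    ultimately show "H = (U, W)"
      using H U' W' by blast
  qed
qed

subsection \<open>Selfadjoint matrices\<close>

lemma inner_smult_real:
  fixes u v :: "complex^'n"
  shows "(complex_of_real r *s u) \<bullet> v = r * (u \<bullet> v)" "u \<bullet> (complex_of_real r *s v) = r * (u \<bullet> v)"
  by (simp_all add: inner_vec_def sum_distrib_left inner_complex_def algebra_simps)

lemma selfadjoint_eigenvalue_real:
  assumes M: "selfadjoint M" and v: "M *v v = z *s v" "v \<noteq> 0"
  shows "z = complex_of_real (Re z)"
proof -
  have "0 = (z *s v) \<bullet> (\<i> *s v)"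
    using selfadjoint_smult[OF M, of v \<i>] v by simp
  also have "\<dots> = Im z * (v \<bullet> v)"
    by (simp add: inner_smult_left vector_smult_assoc inner_smult_self)
  finally show ?thesis
    using v(2) by (simp add: complex_eq_iff)
qed

lemma selfadjoint_spectrum_real:
  assumes "selfadjoint M" "z \<in> spectrum_on M W"
  obtains x where "z = complex_of_real x"
  using assms selfadjoint_eigenvalue_real[OF assms(1)] by (auto simp: spectrum_on_def)

lemma selfadjoint_eigenvectors_orthogonal:
  assumes "selfadjoint M" "M *v u = complex_of_real x *s u" "M *v v = complex_of_real y *s v" "x \<noteq> y"
  shows "u \<bullet> v = 0"
proof -
  have "x * (u \<bullet> v) = y * (u \<bullet> v)"
    using selfadjointD[OF assms(1), of u v] assms(2,3) by (simp add: inner_smult_real)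
  with assms(4) show ?thesis by simp
qed

text \<open>The members of a family may be zero, so no basis has to be chosen and \<open>X\<close>
  may contain numbers that are not eigenvalues.\<close>

definition eigenspace_sum :: "complex^'n^'n \<Rightarrow> (complex^'n) set \<Rightarrow> real set \<Rightarrow> (complex^'n) set" where
  "eigenspace_sum M W X =
     {\<Sum>x\<in>X. f x | f. \<forall>x\<in>X. f x \<in> W \<and> M *v f x = complex_of_real x *s f x}"

lemma eigenspace_sumI:
  "(\<And>x. x \<in> X \<Longrightarrow> f x \<in> W \<and> M *v f x = complex_of_real x *s f x) \<Longrightarrow> (\<Sum>x\<in>X. f x) \<in> eigenspace_sum M W X"
  by (auto simp: eigenspace_sum_def)

lemma subspace_eigenspace_sum:
  assumes "vec.subspace W"
  shows "vec.subspace (eigenspace_sum M W X)"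
proof (rule vec.subspaceI)
  have "(\<Sum>x\<in>X. 0) \<in> eigenspace_sum M W X"
    using assms by (intro eigenspace_sumI) (auto simp: vec.subspace_0)
  then show "0 \<in> eigenspace_sum M W X" by simp
next
  fix u v assume "u \<in> eigenspace_sum M W X" "v \<in> eigenspace_sum M W X"
  then obtain f g where fg: "u = (\<Sum>x\<in>X. f x)" "v = (\<Sum>x\<in>X. g x)"
    "\<And>x. x \<in> X \<Longrightarrow> f x \<in> W \<and> M *v f x = complex_of_real x *s f x"
    "\<And>x. x \<in> X \<Longrightarrow> g x \<in> W \<and> M *v g x = complex_of_real x *s g x"
    by (auto simp: eigenspace_sum_def)
  have "(\<Sum>x\<in>X. f x + g x) \<in> eigenspace_sum M W X"
    using fg(3,4) assms
    by (intro eigenspace_sumI) (auto simp: vec.subspace_add matrix_vector_right_distrib vec.scale_right_distrib)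
  then show "u + v \<in> eigenspace_sum M W X"
    by (simp add: fg sum.distrib)
next
  fix c u assume "u \<in> eigenspace_sum M W X"
  then obtain f where f: "u = (\<Sum>x\<in>X. f x)"
    "\<And>x. x \<in> X \<Longrightarrow> f x \<in> W \<and> M *v f x = complex_of_real x *s f x"
    by (auto simp: eigenspace_sum_def)
  have "(\<Sum>x\<in>X. c *s f x) \<in> eigenspace_sum M W X"
    using f(2) assms
    by (intro eigenspace_sumI) (auto simp: vec.subspace_scale vector_scalar_commute mult.commute)
  then show "c *s u \<in> eigenspace_sum M W X"
    by (simp add: f vec.scale_sum_right)
qed

lemma eigenspace_sum_subset: "vec.subspace W \<Longrightarrow> eigenspace_sum M W X \<subseteq> W"
  by (auto simp: eigenspace_sum_def intro: vec.subspace_sum)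

lemma eigenspace_sum_invariant:
  assumes "vec.subspace W" "v \<in> eigenspace_sum M W X"
  shows "M *v v \<in> eigenspace_sum M W X"
proof -
  obtain f where f: "v = (\<Sum>x\<in>X. f x)"
    "\<And>x. x \<in> X \<Longrightarrow> f x \<in> W \<and> M *v f x = complex_of_real x *s f x"
    using assms(2) by (auto simp: eigenspace_sum_def)
  have "M *v v = (\<Sum>x\<in>X. complex_of_real x *s f x)"
    unfolding f(1) vec.linear_sum[OF matrix_vector_mul_linear_gen] using f(2) by (intro sum.cong) auto
  also have "\<dots> \<in> eigenspace_sum M W X"
    using f(2) assms by (intro eigenspace_sumI) (auto simp: vec.subspace_scale vector_scalar_commute)
  finally show ?thesis .
qed

text \<open>The part of \<open>W\<close> orthogonal to all its eigenvectors is again invariant. If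
  it were nonzero it would contain an eigenvector, which would be orthogonal to itself.\<close>

theorem selfadjoint_eigenspace_sum:
  assumes M: "selfadjoint M" and W: "invariant_subspace M W"
  shows "eigenspace_sum M W {x. complex_of_real x \<in> spectrum_on M W} = W"
proof -
  define X where "X = {x. complex_of_real x \<in> spectrum_on M W}"
  have finX: "finite X"
    using finite_vimageI[OF finite_spectrum_on[of M W], of complex_of_real]
    by (simp add: X_def vimage_def inj_of_real)
  define U where "U = eigenspace_sum M W X"
  have sub: "vec.subspace W" using W by (simp add: invariant_subspace_def)
  have subU: "vec.subspace U"
    unfolding U_def by (rule subspace_eigenspace_sum[OF sub])
  have "U = W"
  proof (rule subspace_eqI_orthogonal[OF subU sub])
    show "U \<subseteq> W" unfolding U_def by (rule eigenspace_sum_subset[OF sub])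
    fix w assume w: "w \<in> W" "w \<in> U\<^sup>\<bottom>"
    show "w = 0"
    proof (rule ccontr)
      assume "w \<noteq> 0"
      have "M *v v \<in> W \<inter> U\<^sup>\<bottom>" if "v \<in> W \<inter> U\<^sup>\<bottom>" for v
      proof
        show "M *v v \<in> W" using that W by (auto simp: invariant_subspace_def)
        show "M *v v \<in> U\<^sup>\<bottom>"
          using that eigenspace_sum_invariant[OF sub, of _ M X] selfadjointD[OF M]
          by (auto simp: orthogonal_comp_altdef U_def simp flip: selfadjointD[OF M])
      qed
      then have "invariant_subspace M (W \<inter> U\<^sup>\<bottom>)"
        using vec.subspace_inter[OF sub vec_subspace_orthogonal_comp[OF subU]]
        by (simp add: invariant_subspace_def)
      with w \<open>w \<noteq> 0\<close> obtain z where "z \<in> spectrum_on M (W \<inter> U\<^sup>\<bottom>)"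
        using spectrum_on_nonempty by blast
      moreover from selfadjoint_spectrum_real[OF M this] obtain x where "z = complex_of_real x" .
      ultimately obtain v where v: "v \<in> W" "v \<in> U\<^sup>\<bottom>" "v \<noteq> 0" "M *v v = complex_of_real x *s v"
        by (auto simp: spectrum_on_def)
      then have x: "x \<in> X" by (auto simp: X_def spectrum_on_def)
      \<comment> \<open>A family with a single nonzero member exhibits \<open>v\<close> itself as an
        element of the sum of eigenspaces.\<close>
      have "(\<Sum>y\<in>X. if y = x then v else 0) \<in> U"
        unfolding U_def using v vec.subspace_0[OF sub] by (intro eigenspace_sumI) auto
      then have "v \<in> U" using x finX by simp
      then show False
        using v orthogonal_comp_Int[of U] by auto
    qed
  qed
  then show ?thesis by (simp add: U_def X_def)
qed

lemma selfadjoint_expansion: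
  assumes "selfadjoint M" "invariant_subspace M W" "v \<in> W"
  obtains X f where "finite X" "v = (\<Sum>x\<in>X. f x)"
    "\<And>x. x \<in> X \<Longrightarrow> complex_of_real x \<in> spectrum_on M W"
    "\<And>x. x \<in> X \<Longrightarrow> f x \<in> W \<and> M *v f x = complex_of_real x *s f x"
proof -
  define X where "X = {x. complex_of_real x \<in> spectrum_on M W}"
  have "finite X"
    using finite_vimageI[OF finite_spectrum_on[of M W], of complex_of_real]
    by (simp add: X_def vimage_def inj_of_real)
  moreover have "v \<in> eigenspace_sum M W X"
    using selfadjoint_eigenspace_sum[OF assms(1,2)] assms(3) by (simp add: X_def)
  ultimately show ?thesis
    using that unfolding eigenspace_sum_def X_def by blast
qed

lemma inner_eigenvector_sum:
  assumes "selfadjoint M" "finite X"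
    and "\<And>x. x \<in> X \<Longrightarrow> M *v f x = complex_of_real x *s f x"
    and "\<And>x. x \<in> X \<Longrightarrow> M *v g x = complex_of_real x *s g x"
  shows "(\<Sum>x\<in>X. f x) \<bullet> (\<Sum>x\<in>X. g x) = (\<Sum>x\<in>X. f x \<bullet> g x)"
proof -
  have "f x \<bullet> (\<Sum>y\<in>X. g y) = f x \<bullet> g x" if "x \<in> X" for x
  proof -
    have "f x \<bullet> (\<Sum>y\<in>X. g y) = (\<Sum>y\<in>X. if y = x then f x \<bullet> g x else 0)"
      unfolding inner_sum_right using that assms
      by (intro sum.cong) (auto intro: selfadjoint_eigenvectors_orthogonal[OF assms(1)])
    then show ?thesis using that assms(2) by simp
  qed
  then show ?thesis
    by (simp add: inner_sum_left)
qed

text \<open>In the orthogonal expansion of \<open>v\<close> into eigenvectors of \<open>M\<close>,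
  each component is multiplied by \<open>a * x + z\<close>. Complex \<open>a\<close> and
  \<open>z\<close> are allowed because the lemma is applied to the normal matrix built from the
  imaginary multiple of \<open>B\<close> and a complex eigenvalue of \<open>A\<close>.\<close>

lemma selfadjoint_norm_lower_bound:
  assumes M: "selfadjoint M" and W: "invariant_subspace M W" and v: "v \<in> W" and "0 \<le> d"
    and d: "\<And>x. complex_of_real x \<in> spectrum_on M W \<Longrightarrow> d \<le> cmod (a * x + z)"
  shows "d * norm v \<le> norm (a *s (M *v v) + z *s v)"
proof -
  obtain X f where f: "finite X" "v = (\<Sum>x\<in>X. f x)"
    "\<And>x. x \<in> X \<Longrightarrow> complex_of_real x \<in> spectrum_on M W"
    "\<And>x. x \<in> X \<Longrightarrow> f x \<in> W \<and> M *v f x = complex_of_real x *s f x"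
    by (rule selfadjoint_expansion[OF M W v]) blast
  define g where "g x = (a * x + z) *s f x" for x
  have g: "a *s (M *v v) + z *s v = (\<Sum>x\<in>X. g x)"
    unfolding f(2) vec.linear_sum[OF matrix_vector_mul_linear_gen] vec.scale_sum_right
      sum.distrib[symmetric] g_def
    using f(4) by (intro sum.cong) (auto simp: vec.scale_left_distrib)
  have eig: "M *v g x = complex_of_real x *s g x" if "x \<in> X" for x
    using f(4)[OF that] by (simp only: g_def vector_scalar_commute vector_smult_assoc mult.commute)
  have "(d * norm v)\<^sup>2 = (\<Sum>x\<in>X. d\<^sup>2 * (norm (f x))\<^sup>2)"
    using inner_eigenvector_sum[OF M f(1), of f f] f
    by (simp add: power_mult_distrib power2_norm_eq_inner sum_distrib_left)
  also have "\<dots> \<le> (\<Sum>x\<in>X. (norm (g x))\<^sup>2)"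
    using d[OF f(3)] \<open>0 \<le> d\<close>
    unfolding g_def norm_smult power_mult_distrib
    by (intro sum_mono mult_right_mono power_mono) auto
  also have "\<dots> = (norm (a *s (M *v v) + z *s v))\<^sup>2"
    using inner_eigenvector_sum[OF M f(1), of g g] eig g by (simp add: power2_norm_eq_inner)
  finally show ?thesis
    by (rule power2_le_imp_le) simp
qed

lemma selfadjoint_form_lower_bound:
  assumes M: "selfadjoint M" and W: "invariant_subspace M W" and v: "v \<in> W"
    and b: "\<And>x. complex_of_real x \<in> spectrum_on M W \<Longrightarrow> b \<le> x"
  shows "b * (v \<bullet> v) \<le> v \<bullet> (M *v v)"
proof -
  obtain X f where f: "finite X" "v = (\<Sum>x\<in>X. f x)"
    "\<And>x. x \<in> X \<Longrightarrow> complex_of_real x \<in> spectrum_on M W"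
    "\<And>x. x \<in> X \<Longrightarrow> f x \<in> W \<and> M *v f x = complex_of_real x *s f x"
    by (rule selfadjoint_expansion[OF M W v]) blast
  have Mv: "M *v v = (\<Sum>x\<in>X. complex_of_real x *s f x)"
    unfolding f(2) vec.linear_sum[OF matrix_vector_mul_linear_gen] using f(4) by (intro sum.cong) auto
  have "b * (v \<bullet> v) = (\<Sum>x\<in>X. b * (f x \<bullet> f x))"
    using inner_eigenvector_sum[OF M f(1), of f f] f by (simp add: sum_distrib_left)
  also have "\<dots> \<le> (\<Sum>x\<in>X. x * (f x \<bullet> f x))"
    using b[OF f(3)] by (intro sum_mono mult_right_mono) auto
  also have "\<dots> = (\<Sum>x\<in>X. f x \<bullet> (complex_of_real x *s f x))"
    by (simp add: inner_smult_real)
  also have "\<dots> = v \<bullet> (M *v v)"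
    unfolding Mv by (subst f(2), rule inner_eigenvector_sum[OF M f(1), symmetric])
      (use f(4) in \<open>auto simp: vector_scalar_commute\<close>)
  finally show ?thesis .
qed

text \<open>Eigenspaces for different eigenvalues are orthogonal, so their dimensions add. This
  relates the multiplicities of the nonzero eigenvalues to the rank.\<close>

lemma dim_eigenspace_sum:
  assumes M: "selfadjoint M" and W: "vec.subspace W" and "finite X"
  shows "vec.dim (eigenspace_sum M W X) = (\<Sum>x\<in>X. vec.dim {v\<in>W. M *v v = complex_of_real x *s v})"
  using \<open>finite X\<close>
proof (induction X rule: finite_induct)
  case empty
  have "eigenspace_sum M W {} = {0}"
    by (auto simp: eigenspace_sum_def)
  then show ?case by simp
next
  case (insert a X)
  define E where "E = {v\<in>W. M *v v = complex_of_real a *s v}"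
  define F where "F = eigenspace_sum M W X"
  have subE: "vec.subspace E"
    using W by (auto simp: E_def vec.subspace_def algebra_simps vec.scale_right_distrib vector_scalar_commute)
  have subF: "vec.subspace F"
    unfolding F_def by (rule subspace_eigenspace_sum[OF W])
  have "direct_sum (eigenspace_sum M W (insert a X)) E F"
    unfolding direct_sum_def
  proof
    have "u \<bullet> v = 0" if uv: "u \<in> E" "v \<in> F" for u v
    proof -
      obtain f where f: "v = (\<Sum>x\<in>X. f x)"
        "\<And>x. x \<in> X \<Longrightarrow> f x \<in> W \<and> M *v f x = complex_of_real x *s f x"
        using uv(2) by (auto simp: F_def eigenspace_sum_def)
      have "u \<bullet> f x = 0" if "x \<in> X" for x
        using insert(2) that uv(1) f(2)[OF that]
        by (intro selfadjoint_eigenvectors_orthogonal[OF M]) (auto simp: E_def)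
      then show ?thesis by (simp add: f(1) inner_sum_right)
    qed
    then have "u = 0" if "u \<in> E" "u \<in> F" for u
      using that by (metis inner_eq_zero_iff)
    then show "E \<inter> F = {0}"
      using vec.subspace_0[OF subE] vec.subspace_0[OF subF] by auto
    show "eigenspace_sum M W (insert a X) = {u + w |u w. u \<in> E \<and> w \<in> F}"
    proof (intro set_eqI iffI)
      fix v assume "v \<in> eigenspace_sum M W (insert a X)"
      then obtain f where f: "v = (\<Sum>x\<in>insert a X. f x)"
        "\<And>x. x \<in> insert a X \<Longrightarrow> f x \<in> W \<and> M *v f x = complex_of_real x *s f x"
        by (auto simp: eigenspace_sum_def)
      then have "v = f a + (\<Sum>x\<in>X. f x)" "f a \<in> E" "(\<Sum>x\<in>X. f x) \<in> F"
        using insert(1,2) by (auto simp: E_def F_def intro: eigenspace_sumI)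
      then show "v \<in> {u + w |u w. u \<in> E \<and> w \<in> F}" by blast
    next
      fix v assume "v \<in> {u + w |u w. u \<in> E \<and> w \<in> F}"
      then obtain u f where f: "u \<in> E" "v = u + (\<Sum>x\<in>X. f x)"
        "\<And>x. x \<in> X \<Longrightarrow> f x \<in> W \<and> M *v f x = complex_of_real x *s f x"
        by (auto simp: F_def eigenspace_sum_def)
      define g where "g = f(a := u)"
      have "(\<Sum>x\<in>insert a X. g x) \<in> eigenspace_sum M W (insert a X)"
        using f by (intro eigenspace_sumI) (auto simp: g_def E_def)
      moreover have "(\<Sum>x\<in>X. g x) = (\<Sum>x\<in>X. f x)"
        using insert(2) by (intro sum.cong) (auto simp: g_def)
      ultimately show "v \<in> eigenspace_sum M W (insert a X)"
        using insert(1,2) by (simp add: f(2) g_def)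
    qed
  qed
  from direct_sum_dim[OF this subE subF] show ?case
    using insert by (simp add: E_def F_def)
qed

subsection \<open>Definite forms on invariant subspaces\<close>

text \<open>A linear right inverse on \<open>W\<close> is injective, hence onto \<open>W\<close> by
  dimension, and is therefore a left inverse as well.\<close>

lemma surj_on_subspace_imp_inj_on:
  fixes f :: "'a::field^'n \<Rightarrow> 'a^'n"
  assumes lin: "Vector_Spaces.linear (*s) (*s) f" and W: "vec.subspace W" and fW: "f ` W = W"
  shows "inj_on f W"
proof -
  obtain g where g: "range g \<subseteq> W" "Vector_Spaces.linear (*s) (*s) g" "\<And>v. v \<in> W \<Longrightarrow> f (g v) = v"
    using vec.linear_exists_right_inverse_on[OF lin W] fW by metis
  have "inj_on g W"
    using g(3) by (rule inj_on_inverseI)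
  then have "vec.dim (g ` W) = vec.dim W"
    by (intro vec.dim_image_eq[OF g(2)]) (use W in \<open>simp add: vec.span_eq_iff[THEN iffD2]\<close>)
  then have "g ` W = W"
    using g(1) by (intro vec.subspace_dim_equal vec.linear_subspace_image[OF g(2)] W) auto
  then show ?thesis
    using g(3) by (intro inj_on_inverseI[where g = g]) (metis imageE)
qed

text \<open>Evaluates the form at the image of a vector that is an eigenvector modulo a
  \<open>J\<close>-orthogonal subspace. The conjugate in the hypothesis arises from moving
  \<open>\<nu>\<close> across the inner product; \<open>J\<close>-orthogonality to a complex
  subspace supplies it.\<close>

lemma form_eigenvector_plus:
  fixes J :: "complex^'n^'n"
  assumes J: "selfadjoint J" and "(J *v u) \<bullet> (cnj \<nu> *s w) = 0"
  shows "(J *v (\<nu> *s u + w)) \<bullet> (\<nu> *s u + w) = (cmod \<nu>)\<^sup>2 * ((J *v u) \<bullet> u) + (J *v w) \<bullet> w"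
proof -
  have "(J *v (\<nu> *s u)) \<bullet> w = 0"
    using assms by (simp add: vector_scalar_commute inner_smult_left)
  moreover have "(J *v w) \<bullet> (\<nu> *s u) = (J *v (\<nu> *s u)) \<bullet> w"
    using J by (simp add: selfadjointD inner_commute)
  moreover have "(J *v (\<nu> *s u)) \<bullet> (\<nu> *s u) = (cmod \<nu>)\<^sup>2 * ((J *v u) \<bullet> u)"
    using selfadjoint_smult[OF J, of u "cnj \<nu> * \<nu>"]
    by (simp add: vector_scalar_commute inner_smult_left vector_smult_assoc cmod_power2 flip: power2_eq_square)
  ultimately show ?thesis
    by (simp add: matrix_vector_right_distrib inner_add)
qed

text \<open>Inertia of a Hermitian form by induction on the dimension: \<open>W\<close> has an invariant hyperplane \<open>W'\<close>,
  and a vector of \<open>W\<close> that is \<open>J\<close>-orthogonal to \<open>W'\<close> is an eigenvector modulo \<open>W'\<close>.\<close>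

lemma positive_on_invariant_subspace:
  fixes A J :: "complex^'n^'n"
  assumes J: "selfadjoint J" and W: "invariant_subspace A W"
    and step: "\<And>W' u \<nu> w. invariant_subspace A W' \<Longrightarrow> W' \<subseteq> W \<Longrightarrow>
      (\<And>v. v \<in> W' \<Longrightarrow> v \<noteq> 0 \<Longrightarrow> 0 < (J *v v) \<bullet> v) \<Longrightarrow>
      (\<And>v. v \<in> W' \<Longrightarrow> (J *v u) \<bullet> v = 0) \<Longrightarrow> u \<in> W \<Longrightarrow> u \<noteq> 0 \<Longrightarrow>
      \<nu> \<in> spectrum_on A W \<Longrightarrow> w \<in> W' \<Longrightarrow> A *v u = \<nu> *s u + w \<Longrightarrow> 0 < (J *v u) \<bullet> u"
    and v: "v \<in> W" "v \<noteq> 0"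
  shows "0 < (J *v v) \<bullet> v"
  using W step v
proof (induction "vec.dim W" arbitrary: W v rule: less_induct)
  case less
  note W = less.prems(1)
  have sub: "vec.subspace W" and inv: "\<And>v. v \<in> W \<Longrightarrow> A *v v \<in> W"
    using W by (auto simp: invariant_subspace_def)
  obtain \<nu> where \<nu>: "\<nu> \<in> spectrum_on A W"
    using spectrum_on_nonempty[OF W less.prems(3,4)] by auto
  define f where "f v = A *v v - \<nu> *s v" for v
  have f_eq: "f = (*v) (A - mat \<nu>)"
    by (auto simp: f_def matrix_vector_mult_diff_rdistrib mat_mult_vec)
  have lin: "Vector_Spaces.linear (*s) (*s) f"
    unfolding f_eq by (rule matrix_vector_mul_linear_gen)
  have subf: "vec.subspace (f ` W)"
    by (rule vec.linear_subspace_image[OF lin sub])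
  have fW: "f ` W \<subseteq> W"
    using inv sub by (auto simp: f_def vec.subspace_diff vec.subspace_scale)
  have "\<not> bij_betw f W W"
    using \<nu> spectrum_on_iff_not_bij[OF W, of \<nu>] by (simp add: f_def[abs_def])
  then have "f ` W \<noteq> W"
    using surj_on_subspace_imp_inj_on[OF lin sub] by (auto simp: bij_betw_def)
  \<comment> \<open>Since \<open>\<nu>\<close> is an eigenvalue, \<open>A - \<nu>\<close> does not
    map \<open>W\<close> onto itself, and a nonzero \<open>z\<close> is orthogonal to the image. The
    hyperplane of \<open>W\<close> orthogonal to \<open>z\<close> contains this image, so it is
    invariant and \<open>A\<close> acts as \<open>\<nu>\<close> modulo it.\<close>
  then obtain z where z: "z \<in> W" "z \<in> (f ` W)\<^sup>\<bottom>" "z \<noteq> 0"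
    using subspace_eqI_orthogonal[OF subf sub fW] by blast
  define Z where "Z = vec.span {z}"
  define W' where "W' = W \<inter> Z\<^sup>\<bottom>"
  have subZ: "vec.subspace Z" by (simp add: Z_def)
  have Z_iff: "x \<in> Z \<longleftrightarrow> (\<exists>c. x = c *s z)" for x
    by (auto simp: Z_def vec.span_singleton)
  have sub': "vec.subspace W'"
    unfolding W'_def by (intro vec.subspace_inter sub vec_subspace_orthogonal_comp subZ)
  have fW': "f w \<in> W'" if "w \<in> W" for w
  proof -
    have "(c *s z) \<bullet> f w = 0" for c
    proof -
      have "cnj c *s f w \<in> f ` W"
        using that by (intro vec.subspace_scale[OF subf]) auto
      then have "(cnj c *s f w) \<bullet> z = 0"
        using z(2) by (auto simp: orthogonal_comp_altdef)
      then show ?thesis by (simp add: inner_smult_left inner_commute[of z])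
    qed
    then show ?thesis
      using that fW by (auto simp: W'_def orthogonal_comp_altdef Z_iff)
  qed
  have "z \<in> Z" by (simp add: Z_def vec.span_base)
  then have "z \<notin> W'"
    using z(3) orthogonal_comp_Int[of Z] by (auto simp: W'_def)
  have "W' \<subseteq> W" by (simp add: W'_def)
  have inv': "invariant_subspace A W'"
  proof -
    have "A *v w \<in> W'" if "w \<in> W'" for w
    proof -
      have "A *v w = f w + \<nu> *s w" by (simp add: f_def)
      then show ?thesis
        using that fW'[of w] \<open>W' \<subseteq> W\<close> by (auto intro!: vec.subspace_add vec.subspace_scale sub')
    qed
    then show ?thesis using sub' by (simp add: invariant_subspace_def)
  qed
  have "vec.dim W' < vec.dim W"
    using \<open>z \<notin> W'\<close> z(1) vec.subspace_dim_equal[OF sub' sub \<open>W' \<subseteq> W\<close>]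
    by (cases "vec.dim W \<le> vec.dim W'") auto
  then have pos: "0 < (J *v v) \<bullet> v" if "v \<in> W'" "v \<noteq> 0" for v
  proof (rule less.hyps[OF _ inv' _ that])
    fix W'' u \<mu> w
    assume H: "invariant_subspace A W''" "W'' \<subseteq> W'" "\<And>v. v \<in> W'' \<Longrightarrow> v \<noteq> 0 \<Longrightarrow> 0 < (J *v v) \<bullet> v"
      "\<And>v. v \<in> W'' \<Longrightarrow> (J *v u) \<bullet> v = 0" "u \<in> W'" "u \<noteq> 0" "\<mu> \<in> spectrum_on A W'" "w \<in> W''"
      "A *v u = \<mu> *s u + w"
    have "W'' \<subseteq> W" "u \<in> W" "\<mu> \<in> spectrum_on A W"
      using H(2,5,7) \<open>W' \<subseteq> W\<close> spectrum_on_mono[OF \<open>W' \<subseteq> W\<close>, of A] by auto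
    from less.prems(2)[OF H(1) this(1) H(3,4) this(2) H(6) this(3) H(8,9)]
    show "0 < (J *v u) \<bullet> u" .
  qed
  define P where "P = orthogonal_projection W'"
  note P = orthogonal_projection[OF sub', folded P_def]
  have P_inner: "(P *v x) \<bullet> w = x \<bullet> w" if "w \<in> W'" for x w
    using P(2,4) that by (simp add: selfadjointD)
  \<comment> \<open>The compression of \<open>J\<close> to \<open>W'\<close> is positive definite,
    hence bijective on \<open>W'\<close>. So \<open>w'\<close> is the \<open>J\<close>-orthogonal
    projection of \<open>z\<close>, and \<open>z - w'\<close> is \<open>J\<close>-orthogonal to
    \<open>W'\<close>.\<close>
  obtain w' where w': "w' \<in> W'" "P *v (J *v w') = P *v (J *v z)"
  proof -
    define h where "h = (*v) (P ** J)"
    have linh: "Vector_Spaces.linear (*s) (*s) h"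
      by (simp add: h_def)
    have "w = 0" if "w \<in> W'" "h w = 0" for w
    proof (rule ccontr)
      assume "w \<noteq> 0"
      have "(J *v w) \<bullet> w = h w \<bullet> w"
        using P_inner[OF that(1), of "J *v w"] by (simp add: h_def flip: matrix_vector_mul_assoc)
      with pos[OF that(1) \<open>w \<noteq> 0\<close>] that(2) show False by simp
    qed
    then have "inj_on h W'"
      using vec.linear_inj_on_iff_eq_0[OF linh sub'] by blast
    then have "vec.dim (h ` W') = vec.dim W'"
      by (intro vec.dim_image_eq[OF linh]) (use sub' in \<open>simp add: vec.span_eq_iff[THEN iffD2]\<close>)
    moreover have "h ` W' \<subseteq> W'"
      using P(3) by (auto simp: h_def simp flip: matrix_vector_mul_assoc)
    ultimately have "h ` W' = W'"
      by (intro vec.subspace_dim_equal vec.linear_subspace_image[OF linh] sub') auto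
    moreover have "P *v (J *v z) \<in> W'" by (rule P(3))
    ultimately obtain w' where "w' \<in> W'" "h w' = P *v (J *v z)" by (metis imageE)
    then show ?thesis
      using that by (simp add: h_def flip: matrix_vector_mul_assoc)
  qed
  define u where "u = z - w'"
  have u: "u \<in> W" "u \<noteq> 0"
    using z(1) w'(1) \<open>W' \<subseteq> W\<close> \<open>z \<notin> W'\<close> by (auto simp: u_def intro!: vec.subspace_diff[OF sub])
  have Ju: "(J *v u) \<bullet> w = 0" if "w \<in> W'" for w
    using P_inner[OF that, of "J *v z"] P_inner[OF that, of "J *v w'"] w'(2)
    by (simp add: u_def matrix_vector_mult_diff_distrib inner_diff_left)
  have Auu: "A *v u = \<nu> *s u + f u" by (simp add: f_def)
  have pos_u: "0 < (J *v u) \<bullet> u"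
    by (rule less.prems(2)[OF inv' \<open>W' \<subseteq> W\<close> pos Ju u \<nu> fW'[OF u(1)] Auu])
  obtain c y where cy: "v = c *s z + y" "y \<in> Z\<^sup>\<bottom>"
    using orthogonal_comp_decomp[OF subZ, of v] Z_iff by metis
  have "y \<in> W"
    using vec.subspace_diff[OF sub less.prems(3) vec.subspace_scale[OF sub z(1), of c]] cy by simp
  then have y: "y \<in> W'" using cy by (simp add: W'_def)
  \<comment> \<open>Replacing \<open>z\<close> by \<open>u\<close> in the decomposition of
    \<open>v\<close> moves the correction \<open>c *s w'\<close> into the component in
    \<open>W'\<close>.\<close>
  define x where "x = y + c *s w'"
  have x: "x \<in> W'"
    unfolding x_def using y w' by (intro vec.subspace_add vec.subspace_scale sub')
  have vxu: "v = c *s u + x"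
    by (simp add: x_def cy u_def vec.scale_right_diff_distrib)
  have eq: "(J *v v) \<bullet> v = (cmod c)\<^sup>2 * ((J *v u) \<bullet> u) + (J *v x) \<bullet> x"
    unfolding vxu by (intro form_eigenvector_plus[OF J] Ju vec.subspace_scale sub' x)
  show ?case
  proof (cases "x = 0")
    case True
    with less.prems(4) vxu have "c \<noteq> 0" by auto
    with True eq pos_u show ?thesis by simp
  next
    case False
    with eq pos[OF x] pos_u show ?thesis
      by (simp add: add_nonneg_pos)
  qed
qed

text \<open>At a vector \<open>u\<close> that is \<open>J\<close>-orthogonal to \<open>W'\<close>
  with eigenvalue \<open>\<nu>\<close> modulo \<open>W'\<close>, the Lyapunov expression reduces to
  \<open>(Im \<nu> + \<mu>) * ((J *v u) \<bullet> u)\<close>, because the real part of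
  \<open>- \<i> * \<nu>\<close> is \<open>Im \<nu>\<close>. Positivity then ties the sign of the
  form to the side of the line Im = - \<open>\<mu>\<close>; the sign \<open>s\<close> covers both
  sides at once.\<close>

lemma lyapunov_inertia:
  fixes A J :: "complex^'n^'n"
  assumes J: "selfadjoint J" and W: "invariant_subspace A W" and s: "s = 1 \<or> s = -1"
    and lyap: "\<And>v. v \<in> W \<Longrightarrow> v \<noteq> 0 \<Longrightarrow> 0 < (J *v v) \<bullet> ((- \<i>) *s (A *v v)) + \<mu> * ((J *v v) \<bullet> v)"
    and spec: "\<And>\<zeta>. \<zeta> \<in> spectrum_on A W \<Longrightarrow> 0 < s * (Im \<zeta> + \<mu>)"
    and v: "v \<in> W" "v \<noteq> 0"
  shows "0 < s * ((J *v v) \<bullet> v)"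
proof -
  define K where "K = cscale (complex_of_real s) J"
  have K: "(K *v x) \<bullet> y = s * ((J *v x) \<bullet> y)" for x y
    by (simp add: K_def cscale_mult_vec inner_smult_real)
  have "0 < (K *v v) \<bullet> v"
  proof (rule positive_on_invariant_subspace[OF _ W _ v])
    show "selfadjoint K" unfolding K_def by (rule selfadjoint_cscale[OF J])
    fix W' u \<nu> w
    assume W': "invariant_subspace A W'" "W' \<subseteq> W"
      and u: "\<And>v. v \<in> W' \<Longrightarrow> (K *v u) \<bullet> v = 0" "u \<in> W" "u \<noteq> 0"
      and \<nu>: "\<nu> \<in> spectrum_on A W" "w \<in> W'" "A *v u = \<nu> *s u + w"
    \<comment> \<open>\<open>W'\<close> is a complex subspace, so real orthogonality of
      \<open>J *v u\<close> to \<open>W'\<close> also kills imaginary multiples of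
      \<open>w\<close>.\<close>
    have "(- \<i>) *s w \<in> W'"
      using W'(1) \<nu>(2) unfolding invariant_subspace_def by (intro vec.subspace_scale) auto
    then have 1: "(J *v u) \<bullet> ((- \<i>) *s w) = 0"
      using u(1) s unfolding K by fastforce
    have "(J *v u) \<bullet> ((- \<i>) *s (A *v u)) = (J *v u) \<bullet> ((- \<i> * \<nu>) *s u)"
      unfolding \<nu>(3) vec.scale_right_distrib inner_add_right 1 by (simp add: vector_smult_assoc)
    also have "\<dots> = Im \<nu> * ((J *v u) \<bullet> u)"
      by (subst selfadjoint_smult[OF J]) simp
    finally have "0 < (Im \<nu> + \<mu>) * ((J *v u) \<bullet> u)"
      using lyap[OF u(2,3)] by (simp add: distrib_right)
    with spec[OF \<nu>(1)] s show "0 < (K *v u) \<bullet> u"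
      unfolding K by (auto simp: zero_less_mult_iff mult_less_0_iff)
  qed
  then show ?thesis by (simp add: K)
qed

text \<open>If \<open>A *v u = \<nu> *s u + w\<close>, the form at \<open>A *v u\<close> is that at
  \<open>u\<close> times \<open>(cmod \<nu>)\<^sup>2\<close> plus that at \<open>w\<close>, and the
  latter is at most 0 by induction. Dropping it from the Stein inequality leaves a positive product
  whose factor \<open>(cmod \<nu>)\<^sup>2 - r\<^sup>2\<close> is negative.\<close>

lemma stein_inertia_inside:
  fixes A J :: "complex^'n^'n"
  assumes J: "selfadjoint J" and W: "invariant_subspace A W"
    and stein: "\<And>v. v \<in> W \<Longrightarrow> v \<noteq> 0 \<Longrightarrow> r\<^sup>2 * ((J *v v) \<bullet> v) < (J *v (A *v v)) \<bullet> (A *v v)"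
    and spec: "\<And>\<zeta>. \<zeta> \<in> spectrum_on A W \<Longrightarrow> cmod \<zeta> < r"
    and v: "v \<in> W" "v \<noteq> 0"
  shows "(J *v v) \<bullet> v < 0"
proof -
  define K where "K = cscale (complex_of_real (-1)) J"
  have K: "(K *v x) \<bullet> y = - ((J *v x) \<bullet> y)" for x y
    unfolding K_def cscale_mult_vec inner_smult_real by simp
  have "0 < (K *v v) \<bullet> v"
  proof (rule positive_on_invariant_subspace[OF _ W _ v])
    show "selfadjoint K" unfolding K_def by (rule selfadjoint_cscale[OF J])
    fix W' u \<nu> w
    assume W': "invariant_subspace A W'" "W' \<subseteq> W" "\<And>v. v \<in> W' \<Longrightarrow> v \<noteq> 0 \<Longrightarrow> 0 < (K *v v) \<bullet> v"
      and u: "\<And>v. v \<in> W' \<Longrightarrow> (K *v u) \<bullet> v = 0" "u \<in> W" "u \<noteq> 0"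
      and \<nu>: "\<nu> \<in> spectrum_on A W" "w \<in> W'" "A *v u = \<nu> *s u + w"
    have "cnj \<nu> *s w \<in> W'"
      using W'(1) \<nu>(2) unfolding invariant_subspace_def by (intro vec.subspace_scale) auto
    then have "(J *v (A *v u)) \<bullet> (A *v u) = (cmod \<nu>)\<^sup>2 * ((J *v u) \<bullet> u) + (J *v w) \<bullet> w"
      using u(1)[of "cnj \<nu> *s w"] unfolding \<nu>(3) K by (intro form_eigenvector_plus[OF J]) simp
    moreover have "(J *v w) \<bullet> w \<le> 0"
      using W'(3)[OF \<nu>(2)] by (cases "w = 0") (auto simp: K)
    ultimately have "((cmod \<nu>)\<^sup>2 - r\<^sup>2) * ((J *v u) \<bullet> u) > 0"
      using stein[OF u(2,3)] by (simp add: algebra_simps)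
    moreover have "(cmod \<nu>)\<^sup>2 < r\<^sup>2"
      using spec[OF \<nu>(1)] by (intro power_strict_mono) auto
    ultimately show "0 < (K *v u) \<bullet> u"
      by (auto simp: zero_less_mult_iff K)
  qed
  then show ?thesis by (simp add: K)
qed

text \<open>The argument for the inside fails here, because the form at \<open>w\<close> is now
  nonnegative and cannot be dropped. Outside the circle \<open>A\<close> is invertible on
  \<open>W'\<close>, so \<open>w\<close> can be removed by changing \<open>u\<close> within its
  class modulo \<open>W'\<close>.\<close>

lemma stein_inertia_outside:
  fixes A J :: "complex^'n^'n"
  assumes J: "selfadjoint J" and W: "invariant_subspace A W" and r: "0 \<le> r"
    and stein: "\<And>v. v \<in> W \<Longrightarrow> v \<noteq> 0 \<Longrightarrow> r\<^sup>2 * ((J *v v) \<bullet> v) < (J *v (A *v v)) \<bullet> (A *v v)"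
    and spec: "\<And>\<zeta>. \<zeta> \<in> spectrum_on A W \<Longrightarrow> r < cmod \<zeta>"
    and v: "v \<in> W" "v \<noteq> 0"
  shows "0 < (J *v v) \<bullet> v"
proof (rule positive_on_invariant_subspace[OF J W _ v])
  fix W' u \<nu> w
  assume W': "invariant_subspace A W'" "W' \<subseteq> W" "\<And>v. v \<in> W' \<Longrightarrow> v \<noteq> 0 \<Longrightarrow> 0 < (J *v v) \<bullet> v"
    and u: "\<And>v. v \<in> W' \<Longrightarrow> (J *v u) \<bullet> v = 0" "u \<in> W" "u \<noteq> 0"
    and \<nu>: "\<nu> \<in> spectrum_on A W" "w \<in> W'" "A *v u = \<nu> *s u + w"
  have sub: "vec.subspace W" "vec.subspace W'" using W W' by (auto simp: invariant_subspace_def)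
  have "0 \<notin> spectrum_on A W'"
    using spec[of 0] r spectrum_on_mono[OF W'(2), of A] by auto
  then have "bij_betw (\<lambda>v. A *v v - 0 *s v) W' W'"
    using spectrum_on_iff_not_bij[OF W'(1)] by blast
  then have "(\<lambda>v. A *v v - 0 *s v) ` W' = W'"
    by (rule bij_betw_imp_surj_on)
  then obtain y where y: "y \<in> W'" "A *v y = w"
    using \<nu>(2) by force
  define x where "x = 1 *s u + - y"
  have x: "x \<in> W"
    unfolding x_def using u(2) y W'(2) by (auto intro!: vec.subspace_diff[OF sub(1)])
  have Ax: "A *v x = \<nu> *s u + 0"
    by (simp add: x_def matrix_vector_mult_diff_distrib \<nu>(3) y(2))
  have \<nu>0: "r < cmod \<nu>" by (rule spec[OF \<nu>(1)])
  have "x \<noteq> 0"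
  proof
    assume "x = 0"
    then have "\<nu> *s u = 0" using Ax by simp
    with \<nu>0 r u(3) show False by (auto simp: vec.scale_eq_0_iff)
  qed
  have "(J *v (A *v x)) \<bullet> (A *v x) = (cmod \<nu>)\<^sup>2 * ((J *v u) \<bullet> u) + (J *v 0) \<bullet> 0"
    unfolding Ax by (rule form_eigenvector_plus[OF J]) simp
  moreover have "(J *v x) \<bullet> x = (cmod 1)\<^sup>2 * ((J *v u) \<bullet> u) + (J *v (- y)) \<bullet> (- y)"
    unfolding x_def
    using u(1)[of "- y"] y vec.subspace_neg[OF sub(2)] by (intro form_eigenvector_plus[OF J]) simp
  moreover have "0 \<le> (J *v (- y)) \<bullet> (- y)"
    using W'(3)[of "- y"] y vec.subspace_neg[OF sub(2)] by (cases "y = 0") auto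
  moreover note stein[OF x \<open>x \<noteq> 0\<close>]
  moreover have "0 \<le> r\<^sup>2" by simp
  ultimately have "r\<^sup>2 * ((J *v u) \<bullet> u) + r\<^sup>2 * ((J *v (- y)) \<bullet> (- y)) < (cmod \<nu>)\<^sup>2 * ((J *v u) \<bullet> u)"
    "0 \<le> r\<^sup>2 * ((J *v (- y)) \<bullet> (- y))"
    by (simp_all only: norm_one power_one mult_1 distrib_left inner_zero_right add_0_right mult_nonneg_nonneg)
  then have "((cmod \<nu>)\<^sup>2 - r\<^sup>2) * ((J *v u) \<bullet> u) > 0"
    by (simp add: algebra_simps)
  moreover have "r\<^sup>2 < (cmod \<nu>)\<^sup>2"
    using \<nu>0 r by (intro power_strict_mono) auto
  ultimately show "0 < (J *v u) \<bullet> u"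
    by (auto simp: zero_less_mult_iff)
qed

subsection \<open>Complexification of real matrices\<close>

abbreviation cmat :: "real^'n^'m \<Rightarrow> complex^'n^'m" where
  "cmat \<equiv> map_matrix complex_of_real"

definition cvec :: "real^'n \<Rightarrow> complex^'n" where "cvec x = (\<chi> i. complex_of_real (x $ i))"
definition Re_vec :: "complex^'n \<Rightarrow> real^'n" where "Re_vec v = (\<chi> i. Re (v $ i))"
definition Im_vec :: "complex^'n \<Rightarrow> real^'n" where "Im_vec v = (\<chi> i. Im (v $ i))"

lemma Re_vec_cvec [simp]: "Re_vec (cvec x) = x" and Im_vec_cvec [simp]: "Im_vec (cvec x) = 0"
  by (simp_all add: Re_vec_def Im_vec_def cvec_def vec_eq_iff)

lemma Re_Im_vec: "v = cvec (Re_vec v) + \<i> *s cvec (Im_vec v)"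
  by (simp add: Re_vec_def Im_vec_def cvec_def vec_eq_iff complex_eq_iff)

lemma Re_Im_vec_eqI: "Re_vec u = Re_vec v \<Longrightarrow> Im_vec u = Im_vec v \<Longrightarrow> u = v"
  using Re_Im_vec by metis

lemma inner_Re_Im_vec: "u \<bullet> v = Re_vec u \<bullet> Re_vec v + Im_vec u \<bullet> Im_vec v"
  by (simp add: inner_vec_def inner_complex_def Re_vec_def Im_vec_def sum.distrib)

lemma Re_vec_cmat: "Re_vec (cmat M *v v) = M *v Re_vec v"
  and Im_vec_cmat: "Im_vec (cmat M *v v) = M *v Im_vec v"
  by (simp_all add: Re_vec_def Im_vec_def matrix_vector_mult_def vec_eq_iff)

lemma cmat_cvec: "cmat M *v cvec x = cvec (M *v x)"
  by (rule Re_Im_vec_eqI) (simp_all add: Re_vec_cmat Im_vec_cmat)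

lemma cmat_mult: "cmat (M ** N) = cmat M ** cmat N"
  by (simp add: matrix_matrix_mult_def vec_eq_iff)

lemma cmat_inj: "cmat M = cmat N \<longleftrightarrow> M = N"
  by (simp add: vec_eq_iff)

lemma cmat_uminus: "cmat (- M) = - cmat M"
  by (simp add: vec_eq_iff)

lemma hermitian_adjoint_cmat: "hermitian_adjoint (cmat M) = cmat (transpose M)"
  by (simp add: hermitian_adjoint_def transpose_def vec_eq_iff)

lemma selfadjoint_cmat: "transpose M = M \<Longrightarrow> selfadjoint (cmat M)"
  by (simp add: selfadjoint_iff hermitian_adjoint_cmat)

lemma psd_cmat_form: "psd M \<Longrightarrow> 0 \<le> v \<bullet> (cmat M *v v)"
  by (simp add: inner_Re_Im_vec Re_vec_cmat Im_vec_cmat psd_def)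

lemma nonneg_form_eigenvalue:
  assumes "\<And>v. 0 \<le> v \<bullet> (M *v v)" "complex_of_real x \<in> spectrum_on M W"
  shows "0 \<le> x"
proof -
  obtain v where v: "v \<noteq> 0" "M *v v = complex_of_real x *s v"
    using assms(2) by (auto simp: spectrum_on_def)
  then have "0 \<le> x * (v \<bullet> v)" "0 < v \<bullet> v"
    using assms(1)[of v] by (simp_all add: inner_smult_real)
  then show ?thesis
    by (simp add: zero_le_mult_iff)
qed

text \<open>A real basis of the real range is also a complex basis of the complexified range. This
  transfers the real rank of \<open>R\<close> to complex dimensions.\<close>

lemma vec_dim_range_cmat:
  fixes M :: "real^'n^'m"
  shows "vec.dim (range ((*v) (cmat M))) = rank M"
proof -
  define V where "V = range ((*v) M)"
  obtain B where B: "B \<subseteq> V" "independent B" "V \<subseteq> span B" "card B = dim V"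
    using basis_exists by metis
  have finB: "finite B" using B(2) by (rule independent_imp_finite)
  have inj: "inj_on cvec B"
    by (rule inj_on_inverseI[where g = Re_vec]) simp
  have "vec.dim (range ((*v) (cmat M))) = card (cvec ` B)"
  proof (rule vec.dim_unique)
    show "cvec ` B \<subseteq> range ((*v) (cmat M))"
      using B(1) by (auto simp: V_def simp flip: cmat_cvec)
    have span: "cvec a \<in> vec.span (cvec ` B)" if "a \<in> span B" for a
      using that
    proof (induction rule: span_induct_alt)
      case base
      have "cvec 0 = (0 :: complex^'m)" by (simp add: cvec_def vec_eq_iff)
      then show ?case by (simp add: vec.span_zero)
    next
      case (step c x y)
      have "cvec (c *\<^sub>R x + y) = complex_of_real c *s cvec x + cvec y"
        by (simp add: cvec_def vec_eq_iff)
      moreover have "cvec x \<in> vec.span (cvec ` B)"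
        using step(1) by (intro vec.span_base) simp
      ultimately show ?case
        using step(2) by (simp add: vec.span_add vec.span_scale)
    qed
    show "range ((*v) (cmat M)) \<subseteq> vec.span (cvec ` B)"
    proof
      fix v assume "v \<in> range ((*v) (cmat M))"
      then have "Re_vec v \<in> V" "Im_vec v \<in> V"
        by (auto simp: V_def Re_vec_cmat Im_vec_cmat)
      then show "v \<in> vec.span (cvec ` B)"
        using B(3) span by (subst Re_Im_vec) (auto intro!: vec.span_add vec.span_scale)
    qed
    show "vec.independent (cvec ` B)"
    proof (rule vec.independent_if_scalars_zero)
      show "finite (cvec ` B)" using finB by simp
      fix u w assume u: "(\<Sum>x\<in>cvec ` B. u x *s x) = 0" and "w \<in> cvec ` B"
      then obtain b where b: "b \<in> B" "w = cvec b" by auto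
      have u: "(\<Sum>x\<in>B. u (cvec x) *s cvec x) = 0"
        using u by (simp add: sum.reindex[OF inj])
      \<comment> \<open>The real and imaginary parts of a complex relation between real vectors are
        two real relations.\<close>
      have Re: "Re_vec (\<Sum>x\<in>B. u (cvec x) *s cvec x) = (\<Sum>x\<in>B. Re (u (cvec x)) *\<^sub>R x)"
        and Im: "Im_vec (\<Sum>x\<in>B. u (cvec x) *s cvec x) = (\<Sum>x\<in>B. Im (u (cvec x)) *\<^sub>R x)"
        by (simp_all add: Re_vec_def Im_vec_def cvec_def vec_eq_iff)
      have "(\<Sum>x\<in>B. Re (u (cvec x)) *\<^sub>R x) = 0" "(\<Sum>x\<in>B. Im (u (cvec x)) *\<^sub>R x) = 0"
        unfolding Re[symmetric] Im[symmetric] u by (simp_all add: Re_vec_def Im_vec_def vec_eq_iff)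
      then have "Re (u (cvec b)) = 0" "Im (u (cvec b)) = 0"
        using independentD[OF B(2) finB subset_refl _ b(1), of "\<lambda>x. Re (u (cvec x))"]
          independentD[OF B(2) finB subset_refl _ b(1), of "\<lambda>x. Im (u (cvec x))"] by auto
      then show "u w = 0" by (simp add: b complex_eq_iff)
    qed
  qed simp
  also have "\<dots> = rank M"
    by (simp add: card_image[OF inj] B(4) V_def rank_dim_range)
  finally show ?thesis .
qed

subsection \<open>The positive semidefinite square root\<close>

lemma mat_poly_cmat: "cmat (mat_poly p M) = mat_poly (map_poly complex_of_real p) (cmat M)"
proof (induction p)
  case (pCons a p)
  have "cmat (mat a) = mat (complex_of_real a)" by (simp add: mat_def vec_eq_iff)
  moreover have "cmat (M + N) = cmat M + cmat N" for M N :: "real^'a^'a" by (simp add: vec_eq_iff)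
  ultimately show ?case
    using pCons by (simp add: mat_poly_pCons map_poly_pCons cmat_mult)
qed (simp add: vec_eq_iff)

lemma poly_map_poly_of_real: "poly (map_poly complex_of_real p) (complex_of_real x) = complex_of_real (poly p x)"
  by (induction p) (simp_all add: map_poly_pCons)

lemma mat_poly_X: "mat_poly [:0, 1:] M = M"
  by (simp add: matrix_eq mat_poly_pCons_vec)

lemma mat_poly_mult_matrix: "mat_poly (p * q) M = mat_poly p M ** mat_poly q M"
  by (simp add: matrix_eq mat_poly_mult flip: matrix_vector_mul_assoc)

lemma mat_poly_pcompose: "mat_poly (pcompose p q) M = mat_poly p (mat_poly q M)"
proof -
  have "mat_poly (pcompose p q) M *v v = mat_poly p (mat_poly q M) *v v" for v
    by (induction p) (simp_all add: pcompose_pCons mat_poly_pCons_vec mat_poly_add mat_poly_mult)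
  then show ?thesis by (simp add: matrix_eq)
qed

lemma transpose_mat_poly:
  assumes "transpose M = (M :: real^'n^'n)"
  shows "transpose (mat_poly p M) = mat_poly p M"
proof (induction p)
  case (pCons a p)
  have "transpose (M + N) = transpose M + transpose N" for M N :: "real^'n^'n"
    by (simp add: transpose_def vec_eq_iff)
  moreover have "mat_poly p M ** M = M ** mat_poly p M"
    by (simp add: matrix_eq mat_poly_commute flip: matrix_vector_mul_assoc)
  ultimately show ?case
    using pCons by (simp add: mat_poly_pCons matrix_transpose_mul assms)
qed (simp add: transpose_def vec_eq_iff)

text \<open>The complexified matrix has a spanning set of eigenvectors with real eigenvalues, and on
  each of them a polynomial acts by its value at the eigenvalue.\<close>

lemma mat_poly_cong:
  fixes M :: "real^'n^'n"
  assumes M: "transpose M = M" and eq: "\<And>x. complex_of_real x \<in> spectrum (cmat M) \<Longrightarrow> poly p x = poly q x"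
  shows "mat_poly p M = mat_poly q M"
proof -
  have "cmat (mat_poly p M) *v v = cmat (mat_poly q M) *v v" for v
  proof -
    obtain X f where f: "finite X" "v = (\<Sum>x\<in>X. f x)"
      "\<And>x. x \<in> X \<Longrightarrow> complex_of_real x \<in> spectrum (cmat M)"
      "\<And>x. x \<in> X \<Longrightarrow> f x \<in> UNIV \<and> cmat M *v f x = complex_of_real x *s f x"
      by (rule selfadjoint_expansion[OF selfadjoint_cmat[OF M] invariant_subspace_UNIV UNIV_I]) blast
    have "cmat (mat_poly r M) *v v = (\<Sum>x\<in>X. complex_of_real (poly r x) *s f x)" for r
      unfolding f(2) vec.linear_sum[OF matrix_vector_mul_linear_gen] mat_poly_cmat
      by (intro sum.cong refl)
        (simp only: mat_poly_eigenvector[OF f(4)[THEN conjunct2]] poly_map_poly_of_real)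
    then show ?thesis
      using eq f(3) by simp
  qed
  then have "cmat (mat_poly p M) = cmat (mat_poly q M)"
    by (simp add: matrix_eq)
  then show ?thesis by (simp add: cmat_inj)
qed

lemma poly_interpolation:
  fixes g :: "'a::field \<Rightarrow> 'a"
  assumes "finite X"
  shows "\<exists>p. \<forall>x\<in>X. poly p x = g x"
  using assms
proof (induction X)
  case (insert a X)
  then obtain p where p: "\<And>x. x \<in> X \<Longrightarrow> poly p x = g x" by blast
  obtain q where q: "\<And>x. poly q x = 0 \<longleftrightarrow> x \<in> X"
    by (rule poly_with_roots[OF insert(1)]) blast
  have "poly (p + smult ((g a - poly p a) / poly q a) q) x = g x" if "x \<in> insert a X" for x
    using that p q[of x] q[of a] insert(2) by auto
  then show ?case by blast
qed auto

text \<open>Existence interpolates a root function on the finite spectrum. For uniqueness, any psd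
  \<open>S\<close> with square \<open>M\<close> makes \<open>M\<close>, and hence
  \<open>T ** T\<close>, a polynomial in \<open>S\<close>; this polynomial takes the value s at each
  eigenvalue s of \<open>S\<close>, as s is nonnegative, so it evaluates to
  \<open>S\<close>.\<close>

lemma psd_sqrt_unique_exists:
  fixes M :: "real^'n^'n"
  assumes M: "psd M"
  shows "\<exists>!S. psd S \<and> S ** S = M"
proof -
  have tM: "transpose M = M" using M by (simp add: psd_def)
  define X where "X = {x. complex_of_real x \<in> spectrum (cmat M)}"
  have "finite X"
    using finite_vimageI[OF finite_spectrum_on[of "cmat M" UNIV], of complex_of_real]
    by (simp add: X_def vimage_def inj_of_real)
  \<comment> \<open>The fourth root is interpolated, not the square root: the square of the
    symmetric matrix \<open>T\<close> is then visibly positive semidefinite.\<close>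
  then obtain q where q: "\<And>x. x \<in> X \<Longrightarrow> poly q x = sqrt (sqrt x)"
    using poly_interpolation[of X "\<lambda>x. sqrt (sqrt x)"] by blast
  have X: "0 \<le> x" if "x \<in> X" for x
    using nonneg_form_eigenvalue[OF psd_cmat_form[OF M]] that by (auto simp: X_def)
  define T where "T = mat_poly q M"
  have tT: "transpose T = T" unfolding T_def by (rule transpose_mat_poly[OF tM])
  show ?thesis
  proof (rule ex1I[of _ "T ** T"], intro conjI)
    have "x \<bullet> (T *v (T *v x)) = (T *v x) \<bullet> (T *v x)" for x
      by (metis dot_lmul_matrix tT transpose_matrix_vector)
    then show "psd (T ** T)"
      by (simp add: psd_def matrix_transpose_mul tT flip: matrix_vector_mul_assoc)
    have "mat_poly (q * q * (q * q)) M = mat_poly [:0, 1:] M"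
    proof (rule mat_poly_cong[OF tM])
      fix x assume "complex_of_real x \<in> spectrum (cmat M)"
      then have "x \<in> X" by (simp add: X_def)
      then show "poly (q * q * (q * q)) x = poly [:0, 1:] x"
        using X by (simp add: q)
    qed
    then show "T ** T ** (T ** T) = M"
      by (simp only: mat_poly_mult_matrix mat_poly_X T_def)
    fix S assume S: "psd S \<and> S ** S = M"
    then have tS: "transpose S = S" by (simp add: psd_def)
    have MS: "mat_poly [:0, 0, 1:] S = M"
      using S by (simp add: matrix_eq mat_poly_pCons_vec flip: matrix_vector_mul_assoc)
    have "T ** T = mat_poly (pcompose (q * q) [:0, 0, 1:]) S"
      by (simp only: mat_poly_mult_matrix mat_poly_pcompose MS T_def)
    also have "\<dots> = mat_poly [:0, 1:] S"
    proof (rule mat_poly_cong[OF tS])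
      fix s assume s: "complex_of_real s \<in> spectrum (cmat S)"
      have "0 \<le> s"
        using nonneg_form_eigenvalue[OF psd_cmat_form s] S by blast
      obtain v where v: "v \<noteq> 0" "cmat S *v v = complex_of_real s *s v"
        using s by (auto simp: spectrum_on_def)
      have "cmat M *v v = cmat S *v (cmat S *v v)"
        using S by (auto simp: matrix_vector_mul_assoc simp flip: cmat_mult)
      also have "\<dots> = complex_of_real (s * s) *s v"
        by (simp add: v(2) vector_scalar_commute)
      finally have "s * s \<in> X"
        using v(1) by (auto simp: X_def spectrum_on_def)
      then show "poly (pcompose (q * q) [:0, 0, 1:]) s = poly [:0, 1:] s"
        using \<open>0 \<le> s\<close> by (simp add: poly_pcompose q)
    qed
    finally show "S = T ** T"
      by (simp add: mat_poly_X)
  qed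
qed

lemma psd_sqrt:
  assumes "psd M"
  shows "psd (psd_sqrt M)" "psd_sqrt M ** psd_sqrt M = M"
  using theI'[OF psd_sqrt_unique_exists[OF assms]] unfolding psd_sqrt_def by auto

lemma symmetric_inner: "transpose M = M \<Longrightarrow> (M *v x) \<bullet> y = x \<bullet> (M *v (y::real^'n))"
  by (metis dot_lmul_matrix transpose_matrix_vector)

lemma pos_def_inverse_sqrt:
  fixes \<alpha> :: "real^'n^'n"
  assumes \<alpha>: "pos_def \<alpha>"
  shows "psd_sqrt \<alpha> ** matrix_inv (psd_sqrt \<alpha>) = mat 1"
    "matrix_inv (psd_sqrt \<alpha>) ** psd_sqrt \<alpha> = mat 1"
    "transpose (matrix_inv (psd_sqrt \<alpha>)) = matrix_inv (psd_sqrt \<alpha>)"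
proof -
  have "0 \<le> x \<bullet> (\<alpha> *v x)" for x
    using \<alpha> by (cases "x = 0") (auto simp: pos_def_def less_imp_le)
  then have "psd \<alpha>" using \<alpha> by (simp add: psd_def pos_def_def)
  note S = psd_sqrt[OF this]
  define S where "S = psd_sqrt \<alpha>"
  have "x = 0" if "S *v x = 0" for x
  proof (rule ccontr)
    assume "x \<noteq> 0"
    have "\<alpha> *v x = S *v (S *v x)" by (simp add: S_def S matrix_vector_mul_assoc)
    with \<alpha> \<open>x \<noteq> 0\<close> that show False by (auto simp: pos_def_def)
  qed
  then have "invertible S"
    by (metis matrix_left_invertible_ker invertible_left_inverse)
  then have inv: "S ** matrix_inv S = mat 1 \<and> matrix_inv S ** S = mat 1"
    unfolding invertible_def matrix_inv_def by (rule someI_ex)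
  then show *: "psd_sqrt \<alpha> ** matrix_inv (psd_sqrt \<alpha>) = mat 1"
    "matrix_inv (psd_sqrt \<alpha>) ** psd_sqrt \<alpha> = mat 1"
    by (auto simp: S_def)
  have "transpose S = S" using S(1) by (simp add: psd_def S_def)
  then have "transpose (matrix_inv S) ** S = mat 1"
    using inv by (metis matrix_transpose_mul transpose_mat)
  then have "transpose (matrix_inv S) = matrix_inv S"
    using inv by (metis matrix_mul_assoc matrix_mul_lid matrix_mul_rid)
  then show "transpose (matrix_inv (psd_sqrt \<alpha>)) = matrix_inv (psd_sqrt \<alpha>)"
    by (simp add: S_def)
qed

subsection \<open>Complex conjugation\<close>

definition cnj_vec :: "complex^'n \<Rightarrow> complex^'n" where "cnj_vec v = (\<chi> i. cnj (v $ i))"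

lemma cnj_vec_cnj_vec [simp]: "cnj_vec (cnj_vec v) = v"
  and cnj_vec_0 [simp]: "cnj_vec 0 = 0"
  and cnj_vec_smult: "cnj_vec (c *s v) = cnj c *s cnj_vec v"
  by (simp_all add: cnj_vec_def vec_eq_iff)

lemma cnj_vec_eq_0_iff [simp]: "cnj_vec v = 0 \<longleftrightarrow> v = 0"
  by (metis cnj_vec_cnj_vec cnj_vec_0)

lemma cnj_vec_mult: "cnj_vec (M *v v) = map_matrix cnj M *v cnj_vec v"
  by (simp add: cnj_vec_def vec_eq_iff matrix_vector_mult_def)

lemma map_matrix_cnj_mult: "map_matrix cnj (M ** N) = map_matrix cnj M ** map_matrix cnj N"
  by (simp add: matrix_matrix_mult_def vec_eq_iff)

lemma map_matrix_cnj_adjoint: "hermitian_adjoint (map_matrix cnj M) = map_matrix cnj (hermitian_adjoint M)"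
  by (simp add: hermitian_adjoint_def transpose_def vec_eq_iff)

text \<open>The entrywise conjugate is again an orthogonal projection with range \<open>W\<close>,
  and such a projection is unique.\<close>

lemma orthogonal_projection_cnj:
  fixes W :: "(complex^'n) set"
  assumes W: "vec.subspace W" and cnj_W: "\<And>w. w \<in> W \<Longrightarrow> cnj_vec w \<in> W"
  shows "map_matrix cnj (orthogonal_projection W) = orthogonal_projection W"
proof -
  define P where "P = orthogonal_projection W"
  note P = orthogonal_projection[OF W, folded P_def]
  have P': "P ** P = P" "hermitian_adjoint P = P" "range ((*v) P) = W"
    using P by (auto simp: matrix_eq selfadjoint_iff image_iff simp flip: matrix_vector_mul_assoc)
       (metis P(4))
  have "map_matrix cnj P = P"
  proof (rule orthogonal_projection_unique[OF _ _ _ P'])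
    show "map_matrix cnj P ** map_matrix cnj P = map_matrix cnj P"
      by (simp add: P'(1) flip: map_matrix_cnj_mult)
    show "hermitian_adjoint (map_matrix cnj P) = map_matrix cnj P"
      by (simp add: P'(2) map_matrix_cnj_adjoint)
    have *: "map_matrix cnj P *v v = cnj_vec (P *v cnj_vec v)" for v
      by (simp add: cnj_vec_mult)
    show "range ((*v) (map_matrix cnj P)) = W"
    proof
      show "range ((*v) (map_matrix cnj P)) \<subseteq> W"
        using P(3) cnj_W by (auto simp: *)
      show "W \<subseteq> range ((*v) (map_matrix cnj P))"
      proof
        fix w assume "w \<in> W"
        then have "w = map_matrix cnj P *v w"
          using cnj_W by (simp add: * P(4))
        then show "w \<in> range ((*v) (map_matrix cnj P))" by (rule range_eqI)
      qed
    qed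
  qed
  then show ?thesis by (simp add: P_def)
qed

text \<open>Conjugating an eigenvector of a matrix with purely imaginary entries reverses the sign
  of a real eigenvalue.\<close>

lemma spectrum_symmetric:
  assumes "map_matrix cnj M = - M" and "complex_of_real x \<in> spectrum M"
  shows "complex_of_real (- x) \<in> spectrum M"
proof -
  obtain v where v: "v \<noteq> 0" "M *v v = complex_of_real x *s v"
    using assms(2) by (auto simp: spectrum_on_def)
  have neg: "(- M) *v w = - (M *v w)" for w
    using matrix_vector_mult_diff_rdistrib[of 0 M w] by simp
  have "- (M *v cnj_vec v) = complex_of_real x *s cnj_vec v"
    using cnj_vec_mult[of M v] assms(1) by (simp add: v(2) cnj_vec_smult neg)
  then have "M *v cnj_vec v = complex_of_real (- x) *s cnj_vec v"
    by (metis minus_minus of_real_minus vec.scale_minus_left)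
  then show ?thesis
    using v(1) unfolding spectrum_on_def by (intro CollectI bexI[of _ "cnj_vec v"]) auto
qed

subsection \<open>Block matrices\<close>

definition inl_vec :: "complex^'n::finite \<Rightarrow> complex^('n + 'm::finite)" where
  "inl_vec x = (\<chi> i. case i of Inl k \<Rightarrow> x $ k | Inr l \<Rightarrow> 0)"
definition inr_vec :: "complex^'m::finite \<Rightarrow> complex^('n::finite + 'm)" where
  "inr_vec y = (\<chi> i. case i of Inl k \<Rightarrow> 0 | Inr l \<Rightarrow> y $ l)"
definition left_part :: "complex^('n::finite + 'm::finite) \<Rightarrow> complex^'n" where
  "left_part v = (\<chi> k. v $ Inl k)"
definition right_part :: "complex^('n::finite + 'm::finite) \<Rightarrow> complex^'m" where
  "right_part v = (\<chi> l. v $ Inr l)"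

lemma sum_type_vec_eqI: "left_part u = left_part v \<Longrightarrow> right_part u = right_part v \<Longrightarrow> u = v"
  unfolding vec_eq_iff left_part_def right_part_def by (auto split: sum.split) (metis sum.exhaust)

lemma parts_simps [simp]:
  "left_part (inl_vec x) = x" "right_part (inl_vec x) = 0"
  "left_part (inr_vec y) = 0" "right_part (inr_vec y) = y"
  "left_part 0 = 0" "right_part 0 = 0"
  by (simp_all add: left_part_def right_part_def inl_vec_def inr_vec_def vec_eq_iff)

lemma sum_UNIV_Plus:
  "(\<Sum>i\<in>UNIV. f (i :: 'n::finite + 'm::finite)) = (\<Sum>k\<in>UNIV. f (Inl k)) + (\<Sum>l\<in>UNIV. f (Inr l))"
  unfolding UNIV_Plus_UNIV[symmetric] by (subst sum.Plus) simp_all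

lemma inner_parts: "u \<bullet> v = left_part u \<bullet> left_part v + right_part u \<bullet> right_part v"
  by (simp add: inner_vec_def sum_UNIV_Plus left_part_def right_part_def)

lemma block_matrix_vec:
  "left_part (block_matrix P Q S T *v v) = P *v left_part v + Q *v right_part v"
  "right_part (block_matrix P Q S T *v v) = S *v left_part v + T *v right_part v"
  by (simp_all add: left_part_def right_part_def block_matrix_def matrix_vector_mult_def sum_UNIV_Plus vec_eq_iff)

lemma hermitian_adjoint_block_matrix:
  "hermitian_adjoint (block_matrix P Q S T) =
    block_matrix (hermitian_adjoint P) (hermitian_adjoint S) (hermitian_adjoint Q) (hermitian_adjoint T)"
  by (simp add: hermitian_adjoint_def block_matrix_def transpose_def vec_eq_iff split: sum.split)

lemma map_matrix_block_matrix:
  "map_matrix f (block_matrix P Q S T) =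
    block_matrix (map_matrix f P) (map_matrix f Q) (map_matrix f S) (map_matrix f T)"
  by (simp add: block_matrix_def vec_eq_iff split: sum.split)

lemma uminus_block_matrix:
  "- block_matrix P Q S T = block_matrix (- P) (- Q) (- S) (- T :: 'a::ab_group_add^'b^'c)"
  by (simp add: block_matrix_def vec_eq_iff split: sum.split)

lemma hermitian_adjoint_cscale_cmat:
  "hermitian_adjoint (cscale c (cmat M)) = cscale (cnj c) (cmat (transpose M))"
  by (simp add: hermitian_adjoint_def cscale_def transpose_def vec_eq_iff)

lemma linear_inl_vec: "Vector_Spaces.linear (*s) (*s) inl_vec"
  and linear_inr_vec: "Vector_Spaces.linear (*s) (*s) inr_vec"
  by (unfold_locales; simp add: inl_vec_def inr_vec_def vec_eq_iff algebra_simps split: sum.split)+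

lemma vec_dim_image_inl: "vec.dim (inl_vec ` W) = vec.dim W"
  by (rule vec.dim_image_eq[OF linear_inl_vec]) (rule inj_on_inverseI[where g = left_part], simp)

lemma vec_dim_image_inr: "vec.dim (inr_vec ` W) = vec.dim W"
  by (rule vec.dim_image_eq[OF linear_inr_vec]) (rule inj_on_inverseI[where g = right_part], simp)

subsection \<open>The matrices of the system operator\<close>

lemma selfadjoint_\<Omega>_matrix:
  fixes \<alpha> \<eta> \<theta> :: "real^'n^'n"
  assumes \<alpha>: "pos_def \<alpha>" and \<theta>: "transpose \<theta> = - \<theta>"
  shows "selfadjoint (\<Omega>_matrix \<alpha> \<eta> \<theta>)"
proof -
  define T where "T = matrix_inv (psd_sqrt \<alpha>)"
  have T: "transpose T = T" unfolding T_def by (rule pos_def_inverse_sqrt[OF \<alpha>])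
  have neg: "A ** - B = - (A ** B)" "- A ** B = - (A ** B)" for A B :: "real^'n^'n"
    by (simp_all add: matrix_matrix_mult_def vec_eq_iff sum_negf)
  have "transpose (T ** \<theta> ** T) = - (T ** \<theta> ** T)"
    by (simp add: matrix_transpose_mul T \<theta> matrix_mul_assoc neg)
  moreover have "cscale c (- M) = cscale (- c) M" for c and M :: "complex^'n^'n"
    by (simp add: cscale_def vec_eq_iff)
  moreover have "hermitian_adjoint (0 :: complex^'n^'n) = 0"
    by (simp add: hermitian_adjoint_def transpose_def vec_eq_iff)
  ultimately show ?thesis
    unfolding selfadjoint_iff \<Omega>_matrix_def T_def[symmetric] hermitian_adjoint_block_matrix
      hermitian_adjoint_cscale_cmat
    by (simp add: cmat_uminus)
qed

lemma cnj_\<Omega>_matrix: "map_matrix cnj (\<Omega>_matrix \<alpha> \<eta> \<theta>) = - \<Omega>_matrix \<alpha> \<eta> \<theta>"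
  unfolding \<Omega>_matrix_def map_matrix_block_matrix uminus_block_matrix
  by (intro arg_cong4[where f = block_matrix]) (simp_all add: cscale_def vec_eq_iff)

lemma cnj_B_matrix: "map_matrix cnj (B_matrix \<alpha> R) = B_matrix \<alpha> R"
  unfolding B_matrix_def map_matrix_block_matrix
  by (intro arg_cong4[where f = block_matrix]) (simp_all add: vec_eq_iff)

lemma B_matrix_vec:
  "B_matrix \<alpha> R *v v = inl_vec (cmat (matrix_inv (psd_sqrt \<alpha>) ** R ** matrix_inv (psd_sqrt \<alpha>)) *v left_part v)"
  by (rule sum_type_vec_eqI) (simp_all add: B_matrix_def block_matrix_vec)

lemma psd_conjugate:
  assumes "transpose T = T" "psd R"
  shows "psd (T ** R ** T)"
  unfolding psd_def
proof (intro conjI allI)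
  show "transpose (T ** R ** T) = T ** R ** T"
    using assms by (simp add: matrix_transpose_mul psd_def matrix_mul_assoc)
  fix x
  have "x \<bullet> (T ** R ** T *v x) = (T *v x) \<bullet> (R *v (T *v x))"
    by (simp add: symmetric_inner[OF assms(1)] flip: matrix_vector_mul_assoc)
  then show "0 \<le> x \<bullet> (T ** R ** T *v x)"
    using assms(2) by (simp add: psd_def)
qed

lemma B_matrix_nonneg:
  fixes \<alpha> R :: "real^'n^'n"
  assumes "pos_def \<alpha>" "psd R"
  shows "selfadjoint (B_matrix \<alpha> R)" "0 \<le> v \<bullet> (B_matrix \<alpha> R *v v)"
proof -
  have psd: "psd (matrix_inv (psd_sqrt \<alpha>) ** R ** matrix_inv (psd_sqrt \<alpha>))"
    by (rule psd_conjugate[OF pos_def_inverse_sqrt(3)[OF assms(1)] assms(2)])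
  have "hermitian_adjoint (0 :: complex^'n^'n) = 0"
    by (simp add: hermitian_adjoint_def transpose_def vec_eq_iff)
  with psd show "selfadjoint (B_matrix \<alpha> R)"
    unfolding selfadjoint_iff B_matrix_def hermitian_adjoint_block_matrix hermitian_adjoint_cmat
    by (simp add: psd_def)
  show "0 \<le> v \<bullet> (B_matrix \<alpha> R *v v)"
    using psd_cmat_form[OF psd] by (simp add: B_matrix_vec inner_parts)
qed

text \<open>\<open>B\<close> acts as the complexification of \<open>T ** R ** T\<close> on the first
  summand, and the invertible factors \<open>T\<close> preserve the rank.\<close>

lemma rank_B_matrix:
  fixes \<alpha> R :: "real^'n^'n"
  assumes "pos_def \<alpha>"
  shows "vec.dim (range ((*v) (B_matrix \<alpha> R))) = rank R"
proof -
  define S where "S = psd_sqrt \<alpha>"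
  define T where "T = matrix_inv S"
  have ST: "S ** T = mat 1" "T ** S = mat 1"
    unfolding S_def T_def by (rule pos_def_inverse_sqrt[OF assms])+
  have "range ((*v) (B_matrix \<alpha> R)) = inl_vec ` range ((*v) (cmat (T ** R ** T)))"
  proof (intro set_eqI iffI)
    fix v :: "complex^('n + 'n)" assume "v \<in> inl_vec ` range ((*v) (cmat (T ** R ** T)))"
    then obtain x where "v = inl_vec (cmat (T ** R ** T) *v x)" by auto
    then have "v = B_matrix \<alpha> R *v inl_vec x"
      by (simp add: B_matrix_vec T_def S_def)
    then show "v \<in> range ((*v) (B_matrix \<alpha> R))" by (rule range_eqI)
  qed (auto simp: B_matrix_vec T_def S_def)
  then have "vec.dim (range ((*v) (B_matrix \<alpha> R))) = rank (T ** R ** T)"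
    by (simp add: vec_dim_image_inl vec_dim_range_cmat)
  also have "\<dots> = rank R"
  proof (rule antisym)
    show "rank (T ** R ** T) \<le> rank R"
      by (rule order_trans[OF rank_mul_le_left rank_mul_le_right])
    have "R = S ** (T ** R ** T) ** S"
      by (metis ST matrix_mul_assoc matrix_mul_lid matrix_mul_rid)
    then show "rank R \<le> rank (T ** R ** T)"
      by (metis order_trans rank_mul_le_left rank_mul_le_right)
  qed
  finally show ?thesis .
qed

text \<open>The first component x of \<open>u\<close> is annihilated by both blocks
  \<open>T ** R ** T\<close> and \<open>\<Phi>\<close>, so \<open>T\<close> maps its real and
  imaginary parts into the common kernel of \<open>R\<close> and \<open>\<eta>\<close>. This is the
  nondegeneracy needed for the rank of the compression of \<open>\<Omega>\<close> to Ker
  \<open>B\<close>.\<close>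

lemma \<Omega>_B_matrix_kernel:
  fixes \<alpha> \<eta> \<theta> R :: "real^'n^'n"
  assumes \<alpha>: "pos_def \<alpha>" and \<eta>: "psd \<eta>" and ker: "{x. R *v x = 0} \<inter> {x. \<eta> *v x = 0} = {0}"
    and u: "B_matrix \<alpha> R *v u = 0" "right_part u = 0" "right_part (\<Omega>_matrix \<alpha> \<eta> \<theta> *v u) = 0"
  shows "u = 0"
proof -
  define S where "S = psd_sqrt \<alpha>"
  define T where "T = matrix_inv S"
  have ST: "S ** T = mat 1" "T ** S = mat 1"
    unfolding S_def T_def by (rule pos_def_inverse_sqrt[OF \<alpha>])+
  define x where "x = left_part u"
  have R: "cmat (T ** R ** T) *v x = 0"
    using arg_cong[OF u(1), of left_part] by (simp add: B_matrix_vec x_def T_def S_def)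
  have "\<i> *s (cmat (psd_sqrt \<eta> ** T) *v x) = 0"
    using u(2,3) by (simp add: \<Omega>_matrix_def \<Phi>_matrix_def block_matrix_vec cscale_mult_vec x_def T_def S_def)
  then have \<Phi>: "cmat (psd_sqrt \<eta> ** T) *v x = 0"
    by (simp add: vec.scale_eq_0_iff)
  have real: "a = 0" if "(T ** R ** T) *v a = 0" "(psd_sqrt \<eta> ** T) *v a = 0" for a
  proof -
    have "S *v ((T ** R ** T) *v a) = R *v (T *v a)"
      by (metis ST(1) matrix_mul_assoc matrix_mul_lid matrix_vector_mul_assoc)
    then have "R *v (T *v a) = 0" using that by simp
    moreover have "\<eta> *v (T *v a) = psd_sqrt \<eta> *v ((psd_sqrt \<eta> ** T) *v a)"
      by (metis psd_sqrt(2)[OF \<eta>] matrix_vector_mul_assoc)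
    then have "\<eta> *v (T *v a) = 0" using that by simp
    ultimately have "T *v a = 0" using ker by blast
    then have "S *v (T *v a) = 0" by simp
    then show ?thesis by (simp add: ST matrix_vector_mul_assoc)
  qed
  have zero: "Re_vec (0 :: complex^'n) = 0" "Im_vec (0 :: complex^'n) = 0"
    by (simp_all add: Re_vec_def Im_vec_def vec_eq_iff)
  have "Re_vec x = 0" "Im_vec x = 0"
    using arg_cong[OF R, of Re_vec] arg_cong[OF \<Phi>, of Re_vec]
      arg_cong[OF R, of Im_vec] arg_cong[OF \<Phi>, of Im_vec]
    by (auto simp: Re_vec_cmat Im_vec_cmat zero intro: real)
  then have "x = 0" by (intro Re_Im_vec_eqI) (simp_all add: zero)
  then show ?thesis
    using u(2) by (intro sum_type_vec_eqI) (simp_all add: x_def)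
qed

lemma \<Omega>_matrix_inr: "left_part v = 0 \<Longrightarrow> right_part (\<Omega>_matrix \<alpha> \<eta> \<theta> *v v) = 0"
  by (simp add: \<Omega>_matrix_def block_matrix_vec)

subsection \<open>Nonzero eigenvalues and the range\<close>

text \<open>Contrapositive of \<open>selfadjoint_norm_lower_bound\<close>: if every eigenvalue gave
  a distance above \<open>e\<close>, so would the minimum over the finite spectrum, and the residual
  would be too large.\<close>

lemma selfadjoint_approximate_eigenvalue:
  assumes M: "selfadjoint M" and W: "invariant_subspace M W" and v: "v \<in> W" "v \<noteq> 0"
    and le: "norm (a *s (M *v v) + z *s v) \<le> e * norm v"
  obtains x where "complex_of_real x \<in> spectrum_on M W" "cmod (a * x + z) \<le> e"
proof -
  have "\<exists>x. complex_of_real x \<in> spectrum_on M W \<and> cmod (a * x + z) \<le> e"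
  proof (rule ccontr)
    assume neg: "\<not> ?thesis"
    have gt: "e < cmod (a * y + z)" if y: "y \<in> spectrum_on M W" for y
    proof -
      obtain x where "y = complex_of_real x" by (rule selfadjoint_spectrum_real[OF M y])
      with y neg show ?thesis by (auto simp: not_le)
    qed
    define D where "D = (\<lambda>y. cmod (a * y + z)) ` spectrum_on M W"
    have D: "finite D" "D \<noteq> {}"
      using spectrum_on_nonempty[OF W v] by (auto simp: D_def)
    have "Min D \<in> D" using D by (rule Min_in)
    then have "e < Min D" "0 \<le> Min D" using gt by (auto simp: D_def)
    have "Min D * norm v \<le> norm (a *s (M *v v) + z *s v)"
    proof (rule selfadjoint_norm_lower_bound[OF M W v(1) \<open>0 \<le> Min D\<close>])
      show "Min D \<le> cmod (a * x + z)" if "complex_of_real x \<in> spectrum_on M W" for x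
        using that D by (intro Min_le) (auto simp: D_def)
    qed
    moreover have "e * norm v < Min D * norm v"
      using v(2) \<open>e < Min D\<close> by simp
    ultimately show False using le by linarith
  qed
  with that show ?thesis by blast
qed

lemma finite_real_spectrum: "finite {x. complex_of_real x \<in> spectrum_on M W}"
  using finite_vimageI[OF finite_spectrum_on[of M W], of complex_of_real]
  by (simp add: vimage_def inj_of_real)

lemma invariant_range: "invariant_subspace M (range ((*v) M))"
  by (auto simp: invariant_subspace_def subspace_range)

lemma spectrum_on_range:
  assumes M: "selfadjoint M" and z: "z \<in> spectrum_on M (range ((*v) M))"
  shows "z \<noteq> 0" "z \<in> spectrum M"
proof -
  obtain v where v: "v \<in> range ((*v) M)" "v \<noteq> 0" "M *v v = z *s v"
    using z by (auto simp: spectrum_on_def)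
  show "z \<noteq> 0"
  proof
    assume "z = 0"
    then have "v \<in> {v. M *v v = 0}" using v by simp
    then show False
      using v orthogonal_comp_Int[of "range ((*v) M)"] by (auto simp: selfadjoint_kernel[OF M])
  qed
  show "z \<in> spectrum M" using z spectrum_on_mono by blast
qed

text \<open>\<open>M\<close> kills the component with eigenvalue 0 and reproduces every other one up
  to a factor that can be divided out.\<close>

lemma range_eq_eigenspace_sum:
  assumes M: "selfadjoint M"
  shows "range ((*v) M) = eigenspace_sum M UNIV {x. x \<noteq> 0 \<and> complex_of_real x \<in> spectrum M}"
proof -
  define X where "X = {x. complex_of_real x \<in> spectrum M}"
  have finX: "finite X" unfolding X_def by (rule finite_real_spectrum)
  have X0: "{x. x \<noteq> 0 \<and> complex_of_real x \<in> spectrum M} = X - {0}" by (auto simp: X_def)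
  show ?thesis
    unfolding X0
  proof (intro equalityI subsetI)
    fix w assume "w \<in> range ((*v) M)"
    then obtain v where w: "w = M *v v" by auto
    have "v \<in> eigenspace_sum M UNIV X"
      using selfadjoint_eigenspace_sum[OF M invariant_subspace_UNIV] by (simp add: X_def)
    then obtain f where f: "v = (\<Sum>x\<in>X. f x)" "\<And>x. x \<in> X \<Longrightarrow> M *v f x = complex_of_real x *s f x"
      by (auto simp: eigenspace_sum_def)
    have "w = (\<Sum>x\<in>X. complex_of_real x *s f x)"
      unfolding w f(1) vec.linear_sum[OF matrix_vector_mul_linear_gen] using f(2) by (intro sum.cong) auto
    also have "\<dots> = (\<Sum>x\<in>X - {0}. complex_of_real x *s f x)"
      using finX by (intro sum.mono_neutral_right) auto
    also have "\<dots> \<in> eigenspace_sum M UNIV (X - {0})"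
      using f(2) by (intro eigenspace_sumI) (auto simp: vector_scalar_commute)
    finally show "w \<in> eigenspace_sum M UNIV (X - {0})" .
  next
    fix w assume "w \<in> eigenspace_sum M UNIV (X - {0})"
    then obtain f where f: "w = (\<Sum>x\<in>X - {0}. f x)"
      "\<And>x. x \<in> X - {0} \<Longrightarrow> M *v f x = complex_of_real x *s f x"
      by (auto simp: eigenspace_sum_def)
    have "f x \<in> range ((*v) M)" if x: "x \<in> X - {0}" for x
    proof -
      have "f x = M *v ((1 / complex_of_real x) *s f x)"
        using f(2)[OF x] x by (simp add: vector_scalar_commute)
      then show ?thesis by (rule range_eqI)
    qed
    then show "w \<in> range ((*v) M)"
      unfolding f(1) by (intro vec.subspace_sum subspace_range)
  qed
qed

lemma nonzero_eigenvalue_exists: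
  assumes "selfadjoint M" "M \<noteq> 0"
  shows "{x. x \<noteq> 0 \<and> complex_of_real x \<in> spectrum M} \<noteq> {}"
proof
  assume "{x. x \<noteq> 0 \<and> complex_of_real x \<in> spectrum M} = {}"
  then have "range ((*v) M) = eigenspace_sum M UNIV {}"
    using range_eq_eigenspace_sum[OF assms(1)] by (simp only:)
  also have "\<dots> = {0}" by (auto simp: eigenspace_sum_def)
  finally have "M = 0" by (auto simp: matrix_eq)
  with assms(2) show False by contradiction
qed

text \<open>The list without its leading 0 has length equal to the rank, because the dimensions of
  the eigenspaces add up to it. Hence the indices from 1 to the rank hit exactly the nonzero
  eigenvalues.\<close>

lemma zero_and_nonzero_eigenvalues:
  assumes M: "selfadjoint M"
  shows "zero_and_nonzero_eigenvalues M ! 0 = 0"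
    "(!) (zero_and_nonzero_eigenvalues M) ` {1..vec.dim (range ((*v) M))}
      = {x. x \<noteq> 0 \<and> complex_of_real x \<in> spectrum M}"
proof -
  define X where "X = {x. x \<noteq> 0 \<and> complex_of_real x \<in> spectrum M}"
  define m where "m x = vec.dim {v. M *v v = complex_of_real x *s v}" for x
  define L where "L = sorted_list_of_multiset (\<Sum>x\<in>X. replicate_mset (m x) x)"
  have finX: "finite X"
    by (rule finite_subset[OF _ finite_real_spectrum[of M UNIV]]) (auto simp: X_def)
  have eq: "zero_and_nonzero_eigenvalues M = 0 # L"
    by (simp add: zero_and_nonzero_eigenvalues_def L_def X_def m_def)
  have mset: "mset L = (\<Sum>x\<in>X. replicate_mset (m x) x)"
    by (simp add: L_def)
  have "length L = (\<Sum>x\<in>X. m x)"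
  proof -
    have "size (\<Sum>x\<in>X. replicate_mset (m x) x) = (\<Sum>x\<in>X. m x)"
      using finX by (induction X rule: finite_induct) auto
    then show ?thesis by (simp flip: mset)
  qed
  also have "\<dots> = vec.dim (range ((*v) M))"
    using dim_eigenspace_sum[OF M vec.subspace_UNIV finX] range_eq_eigenspace_sum[OF M]
    by (simp add: X_def m_def)
  finally have len: "length L = vec.dim (range ((*v) M))" .
  have pos: "0 < m x" if x: "x \<in> X" for x
  proof -
    obtain v where v: "v \<noteq> 0" "M *v v = complex_of_real x *s v"
      using x by (auto simp: X_def spectrum_on_def)
    then have "\<not> {v. M *v v = complex_of_real x *s v} \<subseteq> {0}" by blast
    then show ?thesis
      unfolding m_def by (metis vec.dim_eq_0 gr0I)
  qed
  have set_L: "set L = X"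
  proof -
    have "x \<in># (\<Sum>x\<in>X. replicate_mset (m x) x) \<longleftrightarrow> (\<exists>y\<in>X. x \<in># replicate_mset (m y) y)" for x
      using finX by (induction X rule: finite_induct) auto
    then have "x \<in> set L \<longleftrightarrow> x \<in> X" for x
      using pos by (simp add: mset flip: set_mset_mset)
    then show ?thesis by blast
  qed
  show "zero_and_nonzero_eigenvalues M ! 0 = 0" by (simp add: eq)
  \<comment> \<open>The leading 0 shifts all positions by one.\<close>
  have "(!) (0 # L) ` {1..length L} = (!) L ` {0..<length L}"
  proof -
    have "{1..length L} = Suc ` {0..<length L}"
      by (simp add: image_Suc_atLeastLessThan atLeastLessThanSuc_atLeastAtMost)
    then show ?thesis by (simp only: image_image nth_Cons_Suc)
  qed
  also have "\<dots> = X"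
    using set_L by (auto simp: set_conv_nth image_iff)
  finally show "(!) (zero_and_nonzero_eigenvalues M) ` {1..vec.dim (range ((*v) M))}
      = {x. x \<noteq> 0 \<and> complex_of_real x \<in> spectrum M}"
    by (simp add: eq len X_def)
qed

subsection \<open>Two elementary inequalities\<close>

text \<open>Here p and q are the norms of the components in Ker \<open>B\<close> and in Ran
  \<open>B\<close>, t is their coupling through \<Omega>, and d is \<beta> b. Completing the square
  leaves the coefficient \<open>d * \<kappa> - (\<kappa>\<^sup>2 + 1) * \<omega>\<close> of p q,
  which the relation between d and \<kappa> makes positive.\<close>

lemma lyapunov_inequality:
  fixes \<kappa> \<omega> d p q t :: real
  assumes "0 < \<kappa>" "\<kappa> < 1" "0 < \<omega>" "d * \<kappa> = 2 * \<omega> + 2 * \<omega> * \<kappa>" "0 \<le> p" "0 \<le> q" "0 < p \<or> 0 < q"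
    and t: "- (\<omega> * p * q) \<le> t"
  shows "0 < (\<kappa>\<^sup>2 + 1) * t + d * q\<^sup>2 + d / 2 * (\<kappa>\<^sup>2 * p\<^sup>2 - q\<^sup>2)"
proof -
  have d: "0 < d"
    using assms by (smt (verit) mult_pos_pos zero_less_mult_pos2)
  have "(\<kappa>\<^sup>2 + 1) * t + d * q\<^sup>2 + d / 2 * (\<kappa>\<^sup>2 * p\<^sup>2 - q\<^sup>2)
      = (\<kappa>\<^sup>2 + 1) * (t + \<omega> * p * q) + (d * \<kappa> - (\<kappa>\<^sup>2 + 1) * \<omega>) * (p * q) + d / 2 * (\<kappa> * p - q)\<^sup>2"
    by (simp add: power2_eq_square field_simps)
  also have "d * \<kappa> - (\<kappa>\<^sup>2 + 1) * \<omega> = \<omega> * (1 + \<kappa> * (2 - \<kappa>))"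
    using assms(4) by (simp add: power2_eq_square algebra_simps)
  also have "0 < (\<kappa>\<^sup>2 + 1) * (t + \<omega> * p * q) + \<omega> * (1 + \<kappa> * (2 - \<kappa>)) * (p * q) + d / 2 * (\<kappa> * p - q)\<^sup>2"
  proof -
    have 1: "0 \<le> (\<kappa>\<^sup>2 + 1) * (t + \<omega> * p * q)" using t by simp
    have 2: "0 < \<omega> * (1 + \<kappa> * (2 - \<kappa>))"
      using assms by (intro mult_pos_pos add_pos_pos) auto
    show ?thesis
    proof (cases "p = 0 \<or> q = 0")
      case True
      then have "\<kappa> * p - q \<noteq> 0" using assms by auto
      then have "0 < d / 2 * (\<kappa> * p - q)\<^sup>2" using d by simp
      then show ?thesis using 1 True by auto
    next
      case False
      then have "0 < p * q" using assms by simp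
      then have "0 < \<omega> * (1 + \<kappa> * (2 - \<kappa>)) * (p * q)" using 2 by (rule mult_pos_pos[rotated])
      moreover have "0 \<le> d / 2 * (\<kappa> * p - q)\<^sup>2" using d by simp
      ultimately show ?thesis using 1 by linarith
    qed
  qed
  finally show ?thesis .
qed

text \<open>In the application s is \<rho> / 2, a and z are the norms of the components of
  \<open>P *v v\<close> in Ran \<open>M\<close> and orthogonal to it, and x and y are those of the
  perturbation. The first factor 2 reflects that \<open>M\<close> is bounded below by \<rho>, twice
  the radius.\<close>

lemma stein_inequality:
  fixes a z x y m s :: real
  assumes "0 \<le> s" "0 \<le> a" "0 \<le> x" "2 * s * a - x \<le> m" "x\<^sup>2 + y\<^sup>2 < s\<^sup>2 * (a\<^sup>2 + z\<^sup>2)"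
  shows "s\<^sup>2 * (a\<^sup>2 - z\<^sup>2) < m\<^sup>2 - y\<^sup>2"
proof (cases "x \<le> 2 * s * a")
  case True
  then have "(2 * s * a - x)\<^sup>2 \<le> m\<^sup>2"
    using assms(4) by (intro power_mono) auto
  \<comment> \<open>Dropping the square on the right leaves
    \<open>2 * s\<^sup>2 * a\<^sup>2 - x\<^sup>2\<close> as a lower bound for
    \<open>m\<^sup>2\<close>, just enough to absorb the bound on
    \<open>x\<^sup>2 + y\<^sup>2\<close>.\<close>
  moreover have "(2 * s * a - x)\<^sup>2 = s\<^sup>2 * a\<^sup>2 + s\<^sup>2 * a\<^sup>2 - x\<^sup>2 + 2 * (s * a - x)\<^sup>2"
    by (simp add: power2_eq_square algebra_simps)
  moreover have "0 \<le> (s * a - x)\<^sup>2" by simp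
  ultimately show ?thesis
    using assms(5) unfolding right_diff_distrib distrib_left by linarith
next
  case False
  then have "(2 * s * a)\<^sup>2 \<le> x\<^sup>2"
    using assms by (intro power_mono) auto
  then have "4 * (s\<^sup>2 * a\<^sup>2) \<le> x\<^sup>2" by (simp add: power2_eq_square algebra_simps)
  moreover have "0 \<le> s\<^sup>2 * a\<^sup>2" "0 \<le> m\<^sup>2" by simp_all
  ultimately show ?thesis
    using assms(5) unfolding right_diff_distrib distrib_left by linarith
qed

subsection \<open>Overdamped systems\<close>

text \<open>Isolates the properties of the concrete matrices on which the spectral argument rests.
  The two conjugation conditions say that \<open>\<Omega>\<close> is imaginary and \<open>B\<close>
  real; they make the spectrum of \<open>M\<close> symmetric about 0.\<close>

locale overdamped =
  fixes \<Omega> B A P M :: "complex^'m^'m" and \<beta> \<omega> b \<rho> c :: real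
  assumes \<Omega>: "selfadjoint \<Omega>" "map_matrix cnj \<Omega> = - \<Omega>"
    and B: "selfadjoint B" "\<And>v. 0 \<le> v \<bullet> (B *v v)" "map_matrix cnj B = B" "B \<noteq> 0"
    and \<beta>: "0 \<le> \<beta>"
    and A: "A = \<Omega> - cscale (\<i> * of_real \<beta>) B"
    and P_def: "P = orthogonal_projection {v. B *v v = 0}"
    and M: "M = P ** \<Omega> ** P" "M \<noteq> 0"
    and \<omega>: "\<omega> = onorm ((*v) \<Omega>)"
    and b: "b = min_nonzero_eigenvalue B"
    and \<rho>_def: "\<rho> = min_pos_eigenvalue M"
    and c: "c = c_bound \<omega> b \<beta>"
    and \<beta>_gt: "\<beta> > c_bound_inv \<omega> b (\<rho> / 2)"
begin

section \<open>Kernel of B, compression of Omega, and the constants\<close>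

abbreviation K where "K \<equiv> {v. B *v v = 0}"

definition X where "X = {x. x \<noteq> 0 \<and> complex_of_real x \<in> spectrum B}"

lemma K_eq: "K = (range ((*v) B))\<^sup>\<bottom>"
  by (rule selfadjoint_kernel[OF B(1)])

lemmas P = orthogonal_projection[OF subspace_kernel[of B], folded P_def]

lemma BP [simp]: "B *v (P *v v) = 0"
  using P(3) by simp

lemma PB [simp]: "P *v (B *v v) = 0"
proof (rule P(5))
  show "B *v v \<in> K\<^sup>\<bottom>"
    using selfadjointD[OF B(1)] by (auto simp: orthogonal_comp_altdef simp flip: selfadjointD[OF B(1)])
qed

lemma M_vec: "M *v v = P *v (\<Omega> *v (P *v v))"
  by (simp add: M flip: matrix_vector_mul_assoc)

lemma selfadjoint_M: "selfadjoint M"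
  using P(2) \<Omega>(1) by (simp add: selfadjoint_def M_vec)

lemma cnj_M: "map_matrix cnj M = - M"
proof -
  have "cnj_vec w \<in> K" if "w \<in> K" for w
    using cnj_vec_mult[of B w] that B(3) by simp
  then have "map_matrix cnj P = P"
    unfolding P_def by (intro orthogonal_projection_cnj subspace_kernel)
  moreover have "P ** - \<Omega> ** P = - (P ** \<Omega> ** P)"
    by (simp add: matrix_matrix_mult_def vec_eq_iff sum_negf)
  ultimately show ?thesis
    by (simp add: M map_matrix_cnj_mult \<Omega>(2))
qed

lemma range_M_subset: "range ((*v) M) \<subseteq> K"
  using P(3) by (auto simp: M_vec)

lemma complement_in_range: "v - P *v v \<in> range ((*v) B)"
proof -
  obtain r k where rk: "v = r + k" "r \<in> range ((*v) B)" "k \<in> (range ((*v) B))\<^sup>\<bottom>"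
    using orthogonal_comp_decomp[OF subspace_range[of B], of v] by blast
  then have "k \<in> K" using K_eq by blast
  then have "P *v k = k" by (rule P(4))
  moreover have "P *v r = 0" using rk(2) by auto
  ultimately show ?thesis
    using rk by (simp add: matrix_vector_right_distrib)
qed

lemma finite_X [simp]: "finite X"
  unfolding X_def by (rule finite_subset[OF _ finite_real_spectrum[of B UNIV]]) auto

lemma X_nonempty: "X \<noteq> {}"
  unfolding X_def by (rule nonzero_eigenvalue_exists[OF B(1,4)])

lemma X_pos: "x \<in> X \<Longrightarrow> 0 < x"
  using nonneg_form_eigenvalue[OF B(2), of x UNIV] by (auto simp: X_def)

lemma b_eq: "b = Min X"
  by (simp add: b min_nonzero_eigenvalue_def X_def)

lemma b_in: "b \<in> X" and b_le: "x \<in> X \<Longrightarrow> b \<le> x"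
  using X_nonempty by (auto simp: b_eq)

lemma b_pos: "0 < b"
  by (rule X_pos[OF b_in])

lemma spectrum_M_symmetric: "complex_of_real x \<in> spectrum M \<Longrightarrow> complex_of_real \<bar>x\<bar> \<in> spectrum M"
  using spectrum_symmetric[OF cnj_M, of x] by (auto simp: abs_if)

text \<open>A nonzero \<open>M\<close> has a nonzero real eigenvalue, and by symmetry also its
  absolute value. So the minimum ranges over a nonempty set, and the smallest positive eigenvalue
  bounds all nonzero ones in modulus.\<close>

lemma \<rho>: "complex_of_real \<rho> \<in> spectrum M" "0 < \<rho>"
  "complex_of_real x \<in> spectrum M \<Longrightarrow> x \<noteq> 0 \<Longrightarrow> \<rho> \<le> \<bar>x\<bar>"
proof -
  define Y where "Y = {x. 0 < x \<and> complex_of_real x \<in> spectrum M}"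
  have finY: "finite Y"
    unfolding Y_def by (rule finite_subset[OF _ finite_real_spectrum[of M UNIV]]) auto
  have "Y \<noteq> {}"
  proof -
    obtain x where "x \<noteq> 0" "complex_of_real x \<in> spectrum M"
      using nonzero_eigenvalue_exists[OF selfadjoint_M M(2)] by blast
    then have "\<bar>x\<bar> \<in> Y"
      using spectrum_M_symmetric[of x] by (simp add: Y_def)
    then show ?thesis by blast
  qed
  moreover have "\<rho> = Min Y"
    by (simp add: \<rho>_def min_pos_eigenvalue_def Y_def)
  ultimately have "\<rho> \<in> Y" and min: "\<And>y. y \<in> Y \<Longrightarrow> \<rho> \<le> y"
    using finY by auto
  then show "complex_of_real \<rho> \<in> spectrum M" "0 < \<rho>"
    by (auto simp: Y_def)
  show "\<rho> \<le> \<bar>x\<bar>" if "complex_of_real x \<in> spectrum M" "x \<noteq> 0"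
    using that spectrum_M_symmetric by (intro min) (auto simp: Y_def)
qed

lemma norm_\<Omega>: "norm (\<Omega> *v v) \<le> \<omega> * norm v"
  unfolding \<omega> by (rule onorm[OF matrix_vector_mul_bounded_linear])

lemma norm_P: "norm (P *v v) \<le> norm v"
proof -
  have "(norm (P *v v))\<^sup>2 \<le> (norm v)\<^sup>2"
    using projection_norm[OF P(2,1), of v] by simp
  then show ?thesis by (rule power2_le_imp_le) simp
qed

lemma norm_M: "norm (M *v v) \<le> \<omega> * norm v"
proof -
  have "0 \<le> \<omega>" unfolding \<omega> by (rule onorm_pos_le[OF matrix_vector_mul_bounded_linear])
  have "norm (M *v v) \<le> norm (\<Omega> *v (P *v v))"
    unfolding M_vec by (rule norm_P)
  also have "\<dots> \<le> \<omega> * norm (P *v v)" by (rule norm_\<Omega>)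
  also have "\<dots> \<le> \<omega> * norm v" using norm_P \<open>0 \<le> \<omega>\<close> by (rule mult_left_mono)
  finally show ?thesis .
qed

lemma spectrum_M_le: "z \<in> spectrum M \<Longrightarrow> cmod z \<le> \<omega>"
proof -
  assume "z \<in> spectrum M"
  then obtain v where v: "v \<noteq> 0" "M *v v = z *s v" by (auto simp: spectrum_on_def)
  then have "cmod z * norm v \<le> \<omega> * norm v"
    using norm_M[of v] by (simp add: norm_smult)
  with v(1) show ?thesis by simp
qed

lemma \<rho>_le: "\<rho> \<le> \<omega>"
  using spectrum_M_le[OF \<rho>(1)] \<rho>(2) by simp

lemma \<omega>_pos: "0 < \<omega>"
  using \<rho>_le \<rho>(2) by simp

text \<open>After clearing denominators the hypothesis on \<open>\<beta>\<close> reads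
  \<open>4 * \<omega>\<^sup>2 < \<rho> * (\<beta> * b - 2 * \<omega>)\<close>. The last item
  characterises \<open>c\<close> without division, the form used in the estimates.\<close>

lemma gap_bounds: "2 * (\<omega> / b) < \<beta>" "2 * \<omega> < \<beta> * b" "c < \<rho> / 2" "0 < c" "c * (\<beta> * b - 2 * \<omega>) = 2 * \<omega>\<^sup>2"
proof -
  have gt: "4 * \<omega>\<^sup>2 / (b * \<rho>) + 2 * \<omega> / b < \<beta>"
    using \<beta>_gt b_pos \<rho>(2) by (simp add: c_bound_inv_def field_simps)
  moreover have "0 < 4 * \<omega>\<^sup>2 / (b * \<rho>)"
    using \<omega>_pos b_pos \<rho>(2) by simp
  ultimately show 1: "2 * (\<omega> / b) < \<beta>" by simp
  then show 2: "2 * \<omega> < \<beta> * b" using b_pos by (simp add: field_simps)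
  have c': "c = 2 * \<omega>\<^sup>2 / (\<beta> * b - 2 * \<omega>)"
    using b_pos 2 by (simp add: c c_bound_def field_simps)
  then show "0 < c" "c * (\<beta> * b - 2 * \<omega>) = 2 * \<omega>\<^sup>2"
    using 2 \<omega>_pos by auto
  have "4 * \<omega>\<^sup>2 < \<rho> * (\<beta> * b - 2 * \<omega>)"
    using gt b_pos \<rho>(2) by (simp add: field_simps)
  then show "c < \<rho> / 2"
    unfolding c' using 2 by (simp add: field_simps)
qed

lemma A_vec: "A *v v = \<Omega> *v v - (\<i> * complex_of_real \<beta>) *s (B *v v)"
  by (simp add: A matrix_vector_mult_diff_rdistrib cscale_mult_vec)

lemma minus_i_A_vec: "(- \<i>) *s (A *v v) = (- \<i>) *s (\<Omega> *v v) - complex_of_real \<beta> *s (B *v v)"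
  by (simp add: A_vec vec.scale_right_diff_distrib vector_smult_assoc)

text \<open>Multiplication by \<open>- \<i>\<close> makes the Hermitian \<open>\<Omega>\<close> skew
  for the real inner product, so only the dissipative part \<open>B\<close> contributes to the
  energy balance of \<open>A\<close>.\<close>

lemma inner_minus_i_\<Omega>: "v \<bullet> ((- \<i>) *s (\<Omega> *v v)) = 0"
  "u \<bullet> ((- \<i>) *s (\<Omega> *v v)) = - (v \<bullet> ((- \<i>) *s (\<Omega> *v u)))"
proof -
  have *: "x \<bullet> ((- \<i>) *s (\<Omega> *v y)) = - (y \<bullet> ((- \<i>) *s (\<Omega> *v x)))" for x y
  proof -
    have "x \<bullet> ((- \<i>) *s (\<Omega> *v y)) = (\<i> *s x) \<bullet> (\<Omega> *v y)"
      by (simp add: inner_smult_left)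
    also have "\<dots> = (\<Omega> *v (\<i> *s x)) \<bullet> y"
      by (rule selfadjointD[OF \<Omega>(1), symmetric])
    also have "\<dots> = - (y \<bullet> ((- \<i>) *s (\<Omega> *v x)))"
      by (simp add: vector_scalar_commute inner_commute)
    finally show ?thesis .
  qed
  from *[of v v] show "v \<bullet> ((- \<i>) *s (\<Omega> *v v)) = 0" by simp
  show "u \<bullet> ((- \<i>) *s (\<Omega> *v v)) = - (v \<bullet> ((- \<i>) *s (\<Omega> *v u)))" by (rule *)
qed

lemma Im_spectrum_A: "\<zeta> \<in> spectrum A \<Longrightarrow> Im \<zeta> \<le> 0"
proof -
  assume "\<zeta> \<in> spectrum A"
  then obtain v where v: "v \<noteq> 0" "A *v v = \<zeta> *s v" by (auto simp: spectrum_on_def)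
  have "v \<bullet> ((- \<i>) *s (A *v v)) = Im \<zeta> * (v \<bullet> v)"
    unfolding v(2) vector_smult_assoc inner_smult_self by simp
  moreover have "v \<bullet> ((- \<i>) *s (A *v v)) = - \<beta> * (v \<bullet> (B *v v))"
    unfolding minus_i_A_vec inner_diff_right inner_minus_i_\<Omega>(1) inner_smult_real by simp
  moreover have "0 \<le> \<beta> * (v \<bullet> (B *v v))"
    using \<beta> B(2) by simp
  ultimately have "Im \<zeta> * (v \<bullet> v) \<le> 0" by simp
  moreover have "0 < v \<bullet> v" using v(1) by simp
  ultimately show ?thesis by (simp add: mult_le_0_iff)
qed

section \<open>Localisation of the spectrum of A\<close>

definition \<sigma>0 where "\<sigma>0 = spectrum A \<inter> cball 0 \<omega>"
definition \<sigma>1 where "\<sigma>1 = spectrum A \<inter> (\<Union>x\<in>X. cball (- \<i> * of_real \<beta> * of_real x) \<omega>)"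

text \<open>The eigenvalue equation reads (- i \<beta> B - \<zeta>) v = - \<Omega> v, so an
  eigenvector of \<open>A\<close> is an approximate eigenvector of the normal matrix - i \<beta> B
  with residual at most \<omega>.\<close>

lemma spectrum_A: "spectrum A = \<sigma>0 \<union> \<sigma>1"
proof -
  have "\<zeta> \<in> \<sigma>0 \<union> \<sigma>1" if \<zeta>: "\<zeta> \<in> spectrum A" for \<zeta>
  proof -
    obtain v where v: "v \<noteq> 0" "A *v v = \<zeta> *s v"
      using \<zeta> by (auto simp: spectrum_on_def)
    have "(- \<i> * of_real \<beta>) *s (B *v v) + (- \<zeta>) *s v = - (\<Omega> *v v)"
      using v(2) by (simp add: A_vec algebra_simps)
    then have "norm ((- \<i> * of_real \<beta>) *s (B *v v) + (- \<zeta>) *s v) \<le> \<omega> * norm v"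
      using norm_\<Omega>[of v] by (simp only: norm_minus_cancel)
    from selfadjoint_approximate_eigenvalue[OF B(1) invariant_subspace_UNIV UNIV_I v(1) this]
    obtain x where x: "complex_of_real x \<in> spectrum B" "cmod (- \<i> * of_real \<beta> * of_real x + - \<zeta>) \<le> \<omega>" .
    show ?thesis
    proof (cases "x = 0")
      case True
      then show ?thesis using x(2) \<zeta> by (simp add: \<sigma>0_def)
    next
      case False
      then have "x \<in> X" using x(1) by (simp add: X_def)
      moreover have "\<zeta> \<in> cball (- \<i> * of_real \<beta> * of_real x) \<omega>"
        using x(2) by (simp add: dist_norm)
      ultimately show ?thesis using \<zeta> by (auto simp: \<sigma>1_def)
    qed
  qed
  moreover have "\<sigma>0 \<union> \<sigma>1 \<subseteq> spectrum A" by (auto simp: \<sigma>0_def \<sigma>1_def)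
  ultimately show ?thesis by blast
qed

lemma \<sigma>0_D: "\<zeta> \<in> \<sigma>0 \<Longrightarrow> \<zeta> \<in> spectrum A \<and> cmod \<zeta> \<le> \<omega> \<and> - Im \<zeta> \<le> \<omega> \<and> Im \<zeta> \<le> 0"
  using abs_Im_le_cmod[of \<zeta>] Im_spectrum_A[of \<zeta>] by (auto simp: \<sigma>0_def)

lemma \<sigma>1_D: "\<zeta> \<in> \<sigma>1 \<Longrightarrow> \<zeta> \<in> spectrum A \<and> \<bar>Re \<zeta>\<bar> \<le> \<omega> \<and> \<beta> * b - \<omega> \<le> - Im \<zeta>"
proof -
  assume "\<zeta> \<in> \<sigma>1"
  then obtain x where x: "\<zeta> \<in> spectrum A" "x \<in> X" "cmod (- \<i> * of_real \<beta> * of_real x - \<zeta>) \<le> \<omega>"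
    by (auto simp: \<sigma>1_def dist_norm)
  have "\<bar>Re \<zeta>\<bar> \<le> \<omega>"
    using abs_Re_le_cmod[of "- \<i> * of_real \<beta> * of_real x - \<zeta>"] x(3) by simp
  moreover have "\<bar>\<beta> * x + Im \<zeta>\<bar> \<le> \<omega>"
    using abs_Im_le_cmod[of "- \<i> * of_real \<beta> * of_real x - \<zeta>"] x(3) by simp
  moreover have "\<beta> * b \<le> \<beta> * x"
    using b_le[OF x(2)] \<beta> by (rule mult_left_mono)
  ultimately show ?thesis using x(1) by linarith
qed

lemma \<sigma>_disjoint: "\<sigma>0 \<inter> \<sigma>1 = {}"
  using \<sigma>0_D \<sigma>1_D gap_bounds(2) by fastforce

lemma norm_B_lower:
  assumes "cmod \<zeta> \<le> \<omega>" "q \<in> range ((*v) B)"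
  shows "(\<beta> * b - \<omega>) * norm q \<le> norm ((\<i> * of_real \<beta>) *s (B *v q) + \<zeta> *s q)"
proof (rule selfadjoint_norm_lower_bound[OF B(1) invariant_range assms(2)])
  show "0 \<le> \<beta> * b - \<omega>" using gap_bounds(2) \<omega>_pos by simp
  fix x assume x: "complex_of_real x \<in> spectrum_on B (range ((*v) B))"
  then have "x \<in> X" using spectrum_on_range[OF B(1) x] by (auto simp: X_def)
  then have "\<beta> * b \<le> \<beta> * x" "0 \<le> \<beta> * x" using b_le \<beta> less_imp_le[OF X_pos] by (auto intro: mult_left_mono)
  have "\<beta> * x - cmod \<zeta> \<le> cmod (\<i> * of_real \<beta> * of_real x + \<zeta>)"
    using norm_diff_ineq[of "\<i> * of_real \<beta> * of_real x" \<zeta>] \<open>0 \<le> \<beta> * x\<close>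
    by (simp add: norm_mult flip: abs_mult)
  with \<open>\<beta> * b \<le> \<beta> * x\<close> assms(1) show "\<beta> * b - \<omega> \<le> cmod (\<i> * of_real \<beta> * of_real x + \<zeta>)"
    by linarith
qed

text \<open>A Schur complement argument. The component q of the eigenvector in Ran \<open>B\<close>
  is small against the component p in Ker \<open>B\<close>, because \<beta> B is large there; then p
  is an approximate eigenvector of \<open>M\<close>, with residual coming only from the coupling
  \<open>P *v (\<Omega> *v q)\<close>.\<close>

lemma low_loss_eigenvalue:
  assumes "\<zeta> \<in> \<sigma>0"
  obtains x where "complex_of_real x \<in> spectrum M" "cmod (of_real x - \<zeta>) \<le> c"
proof -
  have \<zeta>: "\<zeta> \<in> spectrum A" "cmod \<zeta> \<le> \<omega>" using \<sigma>0_D[OF assms] by auto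
  obtain v where v: "v \<noteq> 0" "A *v v = \<zeta> *s v"
    using \<zeta> by (auto simp: spectrum_on_def)
  define p where "p = P *v v"
  define q where "q = v - P *v v"
  have vpq: "v = p + q" by (simp add: p_def q_def)
  have Bv: "B *v v = B *v q" by (simp add: q_def p_def algebra_simps)
  have "P *v (A *v v) = P *v (\<Omega> *v v)"
    by (simp add: A_vec algebra_simps vector_scalar_commute)
  then have P_eq: "P *v (\<Omega> *v v) = \<zeta> *s p"
    by (simp add: v(2) p_def vector_scalar_commute)
  \<comment> \<open>The eigenvalue equation projected onto the complement of Ker \<open>B\<close>;
    \<open>P_eq\<close> is its projection onto Ker \<open>B\<close>, where \<open>B\<close> drops
    out.\<close>
  have eq: "\<Omega> *v v - P *v (\<Omega> *v v) = (\<i> * of_real \<beta>) *s (B *v q) + \<zeta> *s q"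
    using v(2) unfolding P_eq A_vec Bv by (simp add: q_def p_def algebra_simps vec.scale_right_diff_distrib)
  have "(\<beta> * b - \<omega>) * norm q \<le> norm (\<Omega> *v v - P *v (\<Omega> *v v))"
    unfolding eq q_def by (rule norm_B_lower[OF \<zeta>(2) complement_in_range])
  also have "\<dots> \<le> norm (\<Omega> *v v)"
  proof -
    have "(norm (\<Omega> *v v - P *v (\<Omega> *v v)))\<^sup>2 \<le> (norm (\<Omega> *v v))\<^sup>2"
      using projection_norm[OF P(2,1), of "\<Omega> *v v"] by simp
    then show ?thesis by (rule power2_le_imp_le) simp
  qed
  also have "\<dots> \<le> \<omega> * (norm p + norm q)"
    using norm_\<Omega>[of v] norm_triangle_ineq[of p q] \<omega>_pos unfolding vpq
    by (meson mult_left_mono order_trans less_imp_le)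
  finally have q: "(\<beta> * b - 2 * \<omega>) * norm q \<le> \<omega> * norm p"
    by (simp add: algebra_simps)
  have "p \<noteq> 0"
  proof
    assume "p = 0"
    with q gap_bounds(2) have "q = 0" by (simp add: mult_le_0_iff)
    with \<open>p = 0\<close> v(1) show False by (simp add: vpq)
  qed
  have Pp: "P *v p = p" by (simp add: p_def P(1))
  have "1 *s (M *v p) + (- \<zeta>) *s p = - (P *v (\<Omega> *v q))"
  proof -
    have "P *v (\<Omega> *v v) = M *v p + P *v (\<Omega> *v q)"
      by (simp add: M_vec Pp vpq matrix_vector_right_distrib)
    then show ?thesis unfolding P_eq by simp
  qed
  then have "norm (1 *s (M *v p) + (- \<zeta>) *s p) = norm (P *v (\<Omega> *v q))"
    by (simp only: norm_minus_cancel)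
  also have "\<dots> \<le> \<omega> * norm q"
    using norm_P norm_\<Omega> order_trans by blast
  also have "\<dots> \<le> c * norm p"
  proof -
    have "\<omega> * ((\<beta> * b - 2 * \<omega>) * norm q) \<le> \<omega> * (\<omega> * norm p)"
      using q \<omega>_pos by simp
    \<comment> \<open>The bound on \<open>q\<close> even gives half of \<open>c\<close>; the factor
      2 is introduced here to reach the given constant.\<close>
    also have "\<dots> \<le> 2 * \<omega>\<^sup>2 * norm p" using \<omega>_pos by (simp add: power2_eq_square)
    also have "\<dots> = (\<beta> * b - 2 * \<omega>) * (c * norm p)"
      by (simp flip: gap_bounds(5))
    finally have "(\<beta> * b - 2 * \<omega>) * (\<omega> * norm q) \<le> (\<beta> * b - 2 * \<omega>) * (c * norm p)"
      by (simp add: ac_simps)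
    then show ?thesis using gap_bounds(2) by simp
  qed
  finally have le: "norm (1 *s (M *v p) + (- \<zeta>) *s p) \<le> c * norm p" .
  from selfadjoint_approximate_eigenvalue[OF selfadjoint_M invariant_subspace_UNIV UNIV_I \<open>p \<noteq> 0\<close> le]
  obtain x where "complex_of_real x \<in> spectrum M" "cmod (1 * of_real x + - \<zeta>) \<le> c" .
  then show ?thesis using that by simp
qed

section \<open>The Lyapunov form separating low loss from high loss\<close>

definition \<kappa> where "\<kappa> = c / \<omega>"

text \<open>Explicitly \<open>\<kappa>\<close> is
  \<open>2 * \<omega> / (\<beta> * b - 2 * \<omega>)\<close>. The third item is the relation
  required by \<open>lyapunov_inequality\<close> with d = \<beta> b.\<close>

lemma \<kappa>: "0 < \<kappa>" "\<kappa> < 1" "\<beta> * b * \<kappa> = 2 * \<omega> + 2 * \<omega> * \<kappa>" "\<omega> * \<kappa> = c"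
proof -
  show 1: "0 < \<kappa>" "\<omega> * \<kappa> = c" using gap_bounds(4) \<omega>_pos by (auto simp: \<kappa>_def)
  have "c < \<omega>" using gap_bounds(3) \<rho>_le \<rho>(2) by linarith
  then show "\<kappa> < 1" using \<omega>_pos by (simp add: \<kappa>_def)
  have "\<omega> * \<kappa> * (\<beta> * b - 2 * \<omega>) = 2 * \<omega>\<^sup>2"
    unfolding 1(2) by (rule gap_bounds(5))
  then have "\<omega> * (\<kappa> * (\<beta> * b - 2 * \<omega>)) = \<omega> * (2 * \<omega>)"
    by (simp add: power2_eq_square)
  then have "\<kappa> * (\<beta> * b - 2 * \<omega>) = 2 * \<omega>" using \<omega>_pos by simp
  then show "\<beta> * b * \<kappa> = 2 * \<omega> + 2 * \<omega> * \<kappa>" by (simp add: algebra_simps)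
qed

text \<open>The weight \<open>\<kappa>\<close> makes positivity of this form on a subspace say that the component orthogonal to
  \<open>Ker B\<close> is at most \<open>\<kappa>\<close> times the component in \<open>Ker B\<close>.\<close>

definition J where "J = cscale (complex_of_real (\<kappa>\<^sup>2 + 1)) P - mat 1"

lemma J_vec: "J *v v = complex_of_real (\<kappa>\<^sup>2) *s (P *v v) - (v - P *v v)"
  unfolding J_def matrix_vector_mult_diff_rdistrib cscale_mult_vec
  by (simp add: vec.scale_left_distrib)

lemma selfadjoint_J: "selfadjoint J"
  unfolding J_def by (intro selfadjoint_diff selfadjoint_cscale P(2) selfadjoint_id)

lemma P_orthogonal: "(P *v u) \<bullet> (v - P *v v) = 0"
  using P(1,2) by (simp add: selfadjointD inner_diff_right matrix_vector_mult_diff_distrib)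

lemma J_form: "(J *v v) \<bullet> v = \<kappa>\<^sup>2 * (norm (P *v v))\<^sup>2 - (norm (v - P *v v))\<^sup>2"
proof -
  have "(P *v v) \<bullet> v = (P *v v) \<bullet> (P *v v)"
    using P_orthogonal[of v v] by (simp add: inner_diff_right)
  moreover have "(v - P *v v) \<bullet> v = (v - P *v v) \<bullet> (v - P *v v)"
    using P_orthogonal[of v v] by (simp add: inner_diff inner_commute)
  ultimately show ?thesis
    unfolding J_vec inner_diff_left[of _ "v - P *v v"] inner_smult_real power2_norm_eq_inner by simp
qed

lemma B_form_lower: "b * (norm (v - P *v v))\<^sup>2 \<le> (v - P *v v) \<bullet> (B *v (v - P *v v))"
  unfolding power2_norm_eq_inner
proof (rule selfadjoint_form_lower_bound[OF B(1) invariant_range complement_in_range])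
  fix x assume "complex_of_real x \<in> spectrum_on B (range ((*v) B))"
  from spectrum_on_range[OF B(1) this] show "b \<le> x"
    by (intro b_le) (simp add: X_def)
qed

text \<open>Skewness makes the contribution of \<open>\<Omega>\<close> to the two components equal
  to t and - t, and the opposite signs in \<open>J\<close> turn this into
  \<open>(\<kappa>\<^sup>2 + 1) * t\<close>. The damping adds at least
  \<open>\<beta> * b * (norm q)\<^sup>2\<close>, which pays for the coupling.\<close>

lemma J_lyapunov:
  assumes "v \<noteq> 0"
  shows "0 < (J *v v) \<bullet> ((- \<i>) *s (A *v v)) + \<beta> * b / 2 * ((J *v v) \<bullet> v)"
proof -
  define p where "p = P *v v"
  define q where "q = v - P *v v"
  define t where "t = p \<bullet> ((- \<i>) *s (\<Omega> *v q))"
  have vpq: "v = p + q" by (simp add: p_def q_def)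
  have Jv: "J *v v = complex_of_real (\<kappa>\<^sup>2) *s p - q" by (simp add: J_vec p_def q_def)
  have Bv: "B *v v = B *v q" by (simp add: q_def p_def algebra_simps)
  have \<Omega>v: "(- \<i>) *s (\<Omega> *v v) = (- \<i>) *s (\<Omega> *v p) + (- \<i>) *s (\<Omega> *v q)"
    unfolding vpq matrix_vector_right_distrib vec.scale_right_distrib ..
  have "p \<bullet> ((- \<i>) *s (\<Omega> *v v)) = t" "q \<bullet> ((- \<i>) *s (\<Omega> *v v)) = - t"
    unfolding \<Omega>v inner_add_right inner_minus_i_\<Omega>(1)
    using inner_minus_i_\<Omega>(2)[of q p] by (simp_all add: t_def)
  then have "(J *v v) \<bullet> ((- \<i>) *s (\<Omega> *v v)) = (\<kappa>\<^sup>2 + 1) * t"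
    unfolding Jv inner_diff_left inner_smult_real by (simp add: algebra_simps)
  moreover have "(J *v v) \<bullet> (complex_of_real \<beta> *s (B *v v)) = - \<beta> * (q \<bullet> (B *v q))"
  proof -
    have "p \<bullet> (B *v v) = 0"
      using selfadjointD[OF B(1), of p v] by (simp add: p_def)
    then show ?thesis
      unfolding Jv inner_diff_left inner_smult_real by (simp add: Bv)
  qed
  ultimately have eq: "(J *v v) \<bullet> ((- \<i>) *s (A *v v)) = (\<kappa>\<^sup>2 + 1) * t + \<beta> * (q \<bullet> (B *v q))"
    unfolding minus_i_A_vec inner_diff_right by simp
  have "\<bar>t\<bar> \<le> norm p * norm ((- \<i>) *s (\<Omega> *v q))"
    unfolding t_def by (rule Cauchy_Schwarz_ineq2)
  also have "\<dots> \<le> norm p * (\<omega> * norm q)"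
    unfolding norm_smult using norm_\<Omega> by (intro mult_left_mono) auto
  finally have t: "- (\<omega> * norm p * norm q) \<le> t"
    by (simp add: ac_simps abs_le_iff)
  have "p \<noteq> 0 \<or> q \<noteq> 0" using assms vpq by auto
  then have "0 < (\<kappa>\<^sup>2 + 1) * t + \<beta> * b * (norm q)\<^sup>2 + \<beta> * b / 2 * (\<kappa>\<^sup>2 * (norm p)\<^sup>2 - (norm q)\<^sup>2)"
    by (intro lyapunov_inequality[OF \<kappa>(1,2) \<omega>_pos \<kappa>(3) _ _ _ t]) auto
  moreover have "\<beta> * b * (norm q)\<^sup>2 \<le> \<beta> * (q \<bullet> (B *v q))"
    using mult_left_mono[OF B_form_lower \<beta>, of v] by (simp add: q_def mult.assoc)
  ultimately show ?thesis
    unfolding eq J_form q_def p_def by linarith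
qed

lemma dim_kernel_range: "vec.dim K + vec.dim (range ((*v) B)) = CARD('m)"
  using dim_orthogonal_comp[OF subspace_range[of B]] K_eq by simp

lemma P_range_B: "w \<in> range ((*v) B) \<Longrightarrow> P *v w = 0"
  by auto

section \<open>The Stein form on the range of the compression\<close>

definition Q where "Q = orthogonal_projection (range ((*v) M))"

lemmas Q = orthogonal_projection[OF subspace_range[of M], folded Q_def]

lemma PQ: "P *v (Q *v v) = Q *v v"
  using Q(3) range_M_subset by (intro P(4)) auto

lemma QP: "Q *v (P *v v) = Q *v v"
proof -
  have "(Q *v (P *v v)) \<bullet> u = (Q *v v) \<bullet> u" for u
    using P(2) Q(2) PQ by (simp add: selfadjointD)
  then have "\<forall>u. (Q *v (P *v v)) \<bullet> u = (Q *v v) \<bullet> u" by blast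
  then show ?thesis by (rule vector_eq_rdot[THEN iffD1])
qed

text \<open>The component orthogonal to Ran \<open>M\<close> lies in Ker \<open>M\<close>, and on
  Ran \<open>M\<close> all eigenvalues have modulus at least \<rho>.\<close>

lemma M_lower: "\<rho> * norm (Q *v v) \<le> norm (M *v v)"
proof -
  have "v - Q *v v \<in> {v. M *v v = 0}"
    unfolding selfadjoint_kernel[OF selfadjoint_M] orthogonal_comp_altdef
    using Q(2,4) by (auto simp: inner_diff_right simp flip: selfadjointD)
  then have MQ: "M *v v = M *v (Q *v v)" by (simp add: matrix_vector_mult_diff_distrib)
  have "\<rho> * norm (Q *v v) \<le> norm (1 *s (M *v (Q *v v)) + 0 *s (Q *v v))"
  proof (rule selfadjoint_norm_lower_bound[OF selfadjoint_M invariant_range Q(3)])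
    show "0 \<le> \<rho>" using \<rho>(2) by simp
    fix x assume x: "complex_of_real x \<in> spectrum_on M (range ((*v) M))"
    show "\<rho> \<le> cmod (1 * of_real x + 0)"
      using \<rho>(3)[of x] spectrum_on_range[OF selfadjoint_M x] by simp
  qed
  then show ?thesis by (simp add: MQ)
qed

text \<open>Equals Q - (P - Q): positive on Ran \<open>M\<close>, negative on the part of Ker
  \<open>B\<close> annihilated by \<open>M\<close>, and zero on Ran \<open>B\<close>.\<close>

definition J' where "J' = cscale (complex_of_real 2) Q - P"

lemma selfadjoint_J': "selfadjoint J'"
  unfolding J'_def by (intro selfadjoint_diff selfadjoint_cscale Q(2) P(2))

lemma norm_P_split: "(norm (P *v v))\<^sup>2 = (norm (Q *v v))\<^sup>2 + (norm (P *v v - Q *v v))\<^sup>2"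
  using projection_norm[OF Q(2,1), of "P *v v"] by (simp add: QP)

lemma J'_form: "(J' *v v) \<bullet> v = (norm (Q *v v))\<^sup>2 - (norm (P *v v - Q *v v))\<^sup>2"
proof -
  have "(Q *v v) \<bullet> v = (norm (Q *v v))\<^sup>2" "(P *v v) \<bullet> v = (norm (P *v v))\<^sup>2"
    using Q(1,2) P(1,2) by (metis selfadjointD power2_norm_eq_inner)+
  then show ?thesis
    unfolding J'_def matrix_vector_mult_diff_rdistrib cscale_mult_vec inner_diff_left inner_smult_real
    using norm_P_split[of v] by simp
qed

section \<open>Splitting of the low-loss eigenvalues\<close>

definition \<tau>0 where "\<tau>0 = spectrum A \<inter> cball 0 c"
definition \<tau>1 where "\<tau>1 = spectrum A \<inter> (\<Union>r\<in>spectrum M - {0}. cball r c)"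

lemma spectrum_M_real: "r \<in> spectrum M \<Longrightarrow> r = complex_of_real (Re r)"
  by (erule selfadjoint_spectrum_real[OF selfadjoint_M]) simp

lemma \<tau>0_D: "\<zeta> \<in> \<tau>0 \<Longrightarrow> \<zeta> \<in> \<sigma>0 \<and> cmod \<zeta> < \<rho> / 2"
  using gap_bounds(3) \<rho>(2) \<rho>_le by (auto simp: \<tau>0_def \<sigma>0_def)

text \<open>The discs are centred on the real axis, so their points satisfy
  \<open>\<bar>Im \<zeta>\<bar> \<le> c\<close>, too small for a high-loss eigenvalue. Their centres
  have modulus at least \<rho>, and c < \<rho> / 2 keeps them outside the circle.\<close>

lemma \<tau>1_D: "\<zeta> \<in> \<tau>1 \<Longrightarrow> \<zeta> \<in> \<sigma>0 \<and> \<rho> / 2 < cmod \<zeta>"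
proof -
  assume "\<zeta> \<in> \<tau>1"
  then obtain r where r: "\<zeta> \<in> spectrum A" "r \<in> spectrum M" "r \<noteq> 0" "cmod (r - \<zeta>) \<le> c"
    by (auto simp: \<tau>1_def dist_norm)
  have real: "r = complex_of_real (Re r)" using spectrum_M_real[OF r(2)] .
  then have "\<rho> \<le> cmod r" using \<rho>(3)[of "Re r"] r(2,3) by (metis norm_of_real of_real_0)
  moreover have "cmod r \<le> cmod \<zeta> + cmod (r - \<zeta>)"
    using norm_triangle_ineq[of \<zeta> "r - \<zeta>"] by simp
  ultimately have "\<rho> / 2 < cmod \<zeta>" using r(4) gap_bounds(3) by linarith
  moreover have "\<zeta> \<in> \<sigma>0"
  proof (rule ccontr)
    assume "\<zeta> \<notin> \<sigma>0"
    then have "\<beta> * b - \<omega> \<le> - Im \<zeta>" using spectrum_A r(1) \<sigma>1_D by auto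
    moreover have "Im r = 0" using real by (metis Im_complex_of_real)
    then have "\<bar>Im \<zeta>\<bar> \<le> c" using abs_Im_le_cmod[of "r - \<zeta>"] r(4) by simp
    ultimately show False using gap_bounds(2,3) \<rho>_le \<rho>(2) by linarith
  qed
  ultimately show ?thesis by simp
qed

lemma \<tau>_split: "\<sigma>0 = \<tau>0 \<union> \<tau>1" "\<tau>0 \<inter> \<tau>1 = {}"
proof -
  show "\<tau>0 \<inter> \<tau>1 = {}" using \<tau>0_D \<tau>1_D by fastforce
  have "\<zeta> \<in> \<tau>0 \<union> \<tau>1" if \<zeta>0: "\<zeta> \<in> \<sigma>0" for \<zeta>
  proof -
    obtain x where x: "complex_of_real x \<in> spectrum M" "cmod (of_real x - \<zeta>) \<le> c"
      by (rule low_loss_eigenvalue[OF \<zeta>0])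
    have \<zeta>: "\<zeta> \<in> spectrum A" using \<sigma>0_D[OF \<zeta>0] by simp
    show ?thesis
    proof (cases "x = 0")
      case True
      then show ?thesis using x \<zeta> by (simp add: \<tau>0_def)
    next
      case False
      then have "\<zeta> \<in> \<tau>1"
        unfolding \<tau>1_def using x \<zeta> by (intro IntI UN_I[of "complex_of_real x"]) (auto simp: dist_norm)
      then show ?thesis by simp
    qed
  qed
  then show "\<sigma>0 = \<tau>0 \<union> \<tau>1" using \<tau>0_D \<tau>1_D by blast
qed

section \<open>Dimensions of the invariant subspaces\<close>

context
  fixes Hhl Hll :: "(complex^'m) set"
  assumes split: "spectral_splitting A UNIV \<sigma>1 \<sigma>0 Hhl Hll"
begin

lemmas H = spectral_splittingD[OF split]

lemma J_pos:
  assumes "v \<in> Hll" "v \<noteq> 0"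
  shows "0 < (J *v v) \<bullet> v"
proof -
  have "0 < 1 * ((J *v v) \<bullet> v)"
  proof (rule lyapunov_inertia[OF selfadjoint_J H(2) _ J_lyapunov _ assms])
    fix \<zeta> assume "\<zeta> \<in> spectrum_on A Hll"
    then show "0 < 1 * (Im \<zeta> + \<beta> * b / 2)"
      using \<sigma>0_D[of \<zeta>] gap_bounds(2) unfolding H(5) by auto
  qed simp
  then show ?thesis by simp
qed

lemma J_neg:
  assumes "v \<in> Hhl" "v \<noteq> 0"
  shows "(J *v v) \<bullet> v < 0"
proof -
  have "0 < - 1 * ((J *v v) \<bullet> v)"
  proof (rule lyapunov_inertia[OF selfadjoint_J H(1) _ J_lyapunov _ assms])
    fix \<zeta> assume "\<zeta> \<in> spectrum_on A Hhl"
    then show "0 < - 1 * (Im \<zeta> + \<beta> * b / 2)"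
      using \<sigma>1_D[of \<zeta>] gap_bounds(2) unfolding H(4) by auto
  qed simp
  then show ?thesis by simp
qed

text \<open>\<open>J\<close> is nonnegative on Ker \<open>B\<close> and nonpositive on Ran
  \<open>B\<close>, so these meet the high-loss and the low-loss subspace trivially. Both resulting
  bounds are equalities because Ker \<open>B\<close> and Ran \<open>B\<close> have complementary
  dimensions.\<close>

lemma dim_Hhl: "vec.dim Hhl = vec.dim (range ((*v) B))"
  and dim_Hll: "vec.dim Hll = vec.dim K"
proof -
  have "Hhl \<inter> K \<subseteq> {0}"
  proof
    fix v assume v: "v \<in> Hhl \<inter> K"
    then have "P *v v = v" by (intro P(4)) auto
    then have "0 \<le> (J *v v) \<bullet> v" unfolding J_form by simp
    then show "v \<in> {0}" using J_neg[of v] v by auto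
  qed
  from dim_add_le[OF H(6) subspace_kernel this]
  have 1: "vec.dim Hhl + vec.dim K \<le> CARD('m)" .
  have "Hll \<inter> range ((*v) B) \<subseteq> {0}"
  proof
    fix v assume v: "v \<in> Hll \<inter> range ((*v) B)"
    then have "P *v v = 0" by (intro P_range_B) auto
    then have "(J *v v) \<bullet> v \<le> 0" unfolding J_form by simp
    then show "v \<in> {0}" using J_pos[of v] v by fastforce
  qed
  from dim_add_le[OF H(7) subspace_range this]
  have 2: "vec.dim Hll + vec.dim (range ((*v) B)) \<le> CARD('m)" .
  have 3: "vec.dim Hhl + vec.dim Hll = CARD('m)"
    using H(10) vec_dim_card[where ?'a=complex and ?'n='m] by linarith
  show "vec.dim Hhl = vec.dim (range ((*v) B))" "vec.dim Hll = vec.dim K"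
    using 1 2 3 dim_kernel_range by linarith+
qed

lemma graph_bound: "v \<in> Hll \<Longrightarrow> v \<noteq> 0 \<Longrightarrow> norm (v - P *v v) < \<kappa> * norm (P *v v)"
proof -
  assume "v \<in> Hll" "v \<noteq> 0"
  then have "(norm (v - P *v v))\<^sup>2 < (\<kappa> * norm (P *v v))\<^sup>2"
    using J_pos unfolding J_form power_mult_distrib by simp
  then show ?thesis
    by (rule power2_less_imp_less) (use \<kappa>(1) in simp)
qed

text \<open>\<open>J'\<close> sees only components in Ker \<open>B\<close>, where the damping term
  of \<open>A\<close> is absent and \<open>P *v (A *v v)\<close> is \<open>M *v v\<close> plus the
  coupling \<open>e\<close>. The graph bound makes \<open>e\<close> smaller than \<omega> \<kappa> =
  c, hence than \<rho> / 2, times the norm of \<open>P *v v\<close>.\<close>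

lemma J'_stein:
  assumes v: "v \<in> Hll" "v \<noteq> 0"
  shows "(\<rho> / 2)\<^sup>2 * ((J' *v v) \<bullet> v) < (J' *v (A *v v)) \<bullet> (A *v v)"
proof -
  define q where "q = v - P *v v"
  define e where "e = P *v (\<Omega> *v q)"
  have "\<Omega> *v v = \<Omega> *v (P *v v) + \<Omega> *v q"
    by (simp add: q_def matrix_vector_mult_diff_distrib)
  then have "P *v (A *v v) = M *v v + e"
    by (simp add: A_vec e_def M_vec matrix_vector_mult_diff_distrib vector_scalar_commute matrix_vector_right_distrib)
  moreover have "Q *v (M *v v) = M *v v" by (intro Q(4)) auto
  ultimately have QA: "Q *v (A *v v) = M *v v + Q *v e" and PA: "P *v (A *v v) = M *v v + e"
    using QP[of "A *v v"] by (simp_all add: matrix_vector_right_distrib)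
  have "norm e \<le> \<omega> * norm q"
    unfolding e_def using norm_P norm_\<Omega> order_trans by blast
  also have "\<dots> < \<omega> * (\<kappa> * norm (P *v v))"
    using graph_bound[OF v] \<omega>_pos unfolding q_def by (rule mult_strict_left_mono)
  also have "\<dots> = c * norm (P *v v)" by (simp only: \<kappa>(4) mult.assoc[symmetric])
  also have "\<dots> \<le> \<rho> / 2 * norm (P *v v)"
    using gap_bounds(3) by (intro mult_right_mono) auto
  finally have "(norm e)\<^sup>2 < (\<rho> / 2 * norm (P *v v))\<^sup>2"
    by (intro power_strict_mono) auto
  then have e: "(norm (Q *v e))\<^sup>2 + (norm (e - Q *v e))\<^sup>2
      < (\<rho> / 2)\<^sup>2 * ((norm (Q *v v))\<^sup>2 + (norm (P *v v - Q *v v))\<^sup>2)"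
    unfolding norm_P_split[symmetric] projection_norm[OF Q(2,1), symmetric] by (simp only: power_mult_distrib)
  have "2 * (\<rho> / 2) * norm (Q *v v) - norm (Q *v e) \<le> norm (M *v v + Q *v e)"
    using M_lower[of v] norm_diff_ineq[of "M *v v" "Q *v e"] by simp
  from stein_inequality[OF _ _ _ this e] show ?thesis
    unfolding J'_form QA PA using \<rho>(2) by simp
qed

lemma low_loss_splitting: "\<exists>!H. spectral_splitting A Hll \<tau>0 \<tau>1 (fst H) (snd H)"
  using H(5) \<tau>_split by (intro spectral_splitting_unique_exists[OF H(2)]) auto

context
  fixes Hll0 Hll1 :: "(complex^'m) set"
  assumes split': "spectral_splitting A Hll \<tau>0 \<tau>1 Hll0 Hll1"
begin

lemmas H' = spectral_splittingD[OF split']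

lemma J'_neg: "v \<in> Hll0 \<Longrightarrow> v \<noteq> 0 \<Longrightarrow> (J' *v v) \<bullet> v < 0"
  by (rule stein_inertia_inside[OF selfadjoint_J' H'(1), of "\<rho> / 2"])
    (use H'(4,8) J'_stein \<tau>0_D in auto)

lemma J'_pos: "v \<in> Hll1 \<Longrightarrow> v \<noteq> 0 \<Longrightarrow> 0 < (J' *v v) \<bullet> v"
  by (rule stein_inertia_outside[OF selfadjoint_J' H'(2), of "\<rho> / 2"])
    (use H'(5,9) J'_stein \<tau>1_D \<rho>(2) in auto)

text \<open>\<open>J'\<close> is nonnegative on Ran \<open>M\<close> + Ran \<open>B\<close> and
  nonpositive on Ker \<open>M\<close>, so these meet the inner and the outer subspace trivially. Ran
  \<open>B\<close> must be included: only then do the two upper bounds add up to the dimension of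
  \<open>Hll\<close>.\<close>

lemma dim_Hll1: "vec.dim Hll1 = vec.dim (range ((*v) M))"
proof -
  define U where "U = {u + w | u w. u \<in> range ((*v) M) \<and> w \<in> range ((*v) B)}"
  have ds: "direct_sum U (range ((*v) M)) (range ((*v) B))"
  proof -
    have "v = 0" if "v \<in> range ((*v) M)" "v \<in> range ((*v) B)" for v
      using P(4)[of v] P_range_B[of v] that range_M_subset by auto
    moreover have "0 \<in> range ((*v) M)" "0 \<in> range ((*v) B)"
      by (intro vec.subspace_0 subspace_range)+
    ultimately show ?thesis
      by (auto simp: direct_sum_def U_def)
  qed
  have subU: "vec.subspace U"
    unfolding U_def by (intro vec.subspace_sums subspace_range)
  have "Hll0 \<inter> U \<subseteq> {0}"
  proof
    fix v assume v: "v \<in> Hll0 \<inter> U"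
    then obtain u w where uw: "v = u + w" "u \<in> range ((*v) M)" "w \<in> range ((*v) B)"
      by (auto simp: U_def)
    have "P *v v = u"
      using P(4)[of u] P_range_B[OF uw(3)] uw(2) range_M_subset
      by (auto simp: uw(1) matrix_vector_right_distrib)
    moreover have "Q *v v = u"
      using QP[of v] Q(4)[OF uw(2)] \<open>P *v v = u\<close> by simp
    ultimately have "0 \<le> (J' *v v) \<bullet> v" by (simp add: J'_form)
    then show "v \<in> {0}" using J'_neg[of v] v by fastforce
  qed
  from dim_add_le[OF H'(6) subU this]
  have 1: "vec.dim Hll0 + (vec.dim (range ((*v) M)) + vec.dim (range ((*v) B))) \<le> CARD('m)"
    using direct_sum_dim[OF ds subspace_range subspace_range] by simp
  have "Hll1 \<inter> {v. M *v v = 0} \<subseteq> {0}"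
  proof
    fix v assume v: "v \<in> Hll1 \<inter> {v. M *v v = 0}"
    then have "\<rho> * norm (Q *v v) \<le> 0" using M_lower[of v] by simp
    then have "Q *v v = 0" using \<rho>(2) by (simp add: mult_le_0_iff)
    then have "(J' *v v) \<bullet> v \<le> 0" by (simp add: J'_form)
    then show "v \<in> {0}" using J'_pos[of v] v by fastforce
  qed
  from dim_add_le[OF H'(7) subspace_kernel this]
  have 2: "vec.dim Hll1 + vec.dim {v. M *v v = 0} \<le> CARD('m)" .
  have 3: "vec.dim (range ((*v) M)) + vec.dim {v. M *v v = 0} = CARD('m)"
    using dim_orthogonal_comp[OF subspace_range[of M]] selfadjoint_kernel[OF selfadjoint_M] by simp
  show ?thesis
    using 1 2 3 H'(10) dim_Hll dim_kernel_range by linarith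
qed

end

end

text \<open>\<open>K \<inter> Z\<^sup>\<bottom>\<close> and \<open>Z\<close> are coupled nondegenerately by \<open>\<Omega>\<close>, so that \<open>Ran M\<close> is the direct sum of
  \<open>K \<inter> Z\<^sup>\<bottom>\<close> and its image under \<open>M\<close>.\<close>

lemma dim_range_M:
  assumes Z: "vec.subspace Z" "Z \<subseteq> K" and \<Omega>Z: "\<And>z. z \<in> Z \<Longrightarrow> \<Omega> *v z \<in> Z\<^sup>\<bottom>"
    and nondeg: "\<And>u. u \<in> K \<Longrightarrow> u \<in> Z\<^sup>\<bottom> \<Longrightarrow> \<Omega> *v u \<in> Z\<^sup>\<bottom> \<Longrightarrow> u = 0"
  shows "vec.dim (range ((*v) M)) + 2 * vec.dim Z = 2 * vec.dim K"
proof -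
  define L where "L = K \<inter> Z\<^sup>\<bottom>"
  have subL: "vec.subspace L"
    unfolding L_def by (intro vec.subspace_inter subspace_kernel vec_subspace_orthogonal_comp Z(1))
  have Pz: "P *v z = z" if "z \<in> Z" for z using that Z(2) by (intro P(4)) auto
  have inner_P: "z \<bullet> (P *v v) = z \<bullet> v" if "z \<in> Z" for z v
    using selfadjointD[OF P(2), of z v] Pz[OF that] by simp
  have P_L: "P *v v \<in> L" if "v \<in> Z\<^sup>\<bottom>" for v
    using that P(3) inner_P by (auto simp: L_def orthogonal_comp_altdef)
  have M_L: "M *v u = P *v (\<Omega> *v u)" if "u \<in> L" for u
    using P(4)[of u] that by (simp add: M_vec L_def)
  have M_Z: "M *v z \<in> L" if "z \<in> Z" for z
    unfolding M_vec Pz[OF that] by (intro P_L \<Omega>Z that)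
  \<comment> \<open>Membership of \<open>M *v u\<close> in \<open>L\<close> says that
    \<open>\<Omega> *v u\<close> is orthogonal to \<open>Z\<close>, so this is the nondegeneracy
    hypothesis restated for the compression.\<close>
  have zero: "u = 0" if u: "u \<in> L" "M *v u \<in> L" for u
  proof (rule nondeg)
    show "u \<in> K" "u \<in> Z\<^sup>\<bottom>" using u by (auto simp: L_def)
    show "\<Omega> *v u \<in> Z\<^sup>\<bottom>"
      using u(2) inner_P unfolding M_L[OF u(1)] by (auto simp: L_def orthogonal_comp_altdef)
  qed
  have subMZ: "vec.subspace ((*v) M ` Z)"
    by (rule vec.linear_subspace_image[OF matrix_vector_mul_linear_gen Z(1)])
  \<comment> \<open>If \<open>u\<close> in \<open>L\<close> is orthogonal to the image of
    \<open>Z\<close>, then \<open>M *v u\<close> is orthogonal to \<open>Z\<close>, hence lies in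
    \<open>L\<close>, and \<open>zero\<close> applies.\<close>
  have MZ: "(*v) M ` Z = L"
  proof (rule subspace_eqI_orthogonal[OF subMZ subL])
    show "(*v) M ` Z \<subseteq> L" using M_Z by auto
    fix u assume u: "u \<in> L" "u \<in> ((*v) M ` Z)\<^sup>\<bottom>"
    have "z \<bullet> (M *v u) = 0" if "z \<in> Z" for z
      using u(2) that selfadjointD[OF selfadjoint_M, of z u] by (auto simp: orthogonal_comp_altdef)
    then have "M *v u \<in> L"
      using range_M_subset by (auto simp: L_def orthogonal_comp_altdef)
    then show "u = 0" by (rule zero[OF u(1)])
  qed
  have subML: "vec.subspace ((*v) M ` L)"
    by (rule vec.linear_subspace_image[OF matrix_vector_mul_linear_gen subL])
  have K_ds: "direct_sum K Z L"
    unfolding direct_sum_def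
  proof
    show "Z \<inter> L = {0}"
      using orthogonal_comp_Int[of Z] vec.subspace_0[OF Z(1)] vec.subspace_0[OF subL] by (auto simp: L_def)
    show "K = {u + w |u w. u \<in> Z \<and> w \<in> L}"
    proof (intro equalityI subsetI)
      fix v assume v: "v \<in> K"
      obtain z y where zy: "v = z + y" "z \<in> Z" "y \<in> Z\<^sup>\<bottom>"
        using orthogonal_comp_decomp[OF Z(1), of v] by blast
      have "v - z \<in> K"
        using v zy(2) Z(2) by (intro vec.subspace_diff subspace_kernel) auto
      with zy show "v \<in> {u + w |u w. u \<in> Z \<and> w \<in> L}" by (auto simp: L_def)
    next
      fix v assume "v \<in> {u + w |u w. u \<in> Z \<and> w \<in> L}"
      then show "v \<in> K"
        using Z(2) by (auto simp: L_def matrix_vector_right_distrib)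
    qed
  qed
  \<comment> \<open>As Ker \<open>B\<close> is \<open>Z\<close> + \<open>L\<close> and
    \<open>M\<close> maps \<open>Z\<close> onto \<open>L\<close>, the range is the image of
    \<open>L\<close> plus \<open>L\<close>. By \<open>zero\<close> this sum is direct and
    \<open>M\<close> is injective on \<open>L\<close>, so the rank is twice the dimension of
    \<open>L\<close>.\<close>
  have "direct_sum (range ((*v) M)) ((*v) M ` L) L"
    unfolding direct_sum_def
  proof
    have "y = 0" if "y \<in> (*v) M ` L" "y \<in> L" for y
      using that zero by (metis imageE matrix_vector_mult_0_right)
    then show "(*v) M ` L \<inter> L = {0}"
      using vec.subspace_0[OF subL] vec.subspace_0[OF subML] by blast
    show "range ((*v) M) = {u + w |u w. u \<in> (*v) M ` L \<and> w \<in> L}"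
    proof (intro equalityI subsetI)
      fix y assume "y \<in> range ((*v) M)"
      then obtain v where y: "y = M *v v" by auto
      have "P *v v \<in> K" by (rule P(3))
      then obtain z u where zu: "P *v v = z + u" "z \<in> Z" "u \<in> L"
        using K_ds unfolding direct_sum_def by blast
      have "y = M *v (P *v v)" by (simp add: y M_vec P(1))
      also have "\<dots> = M *v u + M *v z" by (simp add: zu matrix_vector_right_distrib)
      finally show "y \<in> {u + w |u w. u \<in> (*v) M ` L \<and> w \<in> L}"
        using zu M_Z by blast
    next
      fix y assume "y \<in> {u + w |u w. u \<in> (*v) M ` L \<and> w \<in> L}"
      then obtain u w where uw: "y = u + w" "u \<in> (*v) M ` L" "w \<in> (*v) M ` Z"
        unfolding MZ by blast
      then show "y \<in> range ((*v) M)"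
        by (auto intro!: vec.subspace_add subspace_range)
    qed
  qed
  from direct_sum_dim[OF this subML subL]
  have "vec.dim (range ((*v) M)) = vec.dim ((*v) M ` L) + vec.dim L" .
  moreover have "vec.dim ((*v) M ` L) = vec.dim L"
  proof (rule vec.dim_image_eq[OF matrix_vector_mul_linear_gen])
    have "inj_on ((*v) M) L"
      using vec.linear_inj_on_iff_eq_0[OF matrix_vector_mul_linear_gen subL, of M] zero
        vec.subspace_0[OF subL] by auto
    then show "inj_on ((*v) M) (vec.span L)"
      using subL by (simp add: vec.span_eq_iff[THEN iffD2])
  qed
  moreover have "vec.dim K = vec.dim Z + vec.dim L"
    by (rule direct_sum_dim[OF K_ds Z(1) subL])
  ultimately show ?thesis by simp
qed

end

section \<open>Application to the system operator\<close>

theorem theorem33: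
  fixes \<alpha> \<eta> \<theta> R :: "real^'n^'n"
    and \<beta> \<omega>max bmin \<rho>min cb :: real
    and b :: "nat \<Rightarrow> real"
    and N N\<^sub>R :: nat
    and \<Omega> B A P :: "complex^('n + 'n)^('n + 'n)"
    and \<sigma>0 \<sigma>1 :: "complex set"
  assumes \<alpha>: "pos_def \<alpha>"
    and \<eta>: "psd \<eta>"
    and \<theta>: "transpose \<theta> = - \<theta>"
    and R: "psd R"
    and \<beta>: "0 \<le> \<beta>"
    and N: "N = CARD('n)"
    and N\<^sub>R: "N\<^sub>R = rank R" "0 < N\<^sub>R"
    and \<Omega>: "\<Omega> = \<Omega>_matrix \<alpha> \<eta> \<theta>"
    and B: "B = B_matrix \<alpha> R"
    and A: "A = \<Omega> - cscale (\<i> * of_real \<beta>) B"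
    and P: "P = orthogonal_projection {v. B *v v = 0}"
    and \<omega>max: "\<omega>max = onorm ((*v) \<Omega>)"
    and bmin: "bmin = min_nonzero_eigenvalue B"
    and b: "\<And>j. b j = zero_and_nonzero_eigenvalues B ! j"
    and \<sigma>0: "\<sigma>0 = spectrum A \<inter> cball (- \<i> * of_real \<beta> * of_real (b 0)) \<omega>max"
    and \<sigma>1: "\<sigma>1 = spectrum A \<inter> (\<Union>j\<in>{1..N\<^sub>R}. cball (- \<i> * of_real \<beta> * of_real (b j)) \<omega>max)"
    and \<rho>min: "P ** \<Omega> ** P \<noteq> 0" "\<rho>min = min_pos_eigenvalue (P ** \<Omega> ** P)"
    and cb: "cb = c_bound \<omega>max bmin \<beta>"
    and rank_less: "N\<^sub>R < N"
    and \<beta>_gt: "\<beta> > c_bound_inv \<omega>max bmin (\<rho>min / 2)"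
  shows
    "\<beta> > 2 * (\<omega>max / bmin) \<and> cb < \<rho>min / 2 \<and> \<rho>min / 2 \<le> \<omega>max / 2 \<and>

     spectrum A = \<sigma>0 \<union> \<sigma>1 \<and> \<sigma>0 \<inter> \<sigma>1 = {} \<and>
     (\<exists>!H. spectral_splitting A UNIV \<sigma>1 \<sigma>0 (fst H) (snd H)) \<and>
     (\<forall>Hhl Hll. spectral_splitting A UNIV \<sigma>1 \<sigma>0 Hhl Hll \<longrightarrow>
       vec.dim Hhl = N\<^sub>R \<and> vec.dim Hll = 2 * N - N\<^sub>R \<and>

       spectrum_on A Hll = {\<zeta> \<in> spectrum A. 0 \<le> - Im \<zeta> \<and> - Im \<zeta> \<le> \<omega>max} \<and>
       spectrum_on A Hhl = {\<zeta> \<in> spectrum A. - Im \<zeta> \<ge> \<beta> * bmin - \<omega>max} \<and>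
       \<beta> * bmin - \<omega>max > \<omega>max \<and>
       (MAX \<zeta>\<in>spectrum_on A Hhl. quality_factor \<zeta>) \<le> ereal (1 / 2 * (\<omega>max / (\<beta> * bmin - \<omega>max))) \<and>
       1 / 2 * (\<omega>max / (\<beta> * bmin - \<omega>max)) < 1 / 2 \<and>
       (MAX \<zeta>\<in>spectrum_on A Hll. MIN \<rho>\<in>spectrum (P ** \<Omega> ** P). cmod (\<zeta> - \<rho>)) \<le> cb \<and>
       (\<forall>\<zeta>\<in>spectrum_on A Hll.
          (MIN \<rho>\<in>spectrum (P ** \<Omega> ** P). cmod (of_real (Re \<zeta>) - \<rho>)) \<in> {0..cb} \<and>
          - Im \<zeta> \<in> {0..cb}) \<and>

       (\<exists>!H. spectral_splitting A Hll
               (spectrum A \<inter> cball 0 cb)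
               (spectrum A \<inter> (\<Union>\<rho>\<in>spectrum (P ** \<Omega> ** P) - {0}. cball \<rho> cb))
               (fst H) (snd H)) \<and>
       (\<forall>Hll0 Hll1.
          spectral_splitting A Hll
            (spectrum A \<inter> cball 0 cb)
            (spectrum A \<inter> (\<Union>\<rho>\<in>spectrum (P ** \<Omega> ** P) - {0}. cball \<rho> cb))
            Hll0 Hll1 \<longrightarrow>

          spectrum_on A Hll1 = spectrum A \<inter> {\<zeta>. \<rho>min / 2 < cmod \<zeta> \<and> cmod \<zeta> \<le> \<omega>max} \<and>
          spectrum_on A Hll0 = spectrum A \<inter> {\<zeta>. cmod \<zeta> < \<rho>min / 2} \<and>

          vec.dim Hll1 = vec.dim (range ((*v) (P ** \<Omega> ** P))) \<and>
          int (vec.dim Hll0) = 2 * int N - int N\<^sub>R - int (vec.dim Hll1) \<and>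
          ({x. R *v x = 0} \<inter> {x. \<eta> *v x = 0} = {0} \<longrightarrow>
             vec.dim Hll1 = 2 * (N - N\<^sub>R))))"
proof -
  have selfB: "selfadjoint B" and B_nonneg: "\<And>v. 0 \<le> v \<bullet> (B *v v)"
    unfolding B by (rule B_matrix_nonneg[OF \<alpha> R])+
  have rank_B: "vec.dim (range ((*v) B)) = N\<^sub>R"
    unfolding B N\<^sub>R(1) by (rule rank_B_matrix[OF \<alpha>])
  have "B \<noteq> 0"
  proof
    assume "B = 0"
    then have "range ((*v) B) \<subseteq> {0}" by auto
    then show False using rank_B N\<^sub>R(2) vec.dim_eq_0[of "range ((*v) B)"] by simp
  qed
  define M where "M = P ** \<Omega> ** P"
  interpret S: overdamped \<Omega> B A P M \<beta> \<omega>max bmin \<rho>min cb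
  proof unfold_locales
    show "selfadjoint \<Omega>" "map_matrix cnj \<Omega> = - \<Omega>" "map_matrix cnj B = B"
      unfolding \<Omega> B by (rule selfadjoint_\<Omega>_matrix[OF \<alpha> \<theta>] cnj_\<Omega>_matrix cnj_B_matrix)+
  qed (fact selfB B_nonneg \<open>B \<noteq> 0\<close> \<beta> A P \<rho>min[folded M_def] M_def \<omega>max bmin cb \<beta>_gt refl)+
  have b0: "b 0 = 0" and bX: "b ` {1..N\<^sub>R} = S.X"
    using zero_and_nonzero_eigenvalues[OF selfB] by (simp_all add: b rank_B S.X_def)
  have \<sigma>0_eq: "\<sigma>0 = S.\<sigma>0"
    by (simp add: \<sigma>0 b0 S.\<sigma>0_def)
  have "(\<Union>j\<in>{1..N\<^sub>R}. cball (- \<i> * of_real \<beta> * of_real (b j)) \<omega>max)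
      = (\<Union>x\<in>S.X. cball (- \<i> * of_real \<beta> * of_real x) \<omega>max)"
    unfolding bX[symmetric] by (simp add: image_image)
  then have \<sigma>1_eq: "\<sigma>1 = S.\<sigma>1"
    by (simp only: \<sigma>1 S.\<sigma>1_def)
  have dim_K: "vec.dim S.K = 2 * N - N\<^sub>R"
    using S.dim_kernel_range rank_B by (simp add: N)
  have dim_M: "vec.dim (range ((*v) M)) = 2 * (N - N\<^sub>R)"
    if "{x. R *v x = 0} \<inter> {x. \<eta> *v x = 0} = {0}"
  proof -
    \<comment> \<open>\<open>Z\<close> is the second summand: \<open>B\<close> vanishes on it, and
      the zero lower right block of \<open>\<Omega>\<close> makes \<open>\<Omega>\<close> map it
      into its orthogonal complement.\<close>
    define Z :: "(complex^('n + 'n)) set" where "Z = range inr_vec"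
    have Z_iff: "z \<in> Z \<longleftrightarrow> left_part z = 0" for z
    proof
      assume "left_part z = 0"
      then have "z = inr_vec (right_part z)" by (intro sum_type_vec_eqI) simp_all
      then show "z \<in> Z" unfolding Z_def by (rule range_eqI)
    qed (auto simp: Z_def)
    have Z_perp: "v \<in> Z\<^sup>\<bottom> \<longleftrightarrow> right_part v = 0" for v
    proof
      assume "v \<in> Z\<^sup>\<bottom>"
      then have "inr_vec (right_part v) \<bullet> v = 0"
        by (auto simp: orthogonal_comp_altdef Z_def)
      then show "right_part v = 0" by (simp add: inner_parts)
    qed (auto simp: orthogonal_comp_altdef Z_iff inner_parts)
    have subZ: "vec.subspace Z"
      unfolding Z_def by (rule vec.linear_subspace_image[OF linear_inr_vec vec.subspace_UNIV])
    have dim_Z: "vec.dim Z = N"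
      unfolding Z_def vec_dim_image_inr by (simp only: vec_dim_card N)
    have "vec.dim (range ((*v) M)) + 2 * vec.dim Z = 2 * vec.dim S.K"
    proof (rule S.dim_range_M[OF subZ])
      show "Z \<subseteq> S.K"
      proof
        fix z assume "z \<in> Z"
        then show "z \<in> S.K"
          unfolding B Z_iff by (simp add: B_matrix_vec) (rule sum_type_vec_eqI, simp_all)
      qed
      show "\<Omega> *v z \<in> Z\<^sup>\<bottom>" if "z \<in> Z" for z
        using that \<Omega>_matrix_inr unfolding Z_iff Z_perp \<Omega> by blast
      show "u = 0" if "u \<in> S.K" "u \<in> Z\<^sup>\<bottom>" "\<Omega> *v u \<in> Z\<^sup>\<bottom>" for u
        using \<Omega>_B_matrix_kernel[OF \<alpha> \<eta> \<open>{x. R *v x = 0} \<inter> {x. \<eta> *v x = 0} = {0}\<close>, of u \<theta>] that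
        unfolding Z_perp B \<Omega> by simp
    qed
    then show ?thesis
      using rank_less unfolding dim_K dim_Z by simp
  qed

  have gap: "\<beta> * bmin - \<omega>max > \<omega>max" using S.gap_bounds(2) by simp
  have split_iff: "spectral_splitting A UNIV \<sigma>1 \<sigma>0 Hhl Hll \<longleftrightarrow> spectral_splitting A UNIV S.\<sigma>1 S.\<sigma>0 Hhl Hll" for Hhl Hll
    by (simp only: \<sigma>0_eq \<sigma>1_eq)
  have ex1: "\<exists>!H. spectral_splitting A UNIV \<sigma>1 \<sigma>0 (fst H) (snd H)"
    unfolding split_iff using S.spectrum_A S.\<sigma>_disjoint
    by (intro spectral_splitting_unique_exists) auto
  have low: "spectral_splitting A Hll (spectrum A \<inter> cball 0 cb)
      (spectrum A \<inter> (\<Union>\<rho>\<in>spectrum M - {0}. cball \<rho> cb)) U W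
      \<longleftrightarrow> spectral_splitting A Hll S.\<tau>0 S.\<tau>1 U W" for Hll U W
    by (simp only: S.\<tau>0_def S.\<tau>1_def)
  have fin_M: "finite (f ` spectrum M)" "f ` spectrum M \<noteq> {}" for f :: "complex \<Rightarrow> real"
    using S.\<rho>(1) by auto
  have Min_le: "Min ((\<lambda>\<rho>. cmod (\<zeta> - \<rho>)) ` spectrum M) \<le> cb"
      "Min ((\<lambda>\<rho>. cmod (of_real (Re \<zeta>) - \<rho>)) ` spectrum M) \<in> {0..cb}" "- Im \<zeta> \<in> {0..cb}"
    if \<zeta>: "\<zeta> \<in> S.\<sigma>0" for \<zeta>
  proof -
    obtain x where x: "complex_of_real x \<in> spectrum M" "cmod (of_real x - \<zeta>) \<le> cb"
      by (rule S.low_loss_eigenvalue[OF \<zeta>])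
    have "cmod (\<zeta> - of_real x) \<le> cb" using x(2) by (simp add: norm_minus_commute)
    then show "Min ((\<lambda>\<rho>. cmod (\<zeta> - \<rho>)) ` spectrum M) \<le> cb"
      using x(1) fin_M by (subst Min_le_iff) auto
    have "cmod (of_real (Re \<zeta>) - of_real x) = \<bar>Re (\<zeta> - of_real x)\<bar>"
      by (simp flip: of_real_diff)
    also have "\<dots> \<le> cb"
      using abs_Re_le_cmod[of "\<zeta> - of_real x"] \<open>cmod (\<zeta> - of_real x) \<le> cb\<close> by linarith
    finally have "Min ((\<lambda>\<rho>. cmod (of_real (Re \<zeta>) - \<rho>)) ` spectrum M) \<le> cb"
      using x(1) fin_M by (subst Min_le_iff) auto
    moreover have "0 \<le> Min ((\<lambda>\<rho>. cmod (of_real (Re \<zeta>) - \<rho>)) ` spectrum M)"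
      using fin_M by (subst Min_ge_iff) auto
    ultimately show "Min ((\<lambda>\<rho>. cmod (of_real (Re \<zeta>) - \<rho>)) ` spectrum M) \<in> {0..cb}" by simp
    have "\<bar>Im \<zeta>\<bar> \<le> cb" using abs_Im_le_cmod[of "of_real x - \<zeta>"] x(2) by simp
    then show "- Im \<zeta> \<in> {0..cb}" using S.\<sigma>0_D[OF \<zeta>] by auto
  qed
  have low_part: "spectrum_on A W = spectrum A \<inter> {\<zeta>. \<rho>min / 2 < cmod \<zeta> \<and> cmod \<zeta> \<le> \<omega>max}"
      "spectrum_on A U = spectrum A \<inter> {\<zeta>. cmod \<zeta> < \<rho>min / 2}"
      "vec.dim W = vec.dim (range ((*v) M))"
      "int (vec.dim U) = 2 * int N - int N\<^sub>R - int (vec.dim W)"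
      "{x. R *v x = 0} \<inter> {x. \<eta> *v x = 0} = {0} \<Longrightarrow> vec.dim W = 2 * (N - N\<^sub>R)"
    if split: "spectral_splitting A UNIV S.\<sigma>1 S.\<sigma>0 Hhl Hll"
      and split': "spectral_splitting A Hll S.\<tau>0 S.\<tau>1 U W" for Hhl Hll U W
  proof -
    note D = spectral_splittingD[OF split']
    have mem: "\<zeta> \<in> S.\<tau>0 \<or> \<zeta> \<in> S.\<tau>1" if "\<zeta> \<in> spectrum A" "cmod \<zeta> \<le> \<omega>max" for \<zeta>
    proof -
      have "\<zeta> \<in> S.\<sigma>0" using that by (simp add: S.\<sigma>0_def)
      then show ?thesis using S.\<tau>_split(1) by blast
    qed
    show "spectrum_on A W = spectrum A \<inter> {\<zeta>. \<rho>min / 2 < cmod \<zeta> \<and> cmod \<zeta> \<le> \<omega>max}"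
      unfolding D(5)
    proof (intro equalityI subsetI)
      fix \<zeta> assume "\<zeta> \<in> S.\<tau>1"
      then show "\<zeta> \<in> spectrum A \<inter> {\<zeta>. \<rho>min / 2 < cmod \<zeta> \<and> cmod \<zeta> \<le> \<omega>max}"
        using S.\<tau>1_D[of \<zeta>] S.\<sigma>0_D[of \<zeta>] by blast
    next
      fix \<zeta> assume "\<zeta> \<in> spectrum A \<inter> {\<zeta>. \<rho>min / 2 < cmod \<zeta> \<and> cmod \<zeta> \<le> \<omega>max}"
      then show "\<zeta> \<in> S.\<tau>1"
        using mem[of \<zeta>] S.\<tau>0_D[of \<zeta>] by auto
    qed
    show "spectrum_on A U = spectrum A \<inter> {\<zeta>. cmod \<zeta> < \<rho>min / 2}"
      unfolding D(4)
    proof (intro equalityI subsetI)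
      fix \<zeta> assume "\<zeta> \<in> S.\<tau>0"
      then show "\<zeta> \<in> spectrum A \<inter> {\<zeta>. cmod \<zeta> < \<rho>min / 2}"
        using S.\<tau>0_D[of \<zeta>] S.\<sigma>0_D[of \<zeta>] by blast
    next
      fix \<zeta> assume \<zeta>: "\<zeta> \<in> spectrum A \<inter> {\<zeta>. cmod \<zeta> < \<rho>min / 2}"
      then have "cmod \<zeta> \<le> \<omega>max" using S.\<rho>_le S.\<rho>(2) by simp
      with \<zeta> show "\<zeta> \<in> S.\<tau>0"
        using mem[of \<zeta>] S.\<tau>1_D[of \<zeta>] by auto
    qed
    show dim_W: "vec.dim W = vec.dim (range ((*v) M))"
      by (rule S.dim_Hll1[OF split split'])
    have "vec.dim U + vec.dim W = 2 * N - N\<^sub>R"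
      using D(10) S.dim_Hll[OF split] dim_K by simp
    then show "int (vec.dim U) = 2 * int N - int N\<^sub>R - int (vec.dim W)"
      using rank_less by linarith
    show "vec.dim W = 2 * (N - N\<^sub>R)" if "{x. R *v x = 0} \<inter> {x. \<eta> *v x = 0} = {0}"
      using dim_W dim_M[OF that] by simp
  qed
  have main: "vec.dim Hhl = N\<^sub>R" "vec.dim Hll = 2 * N - N\<^sub>R"
      "spectrum_on A Hll = {\<zeta> \<in> spectrum A. 0 \<le> - Im \<zeta> \<and> - Im \<zeta> \<le> \<omega>max}"
      "spectrum_on A Hhl = {\<zeta> \<in> spectrum A. - Im \<zeta> \<ge> \<beta> * bmin - \<omega>max}"
      "(MAX \<zeta>\<in>spectrum_on A Hhl. quality_factor \<zeta>) \<le> ereal (1 / 2 * (\<omega>max / (\<beta> * bmin - \<omega>max)))"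
      "(MAX \<zeta>\<in>spectrum_on A Hll. MIN \<rho>\<in>spectrum M. cmod (\<zeta> - \<rho>)) \<le> cb"
    if split: "spectral_splitting A UNIV S.\<sigma>1 S.\<sigma>0 Hhl Hll" for Hhl Hll
  proof -
    note D = spectral_splittingD[OF split]
    show dim_hl: "vec.dim Hhl = N\<^sub>R" using S.dim_Hhl[OF split] rank_B by simp
    show dim_ll: "vec.dim Hll = 2 * N - N\<^sub>R" using S.dim_Hll[OF split] dim_K by simp
    have nonempty: "spectrum_on A V \<noteq> {}" if "invariant_subspace A V" "vec.dim V \<noteq> 0" for V
      using subspace_0_if_spectrum_on_empty[OF that(1)] that(2) by auto
    \<comment> \<open>\<open>Max\<close> says nothing useful about an empty set, so both spectra
      must be nonempty; this follows from the positive dimensions.\<close>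
    have ne: "S.\<sigma>1 \<noteq> {}" "S.\<sigma>0 \<noteq> {}"
      using nonempty[OF D(1)] nonempty[OF D(2)] dim_hl dim_ll N\<^sub>R(2) rank_less unfolding D(4,5) by auto
    have fin: "finite S.\<sigma>1" "finite S.\<sigma>0" by (auto simp: S.\<sigma>1_def S.\<sigma>0_def)
    have mem: "\<zeta> \<in> S.\<sigma>0 \<or> \<zeta> \<in> S.\<sigma>1" if "\<zeta> \<in> spectrum A" for \<zeta>
      using that S.spectrum_A by blast
    show "spectrum_on A Hll = {\<zeta> \<in> spectrum A. 0 \<le> - Im \<zeta> \<and> - Im \<zeta> \<le> \<omega>max}"
      unfolding D(5)
    proof (intro equalityI subsetI)
      fix \<zeta> assume "\<zeta> \<in> S.\<sigma>0"
      then show "\<zeta> \<in> {\<zeta> \<in> spectrum A. 0 \<le> - Im \<zeta> \<and> - Im \<zeta> \<le> \<omega>max}"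
        using S.\<sigma>0_D[of \<zeta>] by auto
    next
      fix \<zeta> assume "\<zeta> \<in> {\<zeta> \<in> spectrum A. 0 \<le> - Im \<zeta> \<and> - Im \<zeta> \<le> \<omega>max}"
      then show "\<zeta> \<in> S.\<sigma>0"
        using mem[of \<zeta>] S.\<sigma>1_D[of \<zeta>] gap by auto
    qed
    show "spectrum_on A Hhl = {\<zeta> \<in> spectrum A. - Im \<zeta> \<ge> \<beta> * bmin - \<omega>max}"
      unfolding D(4)
    proof (intro equalityI subsetI)
      fix \<zeta> assume "\<zeta> \<in> S.\<sigma>1"
      then show "\<zeta> \<in> {\<zeta> \<in> spectrum A. - Im \<zeta> \<ge> \<beta> * bmin - \<omega>max}"
        using S.\<sigma>1_D[of \<zeta>] by auto
    next
      fix \<zeta> assume "\<zeta> \<in> {\<zeta> \<in> spectrum A. - Im \<zeta> \<ge> \<beta> * bmin - \<omega>max}"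
      then show "\<zeta> \<in> S.\<sigma>1"
        using mem[of \<zeta>] S.\<sigma>0_D[of \<zeta>] gap by auto
    qed
    have "quality_factor \<zeta> \<le> ereal (1 / 2 * (\<omega>max / (\<beta> * bmin - \<omega>max)))" if "\<zeta> \<in> S.\<sigma>1" for \<zeta>
    proof -
      have *: "\<bar>Re \<zeta>\<bar> \<le> \<omega>max" "\<beta> * bmin - \<omega>max \<le> - Im \<zeta>" "0 < \<beta> * bmin - \<omega>max"
        using S.\<sigma>1_D[OF that] gap S.\<omega>_pos by auto
      then have "\<bar>Re \<zeta>\<bar> / (- Im \<zeta>) \<le> \<omega>max / (\<beta> * bmin - \<omega>max)"
        by (intro frac_le) auto
      then have "1 / 2 * (\<bar>Re \<zeta>\<bar> / (- Im \<zeta>)) \<le> 1 / 2 * (\<omega>max / (\<beta> * bmin - \<omega>max))"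
        by (rule mult_left_mono) simp
      \<comment> \<open>This rules out the special values 0 and infinity of the quality
        factor.\<close>
      moreover have "Im \<zeta> \<noteq> 0" using * by auto
      ultimately show ?thesis unfolding quality_factor_def by (simp only: if_False ereal_less_eq)
    qed
    then show "(MAX \<zeta>\<in>spectrum_on A Hhl. quality_factor \<zeta>) \<le> ereal (1 / 2 * (\<omega>max / (\<beta> * bmin - \<omega>max)))"
      unfolding D(4) using fin ne by (subst Max_le_iff) auto
    show "(MAX \<zeta>\<in>spectrum_on A Hll. MIN \<rho>\<in>spectrum M. cmod (\<zeta> - \<rho>)) \<le> cb"
      unfolding D(5) using fin ne Min_le(1) by (subst Max_le_iff) auto
  qed
  have half: "1 / 2 * (\<omega>max / (\<beta> * bmin - \<omega>max)) < 1 / 2"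
    using gap S.\<omega>_pos by (simp add: field_simps)
  have low_bounds: "(MIN \<rho>\<in>spectrum M. cmod (of_real (Re \<zeta>) - \<rho>)) \<in> {0..cb}" "- Im \<zeta> \<in> {0..cb}"
    if "spectral_splitting A UNIV S.\<sigma>1 S.\<sigma>0 Hhl Hll" "\<zeta> \<in> spectrum_on A Hll" for Hhl Hll \<zeta>
    using spectral_splittingD(5)[OF that(1)] that(2) Min_le(2,3) by blast+
  show ?thesis
    unfolding split_iff low M_def[symmetric]
  proof (intro conjI allI impI ballI)
    show "\<beta> > 2 * (\<omega>max / bmin)" "cb < \<rho>min / 2" "\<rho>min / 2 \<le> \<omega>max / 2"
      using S.gap_bounds(1,3) S.\<rho>_le by simp_all
    show "spectrum A = \<sigma>0 \<union> \<sigma>1" "\<sigma>0 \<inter> \<sigma>1 = {}"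
      unfolding \<sigma>0_eq \<sigma>1_eq by (rule S.spectrum_A S.\<sigma>_disjoint)+
    show "\<exists>!H. spectral_splitting A UNIV S.\<sigma>1 S.\<sigma>0 (fst H) (snd H)"
      by (rule ex1[unfolded split_iff])
  qed (erule main S.low_loss_splitting | erule (1) low_part low_bounds | erule (2) low_part(5)
      | rule gap half)+
qed

end
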